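(* Let $Y$ be a compact Riemann surface and $(\beta,f):\mathcal X\to Y\times S$ a holomorphic family of coverings of Riemann surfaces whose fibers $X_s=f^{-1}(s)$ have genus $>1$. For a tangent vector $\partial_s$ of $S$ at $s$ with horizontal lift $v_s$, the push-forward $u_s=\beta_*(v_s)|_{X_s}$ lies in $H_{X_s/Y}$ and is a generalized harmonic representative of the characteristic map, i.e. $u_s$ corresponds to $\tau_s(\partial_s)$ under the identification $H_{X_s/Y}\cong H^0(X_s,N_{\beta_s})$.
   Context: A holomorphic family of coverings consists of a proper holomorphic submersion $f:\mathcal X\to S$ of complex manifolds with fibers $X_s$ compact Riemann surfaces, together with a holomorphic map $\beta:\mathcal X\to Y$ such that each $\beta_s=\beta|_{X_s}:X_s\to Y$ is non-constant. Let $(z,s)$ be local coordinates on $\mathcal X$ with $f(z,s)=s$, let $w$ be a local coordinate on $Y$, and let $\sqrt{-1}\,g(z,s)\,dz\wedge d\bar z$ be the hyperbolic metric on $X_s$ of constant Ricci curvature $-1$ ($\partial_z\partial_{\bar z}\log g=g$). The horizontal lift of $\partial_s$ is $v_s=\partial_s+a_s^z\partial_z$ with $a_s^z=-g^{-1}\,\partial_s\partial_{\bar z}\log g$ (orthogonal to the fibers with respect to $\sqrt{-1}\,\partial\bar\partial\log g$). In coordinates $u_s=\left(\frac{\partial\beta}{\partial s}+a_s^z\frac{\partial\beta}{\partial z}\right)\partial_w\in A^{0,0}(X_s,\beta_s^*T_Y)$. $N_{\beta_s}=\mathrm{coker}(d\beta_s:T_{X_s}\to\beta_s^*T_Y)$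 is the normal sheaf, with projection $P:\beta_s^*T_Y\to N_{\beta_s}$. The characteristic map $\tau_s:T_sS\to H^0(X_s,N_{\beta_s})$ sends $\partial_s$ to the global section given locally by $P\left(\frac{\partial\beta}{\partial s}\,\partial_w\right)$, where $\partial\beta/\partial s$ is taken in any local holomorphic coordinates $(z,s)$ on $\mathcal X$ with $f(z,s)=s$ and with $\beta$ expressed in the local coordinate $w$ on $Y$. $H_{X_s/Y}=\{\chi\in A^{0,0}(X_s,\beta_s^*T_Y):\bar\partial\chi\in\beta_{s*}(\mathcal H^{0,1}(X_s,T_{X_s}))\}$, where $\mathcal H^{0,1}(X_s,T_{X_s})$ is the space of $\bar\partial$-harmonic $T_{X_s}$-valued $(0,1)$-forms for the hyperbolic metric and $\beta_{s*}:A^{0,1}(X_s,T_{X_s})\to A^{0,1}(X_s,\beta_s^*T_Y)$ is induced by $d\beta_s$. Elements of $H_{X_s/Y}$ are called generalized harmonic representatives. The identification $H_{X_s/Y}\cong H^0(X_s,N_{\beta_s})$ is as follows: if $\bar\partial\chi=\beta_{s*}\vartheta$ and locally on open sets $U_i$ one writes $\vartheta=\bar\partial\eta_i$ with $\eta_i$ a smooth section of $T_{X_s}$, then $\chi$ corresponds to the section of $N_{\beta_s}$ given on $U_i$ by $P(\chi-\beta_{s*}\eta_i)$. *)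

theory Defs
  imports "HOL-Complex_Analysis.Complex_Analysis" "HOL-Homology.Homology"
begin

section \<open>Complex model spaces and calculus on them\<close>

text \<open>Finite-dimensional complex vector spaces, presented as Euclidean spaces with a complex
  structure \<open>mul_i\<close> (multiplication by the imaginary unit).\<close>

class complex_euclidean = euclidean_space +
  fixes mul_i :: "'a \<Rightarrow> 'a"
  assumes mul_i_add: "mul_i (x + y) = mul_i x + mul_i y"
    and mul_i_scaleR: "mul_i (r *\<^sub>R x) = r *\<^sub>R mul_i x"
    and mul_i_mul_i: "mul_i (mul_i x) = - x"

instantiation complex :: complex_euclidean
begin
definition mul_i_complex :: "complex \<Rightarrow> complex" where "mul_i_complex z = \<i> * z"
instance
  by standard (simp_all add: mul_i_complex_def algebra_simps flip: mult.assoc)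
end

instantiation vec :: (complex_euclidean, finite) complex_euclidean
begin
definition mul_i_vec :: "'a ^ 'b \<Rightarrow> 'a ^ 'b" where "mul_i_vec v = (\<chi> k. mul_i (v $ k))"
instance
  by standard (simp_all add: mul_i_vec_def vec_eq_iff mul_i_add mul_i_scaleR mul_i_mul_i)
end

instantiation prod :: (complex_euclidean, complex_euclidean) complex_euclidean
begin
definition mul_i_prod :: "'a \<times> 'b \<Rightarrow> 'a \<times> 'b" where "mul_i_prod v = (mul_i (fst v), mul_i (snd v))"
instance
  by standard (simp_all add: mul_i_prod_def mul_i_add mul_i_scaleR mul_i_mul_i prod_eq_iff)
end

definition cholomorphic_on ::
    "('a::complex_euclidean \<Rightarrow> 'b::complex_euclidean) \<Rightarrow> 'a set \<Rightarrow> bool" where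
  "cholomorphic_on F U \<longleftrightarrow>
     (\<forall>p\<in>U. \<exists>D. (F has_derivative D) (at p) \<and> (\<forall>v. D (mul_i v) = mul_i (D v)))"

text \<open>\<open>smooth_on F U\<close> is only used for open \<open>U\<close>.\<close>

primrec Ck_on :: "nat \<Rightarrow> ('a::real_normed_vector \<Rightarrow> 'b::real_normed_vector) \<Rightarrow> 'a set \<Rightarrow> bool" where
  "Ck_on 0 F U \<longleftrightarrow> continuous_on U F"
| "Ck_on (Suc k) F U \<longleftrightarrow>
     (\<forall>p\<in>U. F differentiable (at p)) \<and> (\<forall>v. Ck_on k (\<lambda>p. frechet_derivative F (at p) v) U)"

definition smooth_on :: "('a::real_normed_vector \<Rightarrow> 'b::real_normed_vector) \<Rightarrow> 'a set \<Rightarrow> bool" where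
  "smooth_on F U \<longleftrightarrow> (\<forall>k. Ck_on k F U)"

text \<open>Wirtinger derivatives along a vector \<open>v\<close>: for \<open>v\<close> the \<open>j\<close>-th unit vector of
  \<open>\<complex>\<^sup>m\<close> these are the partial derivatives with respect to \<open>z\<^sub>j\<close> and to its conjugate.
  \<open>wirt v F\<close> is complex linear in \<open>v\<close>, \<open>wirt_bar v F\<close> is antilinear in \<open>v\<close>.\<close>

definition wirt :: "'a::complex_euclidean \<Rightarrow> ('a \<Rightarrow> complex) \<Rightarrow> 'a \<Rightarrow> complex" where
  "wirt v F p = (frechet_derivative F (at p) v - \<i> * frechet_derivative F (at p) (mul_i v)) / 2"

definition wirt_bar :: "'a::complex_euclidean \<Rightarrow> ('a \<Rightarrow> complex) \<Rightarrow> 'a \<Rightarrow> complex" where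
  "wirt_bar v F p = (frechet_derivative F (at p) v + \<i> * frechet_derivative F (at p) (mul_i v)) / 2"

text \<open>Used below for quantities computed in a choice \<open>i \<in> I\<close> of local coordinates and
  independent of that choice.\<close>

definition common_value :: "'i set \<Rightarrow> ('i \<Rightarrow> 'b) \<Rightarrow> 'b" where
  "common_value I F = (THE t. \<forall>i\<in>I. t = F i)"

section \<open>Complex manifolds\<close>

type_synonym ('p, 'e) chart = "'p set \<times> ('p \<Rightarrow> 'e)"

text \<open>The atlas of a manifold need not be maximal.\<close>

record ('p, 'e) manifold =
  mtop :: "'p topology"
  atlas :: "('p, 'e) chart set"

abbreviation points :: "('p, 'e) manifold \<Rightarrow> 'p set" where
  "points M \<equiv> topspace (mtop M)"

definition is_chart :: "'p topology \<Rightarrow> ('p, 'e::complex_euclidean) chart \<Rightarrow> bool" where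
  "is_chart T c \<longleftrightarrow>
     openin T (fst c) \<and> open (snd c ` fst c) \<and>
     homeomorphic_map (subtopology T (fst c)) (top_of_set (snd c ` fst c)) (snd c)"

definition chart_inv :: "('p, 'e) chart \<Rightarrow> 'e \<Rightarrow> 'p" where
  "chart_inv c = inv_into (fst c) (snd c)"

definition compatible ::
    "('p, 'e::complex_euclidean) chart \<Rightarrow> ('p, 'e) chart \<Rightarrow> bool" where
  "compatible c c' \<longleftrightarrow>
     cholomorphic_on (snd c' \<circ> chart_inv c) (snd c ` (fst c \<inter> fst c')) \<and>
     cholomorphic_on (snd c \<circ> chart_inv c') (snd c' ` (fst c \<inter> fst c'))"

definition complex_manifold :: "('p, 'e::complex_euclidean) manifold \<Rightarrow> bool" where
  "complex_manifold M \<longleftrightarrow>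
     Hausdorff_space (mtop M) \<and> second_countable (mtop M) \<and>
     (\<forall>c\<in>atlas M. is_chart (mtop M) c) \<and> (\<Union>c\<in>atlas M. fst c) = points M \<and>
     (\<forall>c\<in>atlas M. \<forall>c'\<in>atlas M. compatible c c')"

text \<open>All local holomorphic coordinates (the maximal atlas).\<close>

definition charts :: "('p, 'e::complex_euclidean) manifold \<Rightarrow> ('p, 'e) chart set" where
  "charts M = {c. is_chart (mtop M) c \<and> (\<forall>c'\<in>atlas M. compatible c c')}"

definition holomorphic_map ::
    "('p, 'd::complex_euclidean) manifold \<Rightarrow> ('q, 'e::complex_euclidean) manifold \<Rightarrow> ('p \<Rightarrow> 'q) \<Rightarrow> bool"
  where
  "holomorphic_map M N F \<longleftrightarrow>
     continuous_map (mtop M) (mtop N) F \<and>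
     (\<forall>c\<in>atlas M. \<forall>d\<in>atlas N.
        cholomorphic_on (snd d \<circ> F \<circ> chart_inv c) (snd c ` (fst c \<inter> F -` fst d)))"

definition submersion ::
    "('p, 'd::complex_euclidean) manifold \<Rightarrow> ('q, 'e::complex_euclidean) manifold \<Rightarrow> ('p \<Rightarrow> 'q) \<Rightarrow> bool"
  where
  "submersion M N F \<longleftrightarrow>
     (\<forall>c\<in>atlas M. \<forall>d\<in>atlas N. \<forall>x\<in>fst c \<inter> F -` fst d.
        surj (frechet_derivative (snd d \<circ> F \<circ> chart_inv c) (at (snd c x))))"

text \<open>A (holomorphic) tangent vector at \<open>p\<close>, given by its components in the charts around \<open>p\<close>.\<close>

definition tangent_vector ::
    "('p, 'e::complex_euclidean) manifold \<Rightarrow> 'p \<Rightarrow> (('p, 'e) chart \<Rightarrow> 'e) \<Rightarrow> bool" where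
  "tangent_vector M p \<xi> \<longleftrightarrow>
     (\<forall>c\<in>atlas M. \<forall>c'\<in>atlas M. p \<in> fst c \<inter> fst c' \<longrightarrow>
        \<xi> c' = frechet_derivative (snd c' \<circ> chart_inv c) (at (snd c p)) (\<xi> c))"

definition compact_riemann_surface :: "('p, complex) manifold \<Rightarrow> bool" where
  "compact_riemann_surface R \<longleftrightarrow>
     complex_manifold R \<and> compact_space (mtop R) \<and> connected_space (mtop R) \<and> points R \<noteq> {}"

definition has_genus :: "('p, complex) manifold \<Rightarrow> nat \<Rightarrow> bool" where
  "has_genus R g \<longleftrightarrow> homology_group 1 (mtop R) \<cong> free_Abelian_group {..<2 * g}"

section \<open>Tensors on a Riemann surface\<close>

text \<open>A section of a tensor bundle is given by its component functions in the charts of the atlas,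
  subject to the transformation law. In the following \<open>W\<close> is an open subset of the Riemann
  surface \<open>R\<close>. With \<open>z\<close>, \<open>z'\<close> the coordinates of the charts \<open>c\<close>, \<open>c'\<close>,
  \<open>transition c c'\<close> is the function \<open>dz'/dz\<close>.\<close>

definition transition :: "('p, complex) chart \<Rightarrow> ('p, complex) chart \<Rightarrow> 'p \<Rightarrow> complex" where
  "transition c c' x = deriv (snd c' \<circ> chart_inv c) (snd c x)"

definition smooth_vector_field ::
    "('p, complex) manifold \<Rightarrow> 'p set \<Rightarrow> (('p, complex) chart \<Rightarrow> 'p \<Rightarrow> complex) \<Rightarrow> bool" where
  "smooth_vector_field R W \<eta> \<longleftrightarrow>
     (\<forall>c\<in>atlas R. \<forall>c'\<in>atlas R. \<forall>x\<in>W \<inter> fst c \<inter> fst c'. \<eta> c' x = transition c c' x * \<eta> c x) \<and>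
     (\<forall>c\<in>atlas R. smooth_on (\<eta> c \<circ> chart_inv c) (snd c ` (W \<inter> fst c)))"

definition holo_vector_field ::
    "('p, complex) manifold \<Rightarrow> 'p set \<Rightarrow> (('p, complex) chart \<Rightarrow> 'p \<Rightarrow> complex) \<Rightarrow> bool" where
  "holo_vector_field R W \<eta> \<longleftrightarrow>
     (\<forall>c\<in>atlas R. \<forall>c'\<in>atlas R. \<forall>x\<in>W \<inter> fst c \<inter> fst c'. \<eta> c' x = transition c c' x * \<eta> c x) \<and>
     (\<forall>c\<in>atlas R. (\<eta> c \<circ> chart_inv c) holomorphic_on (snd c ` (W \<inter> fst c)))"

text \<open>Smooth \<open>(0,1)\<close>-forms with values in the tangent bundle; \<open>\<theta> c\<close> is the coefficient of
  \<open>\<partial>\<^sub>z \<otimes> d(cnj z)\<close>.\<close>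

definition smooth_T01_form ::
    "('p, complex) manifold \<Rightarrow> (('p, complex) chart \<Rightarrow> 'p \<Rightarrow> complex) \<Rightarrow> bool" where
  "smooth_T01_form R \<theta> \<longleftrightarrow>
     (\<forall>c\<in>atlas R. \<forall>c'\<in>atlas R. \<forall>x\<in>fst c \<inter> fst c'.
        \<theta> c' x = transition c c' x / cnj (transition c c' x) * \<theta> c x) \<and>
     (\<forall>c\<in>atlas R. smooth_on (\<theta> c \<circ> chart_inv c) (snd c ` fst c))"

definition dbar_vector_field ::
    "('p, complex) manifold \<Rightarrow> 'p set \<Rightarrow> (('p, complex) chart \<Rightarrow> 'p \<Rightarrow> complex) \<Rightarrow>
      (('p, complex) chart \<Rightarrow> 'p \<Rightarrow> complex) \<Rightarrow> bool" where
  "dbar_vector_field R W \<eta> \<theta> \<longleftrightarrow>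
     (\<forall>c\<in>atlas R. \<forall>x\<in>W \<inter> fst c. wirt_bar 1 (\<eta> c \<circ> chart_inv c) (snd c x) = \<theta> c x)"

text \<open>\<open>g c\<close> is the coefficient of the Kaehler form \<open>\<i> g dz \<and> d(cnj z)\<close>; the last condition
  says that the Ricci curvature is \<open>-1\<close>.\<close>

definition hyperbolic_metric ::
    "('p, complex) manifold \<Rightarrow> (('p, complex) chart \<Rightarrow> 'p \<Rightarrow> real) \<Rightarrow> bool" where
  "hyperbolic_metric R g \<longleftrightarrow>
     (\<forall>c\<in>atlas R. \<forall>c'\<in>atlas R. \<forall>x\<in>fst c \<inter> fst c'. g c x = (cmod (transition c c' x))\<^sup>2 * g c' x) \<and>
     (\<forall>c\<in>atlas R. smooth_on (g c \<circ> chart_inv c) (snd c ` fst c)) \<and>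
     (\<forall>c\<in>atlas R. \<forall>x\<in>fst c. g c x > 0) \<and>
     (\<forall>c\<in>atlas R. \<forall>x\<in>fst c.
        wirt 1 (wirt_bar 1 (\<lambda>p. of_real (ln (g c (chart_inv c p))))) (snd c x) = of_real (g c x))"

text \<open>\<open>\<zeta>\<close> is the image of \<open>\<theta>\<close> under the formal adjoint of the dbar operator: the
  \<open>L\<^sup>2\<close> products of \<open>\<theta>\<close> with \<open>dbar k\<close> and of \<open>\<zeta>\<close> with \<open>k\<close> agree for all smooth
  vector fields \<open>k\<close> with compact support in a coordinate domain. In the pointwise products
  \<open>\<partial>\<^sub>z\<close> has square norm \<open>g\<close>, \<open>d(cnj z)\<close> has square norm \<open>1/g\<close>, and the
  area form is \<open>g\<close> times Lebesgue measure; hence the factors \<open>g \<cdot> (1/g) \<cdot> g = g\<close>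
  and \<open>g \<cdot> g\<close>.\<close>

definition formal_adjoint_dbar ::
    "('p, complex) manifold \<Rightarrow> (('p, complex) chart \<Rightarrow> 'p \<Rightarrow> real) \<Rightarrow>
      (('p, complex) chart \<Rightarrow> 'p \<Rightarrow> complex) \<Rightarrow> (('p, complex) chart \<Rightarrow> 'p \<Rightarrow> complex) \<Rightarrow> bool" where
  "formal_adjoint_dbar R g \<theta> \<zeta> \<longleftrightarrow>
     (\<forall>c\<in>atlas R. \<forall>k :: complex \<Rightarrow> complex.
        smooth_on k UNIV \<and> compact (closure {p. k p \<noteq> 0}) \<and> closure {p. k p \<noteq> 0} \<subseteq> snd c ` fst c \<longrightarrow>
        (LINT p : snd c ` fst c | lborel.
           of_real (g c (chart_inv c p)) * \<theta> c (chart_inv c p) * cnj (wirt_bar 1 k p)) =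
        (LINT p : snd c ` fst c | lborel.
           of_real ((g c (chart_inv c p))\<^sup>2) * \<zeta> c (chart_inv c p) * cnj (k p)))"

text \<open>Harmonicity with respect to the dbar Laplacian. Since there are no forms of type \<open>(0,2)\<close>
  on a Riemann surface, the Laplacian of \<open>\<theta>\<close> is dbar of the adjoint \<open>\<zeta>\<close>.\<close>

definition harmonic_T01_forms ::
    "('p, complex) manifold \<Rightarrow> (('p, complex) chart \<Rightarrow> 'p \<Rightarrow> real) \<Rightarrow>
      (('p, complex) chart \<Rightarrow> 'p \<Rightarrow> complex) set" where
  "harmonic_T01_forms R g =
     {\<theta>. smooth_T01_form R \<theta> \<and>
         (\<exists>\<zeta>. smooth_vector_field R (points R) \<zeta> \<and> formal_adjoint_dbar R g \<theta> \<zeta> \<and>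
              dbar_vector_field R (points R) \<zeta> (\<lambda>c x. 0))}"

section \<open>The pulled back tangent bundle and the normal sheaf of a map\<close>

text \<open>Sections of \<open>b\<^sup>*T\<^sub>Y\<close> over \<open>W\<close>, where \<open>b\<close> maps \<open>R\<close> to \<open>Y\<close>: \<open>\<sigma> d\<close> is the
  coefficient with respect to \<open>\<partial>\<^sub>w\<close> over the domain of the chart \<open>d\<close> of \<open>Y\<close> with
  coordinate \<open>w\<close>.\<close>

definition smooth_pb_section ::
    "('p, complex) manifold \<Rightarrow> ('y, complex) manifold \<Rightarrow> ('p \<Rightarrow> 'y) \<Rightarrow> 'p set \<Rightarrow>
      (('y, complex) chart \<Rightarrow> 'p \<Rightarrow> complex) \<Rightarrow> bool" where
  "smooth_pb_section R Y b W \<sigma> \<longleftrightarrow>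
     (\<forall>d\<in>atlas Y. \<forall>d'\<in>atlas Y. \<forall>x\<in>W \<inter> b -` (fst d \<inter> fst d'). \<sigma> d' x = transition d d' (b x) * \<sigma> d x) \<and>
     (\<forall>c\<in>atlas R. \<forall>d\<in>atlas Y. smooth_on (\<sigma> d \<circ> chart_inv c) (snd c ` (W \<inter> fst c \<inter> b -` fst d)))"

definition holo_pb_section ::
    "('p, complex) manifold \<Rightarrow> ('y, complex) manifold \<Rightarrow> ('p \<Rightarrow> 'y) \<Rightarrow> 'p set \<Rightarrow>
      (('y, complex) chart \<Rightarrow> 'p \<Rightarrow> complex) \<Rightarrow> bool" where
  "holo_pb_section R Y b W \<sigma> \<longleftrightarrow>
     (\<forall>d\<in>atlas Y. \<forall>d'\<in>atlas Y. \<forall>x\<in>W \<inter> b -` (fst d \<inter> fst d'). \<sigma> d' x = transition d d' (b x) * \<sigma> d x) \<and>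
     (\<forall>c\<in>atlas R. \<forall>d\<in>atlas Y. (\<sigma> d \<circ> chart_inv c) holomorphic_on (snd c ` (W \<inter> fst c \<inter> b -` fst d)))"

text \<open>The push-forward \<open>b\<^sub>*\<close> of a tangent vector at \<open>x\<close> with component \<open>t\<close> in the chart
  \<open>c\<close>, in the coordinate of \<open>d\<close>. It is linear, and also used for the components of
  \<open>(0,1)\<close>-forms.\<close>

definition push ::
    "('p \<Rightarrow> 'y) \<Rightarrow> ('p, complex) chart \<Rightarrow> ('y, complex) chart \<Rightarrow> 'p \<Rightarrow> complex \<Rightarrow> complex" where
  "push b c d x t = deriv (snd d \<circ> b \<circ> chart_inv c) (snd c x) * t"

definition push_vector_field ::
    "('p, complex) manifold \<Rightarrow> ('p \<Rightarrow> 'y) \<Rightarrow> (('p, complex) chart \<Rightarrow> 'p \<Rightarrow> complex) \<Rightarrow>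
      ('y, complex) chart \<Rightarrow> 'p \<Rightarrow> complex" where
  "push_vector_field R b \<eta> d x = common_value {c\<in>atlas R. x \<in> fst c} (\<lambda>c. push b c d x (\<eta> c x))"

text \<open>The equation \<open>dbar \<psi> = b\<^sub>* \<theta>\<close> of \<open>b\<^sup>*T\<^sub>Y\<close>-valued \<open>(0,1)\<close>-forms.\<close>

definition dbar_eq_push ::
    "('p, complex) manifold \<Rightarrow> ('y, complex) manifold \<Rightarrow> ('p \<Rightarrow> 'y) \<Rightarrow>
      (('y, complex) chart \<Rightarrow> 'p \<Rightarrow> complex) \<Rightarrow> (('p, complex) chart \<Rightarrow> 'p \<Rightarrow> complex) \<Rightarrow> bool" where
  "dbar_eq_push R Y b \<psi> \<theta> \<longleftrightarrow>
     (\<forall>c\<in>atlas R. \<forall>d\<in>atlas Y. \<forall>x\<in>fst c \<inter> b -` fst d.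
        wirt_bar 1 (\<psi> d \<circ> chart_inv c) (snd c x) = push b c d x (\<theta> c x))"

definition generalized_harmonic ::
    "('p, complex) manifold \<Rightarrow> ('y, complex) manifold \<Rightarrow> ('p \<Rightarrow> 'y) \<Rightarrow>
      (('p, complex) chart \<Rightarrow> 'p \<Rightarrow> real) \<Rightarrow> (('y, complex) chart \<Rightarrow> 'p \<Rightarrow> complex) set" where
  "generalized_harmonic R Y b g =
     {\<psi>. smooth_pb_section R Y b (points R) \<psi> \<and>
         (\<exists>\<theta>\<in>harmonic_T01_forms R g. dbar_eq_push R Y b \<psi> \<theta>)}"

text \<open>The stalk of the normal sheaf at \<open>x\<close> consists of germs of holomorphic sections of
  \<open>b\<^sup>*T\<^sub>Y\<close> modulo images under \<open>b\<^sub>*\<close> of germs of holomorphic vector fields.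
  \<open>normal_class \<dots> \<sigma> x\<close> is the class at \<open>x\<close> of a section \<open>\<sigma>\<close> that is holomorphic near
  \<open>x\<close>, as the set of all representatives (it is empty if \<open>\<sigma>\<close> is not holomorphic
  near \<open>x\<close>); it is the projection \<open>P\<close>.\<close>

definition normal_class ::
    "('p, complex) manifold \<Rightarrow> ('y, complex) manifold \<Rightarrow> ('p \<Rightarrow> 'y) \<Rightarrow>
      (('y, complex) chart \<Rightarrow> 'p \<Rightarrow> complex) \<Rightarrow> 'p \<Rightarrow> (('y, complex) chart \<Rightarrow> 'p \<Rightarrow> complex) set" where
  "normal_class R Y b \<sigma> x =
     {\<sigma>'. \<exists>W \<eta>. openin (mtop R) W \<and> x \<in> W \<and>
        holo_pb_section R Y b W \<sigma> \<and> holo_pb_section R Y b W \<sigma>' \<and> holo_vector_field R W \<eta> \<and>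
        (\<forall>d\<in>atlas Y. \<forall>y\<in>W \<inter> b -` fst d. \<sigma>' d y = \<sigma> d y + push_vector_field R b \<eta> d y)}"

text \<open>Global sections of the normal sheaf, i.e. of the sheafification of the quotient: functions
  into the stalks that are locally classes of holomorphic sections of \<open>b\<^sup>*T\<^sub>Y\<close>.\<close>

definition normal_sections ::
    "('p, complex) manifold \<Rightarrow> ('y, complex) manifold \<Rightarrow> ('p \<Rightarrow> 'y) \<Rightarrow>
      ('p \<Rightarrow> (('y, complex) chart \<Rightarrow> 'p \<Rightarrow> complex) set) set" where
  "normal_sections R Y b =
     {n \<in> extensional (points R). \<forall>x\<in>points R. \<exists>W \<sigma>. openin (mtop R) W \<and> x \<in> W \<and>
        holo_pb_section R Y b W \<sigma> \<and> (\<forall>y\<in>W. n y = normal_class R Y b \<sigma> y)}"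

text \<open>The correspondence between generalized harmonic representatives \<open>\<psi>\<close> and sections \<open>n\<close> of
  the normal sheaf: local primitives \<open>\<eta>\<close> of \<open>\<theta>\<close> exist, and \<open>n\<close> is the class of
  \<open>\<psi> - b\<^sub>* \<eta>\<close> for every choice of them.\<close>

definition corresponds ::
    "('p, complex) manifold \<Rightarrow> ('y, complex) manifold \<Rightarrow> ('p \<Rightarrow> 'y) \<Rightarrow>
      (('p, complex) chart \<Rightarrow> 'p \<Rightarrow> real) \<Rightarrow> (('y, complex) chart \<Rightarrow> 'p \<Rightarrow> complex) \<Rightarrow>
      ('p \<Rightarrow> (('y, complex) chart \<Rightarrow> 'p \<Rightarrow> complex) set) \<Rightarrow> bool" where
  "corresponds R Y b g \<psi> n \<longleftrightarrow>
     \<psi> \<in> generalized_harmonic R Y b g \<and> n \<in> normal_sections R Y b \<and>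
     (\<exists>\<theta>\<in>harmonic_T01_forms R g. dbar_eq_push R Y b \<psi> \<theta> \<and>
        (\<forall>x\<in>points R. \<exists>U \<eta>. openin (mtop R) U \<and> x \<in> U \<and>
           smooth_vector_field R U \<eta> \<and> dbar_vector_field R U \<eta> \<theta>) \<and>
        (\<forall>U \<eta>. openin (mtop R) U \<and> smooth_vector_field R U \<eta> \<and> dbar_vector_field R U \<eta> \<theta> \<longrightarrow>
           (\<forall>x\<in>U. n x = normal_class R Y b (\<lambda>d y. \<psi> d y - push_vector_field R b \<eta> d y) x)))"

section \<open>Holomorphic families of coverings\<close>

text \<open>Local coordinates \<open>(z, s)\<close> on \<open>X\<close> with \<open>f(z, s) = s\<close>: pairs of a chart \<open>c\<close> of \<open>X\<close>
  and a chart \<open>e\<close> of \<open>S\<close> in which \<open>f\<close> is the projection.\<close>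

definition adapted_charts ::
    "('x, complex \<times> 'e::complex_euclidean) manifold \<Rightarrow> ('s, 'e) manifold \<Rightarrow> ('x \<Rightarrow> 's) \<Rightarrow>
      (('x, complex \<times> 'e) chart \<times> ('s, 'e) chart) set" where
  "adapted_charts X S f =
     {(c, e). c \<in> charts X \<and> e \<in> atlas S \<and> f ` fst c \<subseteq> fst e \<and>
        (\<forall>x\<in>fst c. snd (snd c x) = snd e (f x))}"

text \<open>The fiber over \<open>s\<close>, with the coordinates \<open>z\<close> obtained by restricting adapted charts.\<close>

definition fiber_set :: "('x, 'd) manifold \<Rightarrow> ('x \<Rightarrow> 's) \<Rightarrow> 's \<Rightarrow> 'x set" where
  "fiber_set X f s = {x \<in> points X. f x = s}"

definition fiber_chart ::
    "('x, complex \<times> 'e) manifold \<Rightarrow> ('x \<Rightarrow> 's) \<Rightarrow> 's \<Rightarrow> ('x, complex \<times> 'e) chart \<Rightarrow>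
      ('x, complex) chart" where
  "fiber_chart X f s c = (fst c \<inter> fiber_set X f s, \<lambda>x. fst (snd c x))"

definition fiber ::
    "('x, complex \<times> 'e::complex_euclidean) manifold \<Rightarrow> ('s, 'e) manifold \<Rightarrow> ('x \<Rightarrow> 's) \<Rightarrow> 's \<Rightarrow>
      ('x, complex) manifold" where
  "fiber X S f s =
     \<lparr>mtop = subtopology (mtop X) (fiber_set X f s),
      atlas = {fiber_chart X f s c | c e. (c, e) \<in> adapted_charts X S f}\<rparr>"

definition family_of_coverings ::
    "('x, complex \<times> 'e::complex_euclidean) manifold \<Rightarrow> ('s, 'e) manifold \<Rightarrow> ('y, complex) manifold \<Rightarrow>
      ('x \<Rightarrow> 's) \<Rightarrow> ('x \<Rightarrow> 'y) \<Rightarrow> bool" where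
  "family_of_coverings X S Y f \<beta> \<longleftrightarrow>
     complex_manifold X \<and> complex_manifold S \<and>
     holomorphic_map X S f \<and> proper_map (mtop X) (mtop S) f \<and> submersion X S f \<and>
     (\<forall>s\<in>points S. compact_riemann_surface (fiber X S f s)) \<and>
     holomorphic_map X Y \<beta> \<and> (\<forall>s\<in>points S. \<not> \<beta> constant_on fiber_set X f s)"

text \<open>The function \<open>g(z, s)\<close> in adapted coordinates, for metrics \<open>h s\<close> on the fibers.\<close>

definition family_coefficient ::
    "('x, complex \<times> 'e) manifold \<Rightarrow> ('x \<Rightarrow> 's) \<Rightarrow> ('s \<Rightarrow> ('x, complex) chart \<Rightarrow> 'x \<Rightarrow> real) \<Rightarrow>
      ('x, complex \<times> 'e) chart \<Rightarrow> complex \<times> 'e \<Rightarrow> real" where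
  "family_coefficient X f h c p =
     (let x = chart_inv c p in h (f x) (fiber_chart X f (f x) c) x)"

text \<open>The hyperbolic metrics of the fibers. Their smooth dependence on \<open>s\<close>, which is a
  well-known fact, is part of the definition.\<close>

definition hyperbolic_metric_family ::
    "('x, complex \<times> 'e::complex_euclidean) manifold \<Rightarrow> ('s, 'e) manifold \<Rightarrow> ('x \<Rightarrow> 's) \<Rightarrow>
      ('s \<Rightarrow> ('x, complex) chart \<Rightarrow> 'x \<Rightarrow> real) \<Rightarrow> bool" where
  "hyperbolic_metric_family X S f h \<longleftrightarrow>
     (\<forall>s\<in>points S. hyperbolic_metric (fiber X S f s) (h s)) \<and>
     (\<forall>(c, e)\<in>adapted_charts X S f. smooth_on (family_coefficient X f h c) (snd c ` fst c))"

text \<open>The horizontal lift at \<open>x\<close> of the tangent vector \<open>\<xi>\<close> of \<open>S\<close> at \<open>f x\<close>, in the adapted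
  coordinates given by \<open>c\<close> and \<open>e\<close>: the pair of the components \<open>a\<close> along \<open>\<partial>\<^sub>z\<close> and
  \<open>\<xi> e\<close> along the coordinates of \<open>S\<close>, with \<open>a = - g\<^sup>-\<^sup>1 \<partial>\<^sub>\<xi> (\<partial>/\<partial>(cnj z)) log g\<close>.\<close>

definition horizontal_lift ::
    "('x, complex \<times> 'e::complex_euclidean) manifold \<Rightarrow> ('x \<Rightarrow> 's) \<Rightarrow>
      ('s \<Rightarrow> ('x, complex) chart \<Rightarrow> 'x \<Rightarrow> real) \<Rightarrow> (('s, 'e) chart \<Rightarrow> 'e) \<Rightarrow>
      ('x, complex \<times> 'e) chart \<Rightarrow> ('s, 'e) chart \<Rightarrow> 'x \<Rightarrow> complex \<times> 'e" where
  "horizontal_lift X f h \<xi> c e x =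
     (let g = family_coefficient X f h c
      in (- wirt (0, \<xi> e) (wirt_bar (1, 0) (\<lambda>p. of_real (ln (g p)))) (snd c x)
            / of_real (g (snd c x)), \<xi> e))"

text \<open>The section \<open>\<beta>\<^sub>*(v\<^sub>s)\<close> restricted to the fiber: for \<open>v = (a, \<xi> e)\<close> the Wirtinger derivative
  of \<open>\<beta>\<close> along \<open>v\<close> is \<open>\<partial>\<beta>/\<partial>s + a \<partial>\<beta>/\<partial>z\<close> by complex linearity.\<close>

definition push_horizontal_lift ::
    "('x, complex \<times> 'e::complex_euclidean) manifold \<Rightarrow> ('s, 'e) manifold \<Rightarrow> ('x \<Rightarrow> 's) \<Rightarrow> ('x \<Rightarrow> 'y) \<Rightarrow>
      ('s \<Rightarrow> ('x, complex) chart \<Rightarrow> 'x \<Rightarrow> real) \<Rightarrow> (('s, 'e) chart \<Rightarrow> 'e) \<Rightarrow>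
      ('y, complex) chart \<Rightarrow> 'x \<Rightarrow> complex" where
  "push_horizontal_lift X S f \<beta> h \<xi> d x =
     common_value {(c, e) \<in> adapted_charts X S f. x \<in> fst c}
       (\<lambda>(c, e). wirt (horizontal_lift X f h \<xi> c e x) (snd d \<circ> \<beta> \<circ> chart_inv c) (snd c x))"

text \<open>The characteristic map at \<open>s\<close>, locally \<open>P(\<partial>\<beta>/\<partial>s \<partial>\<^sub>w)\<close> in any adapted coordinates.\<close>

definition characteristic_map ::
    "('x, complex \<times> 'e::complex_euclidean) manifold \<Rightarrow> ('s, 'e) manifold \<Rightarrow> ('y, complex) manifold \<Rightarrow>
      ('x \<Rightarrow> 's) \<Rightarrow> ('x \<Rightarrow> 'y) \<Rightarrow> 's \<Rightarrow> (('s, 'e) chart \<Rightarrow> 'e) \<Rightarrow>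
      'x \<Rightarrow> (('y, complex) chart \<Rightarrow> 'x \<Rightarrow> complex) set" where
  "characteristic_map X S Y f \<beta> s \<xi> =
     (\<lambda>x\<in>fiber_set X f s.
        common_value {(c, e) \<in> adapted_charts X S f. x \<in> fst c}
          (\<lambda>(c, e). normal_class (fiber X S f s) Y \<beta>
             (\<lambda>d y. wirt (0, \<xi> e) (snd d \<circ> \<beta> \<circ> chart_inv c) (snd c y)) x))"

end

theory Submission
  imports Defs
begin

text \<open>Write \<open>g\<close> for the coefficient of the hyperbolic metrics in adapted coordinates \<open>(z, s)\<close> and
  \<open>L = dbar log g\<close> for the derivative along the fibers, so that \<open>\<partial>\<^sub>z L = g\<close> and the horizontal lift
  has vertical component \<open>a = - \<partial>\<^sub>s L / g\<close>. A change of adapted coordinates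
  \<open>z' = \<phi>(z, s)\<close> gives \<open>a' = \<phi>\<^sub>z a + \<phi>\<^sub>s\<close> with \<open>\<phi>\<close> holomorphic. Hence \<open>u\<close> is
  well defined, and \<open>\<theta> = dbar a\<close> is a global form although \<open>a\<close> is not a global vector field.
  Differentiating \<open>\<partial>\<^sub>z L = g\<close> yields \<open>\<partial>\<^sub>z (g \<theta>) = 0\<close>, so the adjoint of dbar annihilates
  \<open>\<theta>\<close>. Since \<open>u = \<partial>\<beta>/\<partial>s + a \<partial>\<beta>/\<partial>z\<close> with \<open>\<beta>\<close> holomorphic, \<open>dbar u = \<beta>\<^sub>* \<theta>\<close>; and
  \<open>a\<close> itself is a local primitive of \<open>\<theta>\<close> for which \<open>u - \<beta>\<^sub>* a = \<partial>\<beta>/\<partial>s\<close> represents the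
  characteristic map. Two primitives of \<open>\<theta>\<close> differ by a holomorphic vector field.\<close>

section \<open>Calculus of smooth maps\<close>

text \<open>The law for \<open>a\<close> comes from g = |\<phi>_z|^2 g': taking dbar of the
  logarithm gives L = cnj (\<phi>_zz / \<phi>_z) + cnj \<phi>_z * L'. The first term and the factor
  cnj \<phi>_z are antiholomorphic, so \<partial>_s acts only on L' in the new coordinates, where
  the chain rule and Liouville's equation for L' produce the summand \<phi>_s g'. Two obstacles
  shape the argument. Holomorphy means real differentiability with complex linear derivative, yet
  coordinate changes and \<beta> are differentiated repeatedly; Cauchy's formula on complex lines
  supplies smoothness and holomorphy of the derivatives. Harmonicity is weak, stated by L2 products
  with test vector fields, so the differential equation for g \<theta> must become the vanishing of
  an integral. Independence of the primitive serves twice: for the correspondence, and to see that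
  \<partial>\<beta>/\<partial>s has the same class in two adapted charts. Both sections are u minus
  the push-forward of a primitive of the same \<theta>, so they need not be compared by
  hand.\<close>

lemma frechet_derivative_cong_open:
  assumes "open U" "p \<in> U" "\<And>x. x \<in> U \<Longrightarrow> F x = G x"
  shows "frechet_derivative F (at p) = frechet_derivative G (at p)"
proof -
  have "(F has_derivative D) (at p) \<longleftrightarrow> (G has_derivative D) (at p)" for D
    using has_derivative_transform_within_open[OF _ assms(1,2)] assms(3) by metis
  then show ?thesis unfolding frechet_derivative_def by simp
qed

lemma differentiable_cong_open:
  assumes "open U" "p \<in> U" "\<And>x. x \<in> U \<Longrightarrow> F x = G x" "F differentiable (at p)"
  shows "G differentiable (at p)"
  using assms unfolding differentiable_def
  by (meson has_derivative_transform_within_open)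

lemma Ck_on_cong:
  assumes "open U" "\<And>x. x \<in> U \<Longrightarrow> F x = G x" "Ck_on k F U"
  shows "Ck_on k G U"
  using assms(2,3)
proof (induction k arbitrary: F G)
  case 0
  have "continuous_on U F \<longleftrightarrow> continuous_on U G"
    by (rule continuous_on_cong[OF refl 0(1)])
  then show ?case using 0(2) by simp
next
  case (Suc k)
  have eq: "frechet_derivative F (at p) = frechet_derivative G (at p)" if "p \<in> U" for p
    using frechet_derivative_cong_open[OF assms(1) that Suc.prems(1)] .
  have "Ck_on k (\<lambda>p. frechet_derivative G (at p) v) U" for v
    by (rule Suc.IH[of "\<lambda>p. frechet_derivative F (at p) v"]) (use eq Suc.prems(2) in auto)
  moreover have "G differentiable (at p)" if "p \<in> U" for p
    using differentiable_cong_open[OF assms(1) that Suc.prems(1)] Suc.prems(2) that by simp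
  ultimately show ?case by simp
qed

lemma Ck_on_SucD: "Ck_on (Suc k) F U \<Longrightarrow> Ck_on k F U"
proof (induction k arbitrary: F)
  case 0
  then show ?case
    by (auto intro: differentiable_imp_continuous_on simp: differentiable_on_def differentiable_at_withinI)
next
  case (Suc k)
  then show ?case by (metis Ck_on.simps(2))
qed

lemma Ck_on_subset: "Ck_on k F U \<Longrightarrow> V \<subseteq> U \<Longrightarrow> Ck_on k F V"
  by (induction k arbitrary: F) (auto intro: continuous_on_subset)

lemma Ck_on_const: "Ck_on k (\<lambda>_. c) U"
proof (induction k arbitrary: c)
  case (Suc k)
  show ?case using Suc[of 0] by (simp add: frechet_derivative_const)
qed simp

lemma Ck_on_bounded_linear:
  assumes "bounded_linear L" "open U" "Ck_on k F U"
  shows "Ck_on k (\<lambda>p. L (F p)) U"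
  using assms(3)
proof (induction k arbitrary: F)
  case 0
  then show ?case using bounded_linear.continuous_on[OF assms(1)] by simp
next
  case (Suc k)
  have d: "((\<lambda>p. L (F p)) has_derivative (\<lambda>v. L (frechet_derivative F (at p) v))) (at p)" if "p \<in> U" for p
    using Suc.prems that
    by (intro bounded_linear.has_derivative[OF assms(1)]) (simp add: frechet_derivative_works)
  have "Ck_on k (\<lambda>p. frechet_derivative (\<lambda>p. L (F p)) (at p) v) U" for v
  proof (rule Ck_on_cong[OF assms(2)])
    show "Ck_on k (\<lambda>p. L (frechet_derivative F (at p) v)) U"
      using Suc.prems by (intro Suc.IH) simp
    show "L (frechet_derivative F (at p) v) = frechet_derivative (\<lambda>p. L (F p)) (at p) v"
      if "p \<in> U" for p
      using frechet_derivative_at[OF d[OF that]] by metis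
  qed
  then show ?case using d by (auto simp: differentiable_def)
qed

lemma Ck_on_add:
  assumes "open U" "Ck_on k F U" "Ck_on k G U"
  shows "Ck_on k (\<lambda>p. F p + G p) U"
  using assms(2,3)
proof (induction k arbitrary: F G)
  case 0
  then show ?case by (simp add: continuous_on_add)
next
  case (Suc k)
  have d: "((\<lambda>p. F p + G p) has_derivative
      (\<lambda>v. frechet_derivative F (at p) v + frechet_derivative G (at p) v)) (at p)" if "p \<in> U" for p
    using Suc.prems that by (intro has_derivative_add) (simp_all add: frechet_derivative_works)
  have "Ck_on k (\<lambda>p. frechet_derivative (\<lambda>p. F p + G p) (at p) v) U" for v
  proof (rule Ck_on_cong[OF assms(1)])
    show "Ck_on k (\<lambda>p. frechet_derivative F (at p) v + frechet_derivative G (at p) v) U"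
      using Suc.prems by (intro Suc.IH) simp_all
    show "frechet_derivative F (at p) v + frechet_derivative G (at p) v =
        frechet_derivative (\<lambda>p. F p + G p) (at p) v" if "p \<in> U" for p
      using frechet_derivative_at[OF d[OF that]] by metis
  qed
  then show ?case using d by (auto simp: differentiable_def)
qed

text \<open>By the Leibniz rule the derivative is a sum of two products of the same kind. Each
  contains one undifferentiated factor, whose order is lowered by \<open>Ck_on_SucD\<close> before
  the induction hypothesis applies.\<close>

lemma Ck_on_bounded_bilinear:
  assumes "bounded_bilinear B" "open U" "Ck_on k F U" "Ck_on k G U"
  shows "Ck_on k (\<lambda>p. B (F p) (G p)) U"
  using assms(3,4)
proof (induction k arbitrary: F G)
  case 0
  then show ?case using bounded_bilinear.continuous_on[OF assms(1)] by simp
next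
  case (Suc k)
  have d: "((\<lambda>p. B (F p) (G p)) has_derivative
      (\<lambda>v. B (F p) (frechet_derivative G (at p) v) + B (frechet_derivative F (at p) v) (G p))) (at p)"
    if "p \<in> U" for p
    using Suc.prems that
    by (intro bounded_bilinear.FDERIV[OF assms(1)]) (simp_all add: frechet_derivative_works)
  have "Ck_on k (\<lambda>p. frechet_derivative (\<lambda>p. B (F p) (G p)) (at p) v) U" for v
  proof (rule Ck_on_cong[OF assms(2)])
    show "Ck_on k (\<lambda>p. B (F p) (frechet_derivative G (at p) v) + B (frechet_derivative F (at p) v) (G p)) U"
      using Suc.prems Ck_on_SucD[OF Suc.prems(1)] Ck_on_SucD[OF Suc.prems(2)]
      by (intro Ck_on_add[OF assms(2)] Suc.IH) auto
    show "B (F p) (frechet_derivative G (at p) v) + B (frechet_derivative F (at p) v) (G p) =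
        frechet_derivative (\<lambda>p. B (F p) (G p)) (at p) v" if "p \<in> U" for p
      using frechet_derivative_at[OF d[OF that]] by metis
  qed
  then show ?case using d by (auto simp: differentiable_def)
qed

lemma Ck_on_sum:
  assumes "open U" "finite I" "\<And>i. i \<in> I \<Longrightarrow> Ck_on k (F i) U"
  shows "Ck_on k (\<lambda>p. \<Sum>i\<in>I. F i p) U"
  using assms(2,3) by (induction I rule: finite_induct) (auto intro: Ck_on_const Ck_on_add[OF assms(1)])

text \<open>The chain rule evaluates the derivative of \<open>G\<close> in a direction that varies
  with \<open>p\<close>, whereas \<open>Ck_on\<close> only controls derivatives in fixed directions.
  Expanding the direction in \<open>Basis\<close> gives a finite sum of fixed directional
  derivatives of \<open>G\<close>, composed with \<open>F\<close> and weighted by C^k coefficients;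
  the induction hypothesis covers each of them. This is why \<open>F\<close> takes values in a
  Euclidean space.\<close>

lemma Ck_on_compose:
  fixes F :: "'a::real_normed_vector \<Rightarrow> 'b::euclidean_space"
  assumes "open U" "open V" "F ` U \<subseteq> V" "Ck_on k F U" "Ck_on k G V"
  shows "Ck_on k (\<lambda>p. G (F p)) U"
  using assms(4,5)
proof (induction k arbitrary: G)
  case 0
  then show ?case using continuous_on_compose2[of V G U F] assms(3) by simp
next
  case (Suc k)
  have FU: "F p \<in> V" if "p \<in> U" for p using that assms(3) by blast
  have d: "((\<lambda>p. G (F p)) has_derivative
      (\<lambda>v. frechet_derivative G (at (F p)) (frechet_derivative F (at p) v))) (at p)"
    if "p \<in> U" for p
    using Suc.prems that FU[OF that]
    by (intro has_derivative_compose[of F _ _ _ G]) (simp_all add: frechet_derivative_works)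
  have e: "frechet_derivative (\<lambda>p. G (F p)) (at p) v =
      (\<Sum>i\<in>Basis. (frechet_derivative F (at p) v \<bullet> i) *\<^sub>R frechet_derivative G (at (F p)) i)"
    if "p \<in> U" for p v
  proof -
    have lin: "linear (frechet_derivative G (at (F p)))"
      using Suc.prems FU[OF that] by (simp add: linear_frechet_derivative)
    have "frechet_derivative (\<lambda>p. G (F p)) (at p) v =
        frechet_derivative G (at (F p)) (frechet_derivative F (at p) v)"
      using frechet_derivative_at[OF d[OF that]] by metis
    also have "\<dots> = frechet_derivative G (at (F p)) (\<Sum>i\<in>Basis. (frechet_derivative F (at p) v \<bullet> i) *\<^sub>R i)"
      by (simp add: euclidean_representation)
    also have "\<dots> = (\<Sum>i\<in>Basis. (frechet_derivative F (at p) v \<bullet> i) *\<^sub>R frechet_derivative G (at (F p)) i)"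
      by (simp add: linear_sum[OF lin] linear_cmul[OF lin])
    finally show ?thesis .
  qed
  have Fk: "Ck_on k F U" using Suc.prems Ck_on_SucD by blast
  have "Ck_on k (\<lambda>p. frechet_derivative (\<lambda>p. G (F p)) (at p) v) U" for v
  proof (rule Ck_on_cong[OF assms(1)])
    show "Ck_on k (\<lambda>p. \<Sum>i\<in>Basis. (frechet_derivative F (at p) v \<bullet> i) *\<^sub>R frechet_derivative G (at (F p)) i) U"
      using Suc.prems Fk
      by (intro Ck_on_sum[OF assms(1)] Ck_on_bounded_bilinear[OF bounded_bilinear_scaleR assms(1)]
          Ck_on_bounded_linear[OF bounded_linear_inner_left assms(1)] Suc.IH) auto
  qed (simp add: e)
  then show ?case using d by (auto simp: differentiable_def)
qed

section \<open>Closure properties of smooth maps\<close>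

lemma smooth_on_imp_Ck_on: "smooth_on F U \<Longrightarrow> Ck_on k F U"
  by (simp add: smooth_on_def)

lemma smooth_onD: "smooth_on F U \<Longrightarrow> p \<in> U \<Longrightarrow> F differentiable (at p)"
  using smooth_on_imp_Ck_on[of F U "Suc 0"] by simp

lemma smooth_on_frechet:
  assumes "smooth_on F U"
  shows "smooth_on (\<lambda>p. frechet_derivative F (at p) v) U"
  unfolding smooth_on_def
proof
  show "Ck_on k (\<lambda>p. frechet_derivative F (at p) v) U" for k
    using smooth_on_imp_Ck_on[OF assms, of "Suc k"] by simp
qed

lemma smooth_onI:
  assumes "\<And>p. p \<in> U \<Longrightarrow> F differentiable (at p)"
    and "\<And>v. smooth_on (\<lambda>p. frechet_derivative F (at p) v) U"
  shows "smooth_on F U"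
  unfolding smooth_on_def
proof
  fix k show "Ck_on k F U"
  proof (cases k)
    case 0
    then show ?thesis using assms(1)
      by (auto intro: differentiable_imp_continuous_on simp: differentiable_on_def differentiable_at_withinI)
  next
    case (Suc l)
    then show ?thesis using assms by (simp add: smooth_on_def)
  qed
qed

lemma smooth_on_cong: "smooth_on F U \<Longrightarrow> open U \<Longrightarrow> (\<And>x. x \<in> U \<Longrightarrow> F x = G x) \<Longrightarrow> smooth_on G U"
  by (metis Ck_on_cong smooth_on_def)

lemma smooth_on_subset: "smooth_on F U \<Longrightarrow> V \<subseteq> U \<Longrightarrow> smooth_on F V"
  by (auto simp: smooth_on_def intro: Ck_on_subset)

lemma smooth_on_const: "smooth_on (\<lambda>_. c) U"
  by (simp add: smooth_on_def Ck_on_const)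

lemma smooth_on_bounded_linear:
  "bounded_linear L \<Longrightarrow> open U \<Longrightarrow> smooth_on F U \<Longrightarrow> smooth_on (\<lambda>p. L (F p)) U"
  by (simp add: smooth_on_def Ck_on_bounded_linear)

lemma smooth_on_add: "open U \<Longrightarrow> smooth_on F U \<Longrightarrow> smooth_on G U \<Longrightarrow> smooth_on (\<lambda>p. F p + G p) U"
  by (simp add: smooth_on_def Ck_on_add)

lemma smooth_on_bounded_bilinear:
  "bounded_bilinear B \<Longrightarrow> open U \<Longrightarrow> smooth_on F U \<Longrightarrow> smooth_on G U \<Longrightarrow> smooth_on (\<lambda>p. B (F p) (G p)) U"
  by (simp add: smooth_on_def Ck_on_bounded_bilinear)

lemma smooth_on_mult:
  fixes F G :: "'a::real_normed_vector \<Rightarrow> 'b::real_normed_algebra"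
  shows "open U \<Longrightarrow> smooth_on F U \<Longrightarrow> smooth_on G U \<Longrightarrow> smooth_on (\<lambda>p. F p * G p) U"
  by (rule smooth_on_bounded_bilinear[OF bounded_bilinear_mult])

lemma smooth_on_minus: "open U \<Longrightarrow> smooth_on F U \<Longrightarrow> smooth_on (\<lambda>p. - F p) U"
  by (rule smooth_on_bounded_linear[OF bounded_linear_minus[OF bounded_linear_ident]])

lemma smooth_on_diff: "open U \<Longrightarrow> smooth_on F U \<Longrightarrow> smooth_on G U \<Longrightarrow> smooth_on (\<lambda>p. F p - G p) U"
  using smooth_on_add[of U F "\<lambda>p. - G p"] smooth_on_minus[of U G] by simp

lemma smooth_on_of_real:
  "open U \<Longrightarrow> smooth_on F U \<Longrightarrow> smooth_on (\<lambda>p. of_real (F p) :: complex) U"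
  by (rule smooth_on_bounded_linear[OF bounded_linear_of_real])

lemma smooth_on_cnj: "open U \<Longrightarrow> smooth_on F U \<Longrightarrow> smooth_on (\<lambda>p. cnj (F p)) U"
  by (rule smooth_on_bounded_linear[OF bounded_linear_cnj])

lemma smooth_on_compose:
  fixes F :: "'a::real_normed_vector \<Rightarrow> 'b::euclidean_space"
  assumes "open U" "open V" "F ` U \<subseteq> V" "smooth_on F U" "smooth_on G V"
  shows "smooth_on (\<lambda>p. G (F p)) U"
  using assms by (simp add: smooth_on_def Ck_on_compose)

text \<open>The derivative of \<open>inverse\<close> is a product of copies of
  \<open>inverse\<close> and a constant, so the induction closes on the function itself. The
  positive half-line suffices for metric coefficients.\<close>

lemma Ck_on_inverse: "Ck_on k (inverse :: real \<Rightarrow> real) {0<..}"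
proof (induction k)
  case 0
  have "continuous_on {0<..} (\<lambda>x::real. inverse x)"
    by (intro continuous_on_inverse continuous_on_id) auto
  then show ?case by simp
next
  case (Suc k)
  have d: "((inverse :: real \<Rightarrow> real) has_derivative (\<lambda>v. - (inverse p * v * inverse p))) (at p)"
    if "p \<in> {0<..}" for p
    using that has_derivative_inverse'[of p UNIV] by simp
  have "Ck_on k (\<lambda>p. frechet_derivative (inverse :: real \<Rightarrow> real) (at p) v) {0<..}" for v
  proof (rule Ck_on_cong)
    show "Ck_on k (\<lambda>p. - (inverse p * v * inverse p :: real)) {0<..}"
      by (intro Ck_on_bounded_linear[OF bounded_linear_minus[OF bounded_linear_ident]]
          Ck_on_bounded_bilinear[OF bounded_bilinear_mult] Suc Ck_on_const) auto
    show "- (inverse p * v * inverse p) = frechet_derivative inverse (at p) v" if "p \<in> {0<..}" for p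
      using frechet_derivative_at[OF d[OF that]] by metis
  qed simp
  then show ?case using d by (auto simp: differentiable_def)
qed

lemma smooth_on_inverse:
  fixes F :: "'a::real_normed_vector \<Rightarrow> real"
  assumes "open U" "smooth_on F U" "\<And>p. p \<in> U \<Longrightarrow> F p > 0"
  shows "smooth_on (\<lambda>p. inverse (F p)) U"
  by (rule smooth_on_compose[OF assms(1), where F = F and G = inverse and V = "{0<..}"]) (use assms in \<open>auto simp: smooth_on_def Ck_on_inverse\<close>)

lemma smooth_on_ln:
  fixes F :: "'a::real_normed_vector \<Rightarrow> real"
  assumes "open U" "smooth_on F U" "\<And>p. p \<in> U \<Longrightarrow> F p > 0"
  shows "smooth_on (\<lambda>p. ln (F p)) U"
proof (rule smooth_on_compose[OF assms(1), where F = F and G = ln and V = "{0<..}"])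
  have d: "(ln has_derivative (\<lambda>v. inverse p * v)) (at p)" if "p \<in> {0<..}" for p :: real
    using DERIV_ln[of p] that by (simp add: has_field_derivative_def)
  show "smooth_on (ln :: real \<Rightarrow> real) {0<..}"
  proof (rule smooth_onI)
    show "smooth_on (\<lambda>p. frechet_derivative (ln::real \<Rightarrow> real) (at p) v) {0<..}" for v
    proof (rule smooth_on_cong)
      show "smooth_on (\<lambda>p::real. inverse p * v) {0<..}"
        by (intro smooth_on_mult smooth_on_const) (auto simp: smooth_on_def Ck_on_inverse)
      show "inverse p * v = frechet_derivative ln (at p) v" if "p \<in> {0<..}" for p
        using frechet_derivative_at[OF d[OF that]] by metis
    qed simp
  qed (use d in \<open>auto simp: differentiable_def\<close>)
qed (use assms in auto)

text \<open>Schwarz's theorem by second differences. The second difference of \<open>F\<close> over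
  the parallelogram spanned by \<open>h u\<close> and \<open>h v\<close> does not depend on the
  order of \<open>u\<close> and \<open>v\<close>, and equals \<open>h * h\<close> times either mixed
  derivative at some point of the parallelogram. Continuity of the mixed derivatives then gives
  equality at \<open>p\<close> as the parallelogram shrinks.\<close>

lemma symmetric_second_derivative_real:
  fixes F :: "'a::real_normed_vector \<Rightarrow> real"
  assumes U: "open U" "p \<in> U" and F: "Ck_on 2 F U"
  shows "frechet_derivative (\<lambda>q. frechet_derivative F (at q) u) (at p) v =
    frechet_derivative (\<lambda>q. frechet_derivative F (at q) v) (at p) u"
proof -
  define D where "D u q = frechet_derivative F (at q) u" for u q
  define DD where "DD u v q = frechet_derivative (D u) (at q) v" for u v q
  have dF: "F differentiable (at q)" "D w differentiable (at q)" if "q \<in> U" for q w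
    using F that unfolding numeral_2_eq_2 Ck_on.simps D_def[abs_def] by blast+
  have cD: "continuous_on U (DD w w')" for w w'
    using F unfolding numeral_2_eq_2 Ck_on.simps DD_def[abs_def] D_def[abs_def] by blast
  have lineD: "((\<lambda>a. G (q + a *\<^sub>R w)) has_real_derivative frechet_derivative G (at (q + a *\<^sub>R w)) w) (at a)"
    if "G differentiable (at (q + a *\<^sub>R w))" for G :: "'a \<Rightarrow> real" and q w a
  proof -
    have G: "(G has_derivative frechet_derivative G (at (q + a *\<^sub>R w))) (at (q + a *\<^sub>R w))"
      using that by (simp add: frechet_derivative_works)
    have "((\<lambda>a. q + a *\<^sub>R w) has_derivative (\<lambda>h. h *\<^sub>R w)) (at a)"
      by (auto intro!: derivative_eq_intros)
    from has_derivative_compose[OF this G]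
    show ?thesis
      by (simp add: has_field_derivative_def linear_cmul[OF linear_frechet_derivative[OF that]] mult_commute_abs)
  qed
  obtain r where r: "r > 0" "ball p r \<subseteq> U" using U openE by blast
  have key: "\<exists>a b. 0 < a \<and> a < h \<and> 0 < b \<and> b < h \<and>
      F (p + h *\<^sub>R u + h *\<^sub>R v) - F (p + h *\<^sub>R u) - F (p + h *\<^sub>R v) + F p
      = h * h * DD u v (p + a *\<^sub>R u + b *\<^sub>R v)"
    if h: "0 < h" "h * (norm u + norm v) < r" for h u v
  proof -
    have inU: "p + a *\<^sub>R u + b *\<^sub>R v \<in> U" if "0 \<le> a" "a \<le> h" "0 \<le> b" "b \<le> h" for a b
    proof -
      have "norm (a *\<^sub>R u + b *\<^sub>R v) \<le> a * norm u + b * norm v"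
        using norm_triangle_ineq[of "a *\<^sub>R u" "b *\<^sub>R v"] that by simp
      also have "\<dots> \<le> h * norm u + h * norm v"
        using that by (intro add_mono mult_right_mono) auto
      finally have "norm (a *\<^sub>R u + b *\<^sub>R v) < r" using h by (simp add: algebra_simps)
      then have "p + a *\<^sub>R u + b *\<^sub>R v \<in> ball p r"
        by (simp add: dist_norm algebra_simps norm_minus_commute)
      then show ?thesis using r by blast
    qed
    \<comment> \<open>Mean value theorem in the direction \<open>u\<close>, applied to the
      difference of \<open>F\<close> along the two opposite sides; a second application in the
      direction \<open>v\<close> follows, at the intermediate point just found.\<close>
    have "\<exists>a. 0 < a \<and> a < h \<and>
      (F ((p + h *\<^sub>R v) + h *\<^sub>R u) - F (p + h *\<^sub>R u)) - (F ((p + h *\<^sub>R v) + 0 *\<^sub>R u) - F (p + 0 *\<^sub>R u))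
      = (h - 0) * (D u ((p + h *\<^sub>R v) + a *\<^sub>R u) - D u (p + a *\<^sub>R u))"
      using h inU[of _ h] inU[of _ 0] unfolding D_def
      by (intro MVT2[of 0 h "\<lambda>a. F ((p + h *\<^sub>R v) + a *\<^sub>R u) - F (p + a *\<^sub>R u)"] DERIV_diff lineD dF)
        (simp_all add: add_ac)
    then obtain a where a: "0 < a" "a < h" and
      eq1: "(F ((p + h *\<^sub>R v) + h *\<^sub>R u) - F (p + h *\<^sub>R u)) - (F (p + h *\<^sub>R v) - F p)
      = h * (D u ((p + h *\<^sub>R v) + a *\<^sub>R u) - D u (p + a *\<^sub>R u))" by auto
    have "\<exists>b. 0 < b \<and> b < h \<and>
      D u ((p + a *\<^sub>R u) + h *\<^sub>R v) - D u ((p + a *\<^sub>R u) + 0 *\<^sub>R v)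
      = (h - 0) * DD u v ((p + a *\<^sub>R u) + b *\<^sub>R v)"
      using h a inU[of a] unfolding DD_def
      by (intro MVT2[of 0 h "\<lambda>b. D u ((p + a *\<^sub>R u) + b *\<^sub>R v)"] lineD dF)
        (simp_all add: add_ac)
    then obtain b where b: "0 < b" "b < h" and
      eq2: "D u ((p + a *\<^sub>R u) + h *\<^sub>R v) - D u (p + a *\<^sub>R u) = h * DD u v ((p + a *\<^sub>R u) + b *\<^sub>R v)"
      by auto
    show ?thesis
      using a b eq1 eq2 by (intro exI[of _ a] exI[of _ b]) (simp add: add_ac algebra_simps)
  qed
  have "\<bar>DD u v p - DD v u p\<bar> \<le> e" if e: "e > 0" for e
  proof -
    have "continuous (at p) (DD u v)" "continuous (at p) (DD v u)"
      using cD U continuous_on_eq_continuous_at by blast+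
    then obtain d1 d2 where d: "d1 > 0" "d2 > 0"
      "\<And>q. dist q p < d1 \<Longrightarrow> dist (DD u v q) (DD u v p) < e/2"
      "\<And>q. dist q p < d2 \<Longrightarrow> dist (DD v u q) (DD v u p) < e/2"
      using e unfolding continuous_at_eps_delta dist_norm real_norm_def by (metis half_gt_zero)
    define m where "m = min r (min d1 d2)"
    \<comment> \<open>With this size every point of either parallelogram is at distance less than
      \<open>m\<close> from \<open>p\<close>; the summand 1 keeps the denominator positive when both
      vectors are 0.\<close>
    define h where "h = m / (2 * (norm u + norm v + 1))"
    have m: "m > 0" "m \<le> r" "m \<le> d1" "m \<le> d2" using r d by (auto simp: m_def)
    have h: "h > 0" using m by (simp add: h_def add_nonneg_pos)
    have "h * (norm u + norm v) < h * (2 * (norm u + norm v + 1))"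
      using h by (intro mult_strict_left_mono) (auto simp: add_nonneg_pos intro: add_increasing)
    also have "\<dots> = m" unfolding h_def by (simp add: add_nonneg_eq_0_iff)
    finally have hm: "h * (norm u + norm v) < m" .
    obtain a b where ab: "0 < a" "a < h" "0 < b" "b < h" and
      e1: "F (p + h *\<^sub>R u + h *\<^sub>R v) - F (p + h *\<^sub>R u) - F (p + h *\<^sub>R v) + F p
        = h * h * DD u v (p + a *\<^sub>R u + b *\<^sub>R v)"
      using key[of h u v] h hm m by auto
    obtain a' b' where ab': "0 < a'" "a' < h" "0 < b'" "b' < h" and
      e2: "F (p + h *\<^sub>R v + h *\<^sub>R u) - F (p + h *\<^sub>R v) - F (p + h *\<^sub>R u) + F p
        = h * h * DD v u (p + a' *\<^sub>R v + b' *\<^sub>R u)"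
      using key[of h v u] h hm m by (auto simp: add_ac)
    have swap: "p + h *\<^sub>R u + h *\<^sub>R v = p + h *\<^sub>R v + h *\<^sub>R u"
      by (simp add: add_ac)
    have "h * h * DD u v (p + a *\<^sub>R u + b *\<^sub>R v) = h * h * DD v u (p + a' *\<^sub>R v + b' *\<^sub>R u)"
      using e1[unfolded swap] e2 by linarith
    then have eq: "DD u v (p + a *\<^sub>R u + b *\<^sub>R v) = DD v u (p + a' *\<^sub>R v + b' *\<^sub>R u)" using h by simp
    have small: "dist (p + a *\<^sub>R u + b *\<^sub>R v) p < m" if "0 < a" "a < h" "0 < b" "b < h" "h * (norm u + norm v) < m" for a b u v
    proof -
      have "norm (a *\<^sub>R u + b *\<^sub>R v) \<le> a * norm u + b * norm v"
        using norm_triangle_ineq[of "a *\<^sub>R u" "b *\<^sub>R v"] that by simp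
      also have "\<dots> \<le> h * norm u + h * norm v"
        using that by (intro add_mono mult_right_mono) auto
      finally show ?thesis using that by (simp add: algebra_simps dist_norm)
    qed
    have "dist (DD u v (p + a *\<^sub>R u + b *\<^sub>R v)) (DD u v p) < e/2"
      using d(3) small[OF ab hm] m by simp
    moreover have "dist (DD v u (p + a' *\<^sub>R v + b' *\<^sub>R u)) (DD v u p) < e/2"
      using d(4) small[OF ab', of v u] hm m by (simp add: add.commute)
    ultimately show ?thesis unfolding dist_real_def eq by linarith
  qed
  then have "\<bar>DD u v p - DD v u p\<bar> \<le> 0" by (rule field_le_epsilon[of _ 0, simplified])
  then show ?thesis by (simp add: DD_def[abs_def] D_def[abs_def])
qed

section \<open>Wirtinger derivatives and holomorphic maps\<close>

lemma frechet_derivative_worksI: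
  "F differentiable (at p) \<Longrightarrow> (F has_derivative frechet_derivative F (at p)) (at p)"
  by (simp add: frechet_derivative_works)

section \<open>Complex scalars on the model spaces\<close>

lemma linear_mul_i: "linear mul_i"
  by (rule linearI) (simp_all add: mul_i_add mul_i_scaleR)

lemma mul_i_zero [simp]: "mul_i 0 = 0"
  by (rule linear_0[OF linear_mul_i])

lemma mul_i_complex [simp]: "mul_i (z::complex) = \<i> * z"
  by (simp add: mul_i_complex_def)

lemma mul_i_Pair [simp]: "mul_i (z, w) = (mul_i z, mul_i w)"
  by (simp add: mul_i_prod_def)

text \<open>The type class offers only real scaling and \<open>mul_i\<close>. Complex multiples are
  assembled from these in order to speak of complex lines \<open>q + cmul t v\<close> and of the
  linearity of \<open>wirt\<close> and antilinearity of \<open>wirt_bar\<close> in the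
  direction.\<close>

definition cmul :: "complex \<Rightarrow> 'a::complex_euclidean \<Rightarrow> 'a" where
  "cmul t v = Re t *\<^sub>R v + Im t *\<^sub>R mul_i v"

lemma cmul_complex [simp]: "cmul t (z::complex) = t * z"
  by (simp add: cmul_def complex_eq_iff)

lemma cmul_zero [simp]: "cmul t 0 = 0"
  by (simp add: cmul_def)

lemma cmul_zero_left [simp]: "cmul 0 v = 0"
  by (simp add: cmul_def)

lemma cmul_Pair [simp]: "cmul t (z, w) = (cmul t z, cmul t w)"
  by (simp add: cmul_def)

lemma mul_i_cmul: "mul_i (cmul t v) = cmul (\<i> * t) v"
  by (simp add: cmul_def mul_i_add mul_i_scaleR mul_i_mul_i)

lemma bounded_linear_cmul: "bounded_linear (\<lambda>t. cmul t v)"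
  unfolding cmul_def
  by (intro bounded_linear_add bounded_linear_scaleR_const bounded_linear_Re bounded_linear_Im
      bounded_linear_compose[OF bounded_linear_scaleR_left])

text \<open>The class does not make \<open>mul_i\<close> an isometry, so the norm of
  \<open>mul_i v\<close> enters the bound next to that of \<open>v\<close>.\<close>

lemma norm_cmul_le: "norm (cmul t v) \<le> cmod t * (norm v + norm (mul_i v))"
proof -
  have "norm (cmul t v) \<le> \<bar>Re t\<bar> * norm v + \<bar>Im t\<bar> * norm (mul_i v)"
    unfolding cmul_def by (metis norm_scaleR norm_triangle_ineq)
  also have "\<dots> \<le> cmod t * norm v + cmod t * norm (mul_i v)"
    by (intro add_mono mult_right_mono abs_Re_le_cmod abs_Im_le_cmod) auto
  finally show ?thesis by (simp add: algebra_simps)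
qed

section \<open>Rules for Wirtinger derivatives\<close>

lemma wirt_eqI:
  assumes "(F has_derivative D) (at p)"
  shows "wirt v F p = (D v - \<i> * D (mul_i v)) / 2"
    and "wirt_bar v F p = (D v + \<i> * D (mul_i v)) / 2"
  using frechet_derivative_at[OF assms] by (simp_all add: wirt_def wirt_bar_def)

lemma wirt_cong_open:
  assumes "open U" "p \<in> U" "\<And>x. x \<in> U \<Longrightarrow> F x = G x"
  shows "wirt v F p = wirt v G p" "wirt_bar v F p = wirt_bar v G p"
  using frechet_derivative_cong_open[OF assms] by (simp_all add: wirt_def wirt_bar_def)

lemma wirt_const [simp]: "wirt v (\<lambda>_. c) p = 0" "wirt_bar v (\<lambda>_. c) p = 0"
  by (simp_all add: wirt_def wirt_bar_def)

lemma wirt_add: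
  assumes "F differentiable (at p)" "G differentiable (at p)"
  shows "wirt v (\<lambda>q. F q + G q) p = wirt v F p + wirt v G p"
    and "wirt_bar v (\<lambda>q. F q + G q) p = wirt_bar v F p + wirt_bar v G p"
  unfolding wirt_eqI[OF has_derivative_add[OF frechet_derivative_worksI[OF assms(1)] frechet_derivative_worksI[OF assms(2)]]]
  by (simp_all add: wirt_def wirt_bar_def field_simps)

lemma wirt_mult:
  assumes "F differentiable (at p)" "G differentiable (at p)"
  shows "wirt v (\<lambda>q. F q * G q) p = wirt v F p * G p + F p * wirt v G p"
    and "wirt_bar v (\<lambda>q. F q * G q) p = wirt_bar v F p * G p + F p * wirt_bar v G p"
  unfolding wirt_eqI[OF has_derivative_mult[OF frechet_derivative_worksI[OF assms(1)] frechet_derivative_worksI[OF assms(2)]]]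
  by (simp_all add: wirt_def wirt_bar_def field_simps)

lemma wirt_minus:
  assumes "F differentiable (at p)"
  shows "wirt v (\<lambda>q. - F q) p = - wirt v F p"
    and "wirt_bar v (\<lambda>q. - F q) p = - wirt_bar v F p"
  unfolding wirt_eqI[OF has_derivative_minus[OF frechet_derivative_worksI[OF assms]]]
  by (simp_all add: wirt_def wirt_bar_def field_simps)

lemma wirt_cnj:
  assumes "F differentiable (at p)"
  shows "wirt v (\<lambda>q. cnj (F q)) p = cnj (wirt_bar v F p)"
    and "wirt_bar v (\<lambda>q. cnj (F q)) p = cnj (wirt v F p)"
  unfolding wirt_eqI[OF has_derivative_cnj[OF frechet_derivative_worksI[OF assms]]]
  by (simp_all add: wirt_def wirt_bar_def)

lemma wirt_vec_add:
  assumes "F differentiable (at p)"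
  shows "wirt (u + v) F p = wirt u F p + wirt v F p"
    and "wirt_bar (u + v) F p = wirt_bar u F p + wirt_bar v F p"
  using linear_frechet_derivative[OF assms]
  by (simp_all add: wirt_def wirt_bar_def mul_i_add linear_add field_simps)

lemma wirt_cmul:
  assumes "F differentiable (at p)"
  shows "wirt (cmul t v) F p = t * wirt v F p"
    and "wirt_bar (cmul t v) F p = cnj t * wirt_bar v F p"
proof -
  note l = linear_frechet_derivative[OF assms]
  have "wirt (a *\<^sub>R v + b *\<^sub>R mul_i v) F p = Complex a b * wirt v F p"
    "wirt_bar (a *\<^sub>R v + b *\<^sub>R mul_i v) F p = cnj (Complex a b) * wirt_bar v F p" for a b
    unfolding wirt_def wirt_bar_def
    by (simp_all add: mul_i_add mul_i_scaleR mul_i_mul_i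
        linear_add[OF l] linear_cmul[OF l] linear_neg[OF l] linear_diff[OF l] complex_eq_iff field_simps)
  from this[of "Re t" "Im t"]
  show "wirt (cmul t v) F p = t * wirt v F p" "wirt_bar (cmul t v) F p = cnj t * wirt_bar v F p"
    by (simp_all add: cmul_def)
qed

text \<open>A complex linear inner derivative commutes with \<open>mul_i\<close>, so the two types
  of derivative do not mix. All holomorphic coordinate changes below are handled by this chain
  rule.\<close>

lemma wirt_comp:
  assumes "(\<Phi> has_derivative D) (at p)" "\<And>v. D (mul_i v) = mul_i (D v)" "F differentiable (at (\<Phi> p))"
  shows "wirt v (\<lambda>q. F (\<Phi> q)) p = wirt (D v) F (\<Phi> p)"
    and "wirt_bar v (\<lambda>q. F (\<Phi> q)) p = wirt_bar (D v) F (\<Phi> p)"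
  unfolding wirt_eqI[OF has_derivative_compose[OF assms(1) frechet_derivative_worksI[OF assms(3)]]]
  by (simp_all add: wirt_def wirt_bar_def assms(2))

lemma frechet_derivative_wirt:
  assumes "open U" "p \<in> U" "smooth_on F U"
  shows "frechet_derivative (wirt v F) (at p) u =
      (frechet_derivative (\<lambda>q. frechet_derivative F (at q) v) (at p) u
       - \<i> * frechet_derivative (\<lambda>q. frechet_derivative F (at q) (mul_i v)) (at p) u) / 2"
    and "frechet_derivative (wirt_bar v F) (at p) u =
      (frechet_derivative (\<lambda>q. frechet_derivative F (at q) v) (at p) u
       + \<i> * frechet_derivative (\<lambda>q. frechet_derivative F (at q) (mul_i v)) (at p) u) / 2"
proof -
  let ?D = "\<lambda>v q. frechet_derivative F (at q) v"
  have d: "(?D v has_derivative frechet_derivative (?D v) (at p)) (at p)" for v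
    using smooth_onD[OF smooth_on_frechet[OF assms(3)] assms(2)] by (simp add: frechet_derivative_works)
  have "(wirt v F has_derivative (\<lambda>u. (frechet_derivative (?D v) (at p) u
       - \<i> * frechet_derivative (?D (mul_i v)) (at p) u) / 2)) (at p)"
    unfolding wirt_def[abs_def] by (intro derivative_eq_intros refl) (auto intro!: d)
  from fun_cong[OF frechet_derivative_at[OF this], of u] show "frechet_derivative (wirt v F) (at p) u =
      (frechet_derivative (?D v) (at p) u - \<i> * frechet_derivative (?D (mul_i v)) (at p) u) / 2"
    by simp
  have "(wirt_bar v F has_derivative (\<lambda>u. (frechet_derivative (?D v) (at p) u
       + \<i> * frechet_derivative (?D (mul_i v)) (at p) u) / 2)) (at p)"
    unfolding wirt_bar_def[abs_def] by (intro derivative_eq_intros refl) (auto intro!: d)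
  from fun_cong[OF frechet_derivative_at[OF this], of u] show "frechet_derivative (wirt_bar v F) (at p) u =
      (frechet_derivative (?D v) (at p) u + \<i> * frechet_derivative (?D (mul_i v)) (at p) u) / 2"
    by simp
qed

lemma smooth_on_wirt:
  assumes "open U" "smooth_on F U"
  shows "smooth_on (wirt v F) U" "smooth_on (wirt_bar v F) U"
  unfolding wirt_def[abs_def] wirt_bar_def[abs_def] divide_inverse
  by (intro smooth_on_mult smooth_on_diff smooth_on_add smooth_on_const smooth_on_frechet assms)+

text \<open>Bounded linear functionals commute with both differentiations, and \<open>Re\<close> and
  \<open>Im\<close> together determine a complex number; this reduces the claim to real
  functions.\<close>

lemma symmetric_second_derivative:
  fixes F :: "'a::real_normed_vector \<Rightarrow> complex"
  assumes U: "open U" "p \<in> U" and F: "smooth_on F U"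
  shows "frechet_derivative (\<lambda>q. frechet_derivative F (at q) u) (at p) v =
    frechet_derivative (\<lambda>q. frechet_derivative F (at q) v) (at p) u"
proof -
  have L: "frechet_derivative (\<lambda>q. L (G q)) (at q) w = L (frechet_derivative G (at q) w)"
    if "bounded_linear L" "G differentiable (at q)" for L :: "complex \<Rightarrow> real" and G :: "'a \<Rightarrow> complex" and q w
    using frechet_derivative_at[OF bounded_linear.has_derivative[OF that(1) frechet_derivative_worksI[OF that(2)]]]
    by metis
  have L2: "frechet_derivative (\<lambda>q. frechet_derivative (\<lambda>q. L (F q)) (at q) u) (at p) v =
      L (frechet_derivative (\<lambda>q. frechet_derivative F (at q) u) (at p) v)"
    if "bounded_linear L" for L :: "complex \<Rightarrow> real" and u v
  proof -
    have "frechet_derivative (\<lambda>q. frechet_derivative (\<lambda>q. L (F q)) (at q) u) (at p) =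
        frechet_derivative (\<lambda>q. L (frechet_derivative F (at q) u)) (at p)"
      by (rule frechet_derivative_cong_open[OF U]) (simp add: L[OF that] smooth_onD[OF F])
    then show ?thesis
      by (simp add: L[OF that] smooth_onD[OF smooth_on_frechet[OF F] U(2)])
  qed
  have "L (frechet_derivative (\<lambda>q. frechet_derivative F (at q) u) (at p) v) =
      L (frechet_derivative (\<lambda>q. frechet_derivative F (at q) v) (at p) u)"
    if "bounded_linear L" for L :: "complex \<Rightarrow> real"
    using symmetric_second_derivative_real[OF U smooth_on_imp_Ck_on[OF smooth_on_bounded_linear[OF that U(1) F]], of u v]
      L2[OF that] by simp
  from this[OF bounded_linear_Re] this[OF bounded_linear_Im] show ?thesis
    by (simp add: complex_eq_iff)
qed

text \<open>Expanding both operators gives the same combination of four second derivatives, in the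
  directions \<open>u\<close>, \<open>mul_i u\<close> paired with \<open>v\<close>,
  \<open>mul_i v\<close>, and each of these is symmetric.\<close>

lemma wirt_commute:
  assumes "open U" "p \<in> U" "smooth_on F U"
  shows "wirt u (wirt_bar v F) p = wirt_bar v (wirt u F) p"
    and "wirt u (wirt v F) p = wirt v (wirt u F) p"
    and "wirt_bar u (wirt_bar v F) p = wirt_bar v (wirt_bar u F) p"
  unfolding wirt_def[of _ "wirt _ F"] wirt_def[of _ "wirt_bar _ F"]
    wirt_bar_def[of _ "wirt _ F"] wirt_bar_def[of _ "wirt_bar _ F"] frechet_derivative_wirt[OF assms]
  using symmetric_second_derivative[OF assms, of u v] symmetric_second_derivative[OF assms, of u "mul_i v"]
    symmetric_second_derivative[OF assms, of "mul_i u" v] symmetric_second_derivative[OF assms, of "mul_i u" "mul_i v"]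
  by (simp_all add: field_simps)

section \<open>Maps with complex linear derivative\<close>

lemma cholomorphic_onD:
  assumes "cholomorphic_on F U" "p \<in> U"
  shows "F differentiable (at p)"
    and "(F has_derivative frechet_derivative F (at p)) (at p)"
    and "frechet_derivative F (at p) (mul_i v) = mul_i (frechet_derivative F (at p) v)"
proof -
  obtain D where D: "(F has_derivative D) (at p)" "\<And>v. D (mul_i v) = mul_i (D v)"
    using assms unfolding cholomorphic_on_def by blast
  then show "F differentiable (at p)" by (auto simp: differentiable_def)
  have "D = frechet_derivative F (at p)" by (rule frechet_derivative_at[OF D(1)])
  with D show "(F has_derivative frechet_derivative F (at p)) (at p)"
    "frechet_derivative F (at p) (mul_i v) = mul_i (frechet_derivative F (at p) v)" by auto
qed

lemma cholomorphic_on_wirt: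
  assumes "cholomorphic_on F U" "p \<in> U"
  shows "wirt v F p = frechet_derivative F (at p) v" "wirt_bar v F p = 0"
  using cholomorphic_onD(3)[OF assms] by (simp_all add: wirt_def wirt_bar_def flip: mult.assoc)

lemma cholomorphic_onI_wirt_bar:
  assumes "\<And>p. p \<in> U \<Longrightarrow> F differentiable (at p)" "\<And>p v. p \<in> U \<Longrightarrow> wirt_bar v F p = 0"
  shows "cholomorphic_on F U"
  unfolding cholomorphic_on_def
proof
  fix p assume p: "p \<in> U"
  have "frechet_derivative F (at p) (mul_i v) = mul_i (frechet_derivative F (at p) v)" for v
  proof -
    have "frechet_derivative F (at p) v + \<i> * frechet_derivative F (at p) (mul_i v) = 0"
      using assms(2)[OF p, of v] by (simp add: wirt_bar_def)
    then have "\<i> * (frechet_derivative F (at p) v + \<i> * frechet_derivative F (at p) (mul_i v)) = 0" by simp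
    then show ?thesis by (simp add: algebra_simps flip: mult.assoc)
  qed
  then show "\<exists>D. (F has_derivative D) (at p) \<and> (\<forall>v. D (mul_i v) = mul_i (D v))"
    using frechet_derivative_worksI[OF assms(1)[OF p]] by blast
qed

lemma cholomorphic_on_subset: "cholomorphic_on F U \<Longrightarrow> V \<subseteq> U \<Longrightarrow> cholomorphic_on F V"
  by (auto simp: cholomorphic_on_def)

lemma cholomorphic_on_cong:
  assumes "open U" "\<And>x. x \<in> U \<Longrightarrow> F x = G x" "cholomorphic_on F U"
  shows "cholomorphic_on G U"
  using assms unfolding cholomorphic_on_def
  by (meson has_derivative_transform_within_open)

lemma cholomorphic_on_compose:
  assumes "cholomorphic_on F U" "cholomorphic_on G V" "F ` U \<subseteq> V"
  shows "cholomorphic_on (\<lambda>p. G (F p)) U"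
  unfolding cholomorphic_on_def
proof
  fix p assume p: "p \<in> U"
  then have Fp: "F p \<in> V" using assms by blast
  show "\<exists>D. ((\<lambda>p. G (F p)) has_derivative D) (at p) \<and> (\<forall>v. D (mul_i v) = mul_i (D v))"
    using has_derivative_compose[OF cholomorphic_onD(2)[OF assms(1) p] cholomorphic_onD(2)[OF assms(2) Fp]]
      cholomorphic_onD(3)[OF assms(1) p] cholomorphic_onD(3)[OF assms(2) Fp]
    by (intro exI conjI allI) auto
qed

lemma cholomorphic_on_complex_linear:
  assumes "bounded_linear L" "\<And>v. L (mul_i v) = mul_i (L v)"
  shows "cholomorphic_on L U"
  unfolding cholomorphic_on_def
  using bounded_linear_imp_has_derivative[OF assms(1)] assms(2) by blast

lemma cholomorphic_on_imp_has_field_derivative: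
  fixes F :: "complex \<Rightarrow> complex"
  assumes "cholomorphic_on F U" "p \<in> U"
  shows "(F has_field_derivative wirt 1 F p) (at p)"
proof -
  note l = linear_frechet_derivative[OF cholomorphic_onD(1)[OF assms]]
  have "frechet_derivative F (at p) v = wirt 1 F p * v" for v
  proof -
    have "v = Re v *\<^sub>R 1 + Im v *\<^sub>R mul_i 1" by (simp add: complex_eq_iff)
    then have "frechet_derivative F (at p) v = Re v *\<^sub>R frechet_derivative F (at p) 1
        + Im v *\<^sub>R mul_i (frechet_derivative F (at p) 1)"
      using linear_add[OF l] linear_cmul[OF l] cholomorphic_onD(3)[OF assms] by metis
    also have "\<dots> = frechet_derivative F (at p) 1 * v" by (simp add: complex_eq_iff)
    finally show ?thesis by (simp add: cholomorphic_on_wirt[OF assms])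
  qed
  then have "frechet_derivative F (at p) = (*) (wirt 1 F p)" by auto
  then show ?thesis
    using cholomorphic_onD(2)[OF assms] unfolding has_field_derivative_def by metis
qed

lemma cholomorphic_on_iff_holomorphic_on:
  fixes F :: "complex \<Rightarrow> complex"
  assumes "open U"
  shows "cholomorphic_on F U \<longleftrightarrow> F holomorphic_on U"
proof
  assume "cholomorphic_on F U"
  then show "F holomorphic_on U"
    using cholomorphic_on_imp_has_field_derivative assms holomorphic_on_open by blast
next
  assume "F holomorphic_on U"
  then show "cholomorphic_on F U"
    using assms unfolding holomorphic_on_open[OF assms] cholomorphic_on_def has_field_derivative_def
    by (metis mul_i_complex mult.left_commute)
qed

lemma cholomorphic_on_imp_deriv:
  fixes F :: "complex \<Rightarrow> complex"
  assumes "cholomorphic_on F U" "p \<in> U"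
  shows "deriv F p = wirt 1 F p"
  by (rule DERIV_imp_deriv[OF cholomorphic_on_imp_has_field_derivative[OF assms]])

text \<open>Restriction to a complex line is the passage to one variable: it makes Cauchy's integral
  formula available for directional derivatives.\<close>

lemma cholomorphic_on_line_has_field_derivative:
  fixes F :: "'a::complex_euclidean \<Rightarrow> complex"
  assumes "cholomorphic_on F U" "q + cmul t v \<in> U"
  shows "((\<lambda>t. F (q + cmul t v)) has_field_derivative frechet_derivative F (at (q + cmul t v)) v) (at t)"
proof -
  let ?V = "{t. q + cmul t v \<in> U}"
  have "cholomorphic_on (\<lambda>t. q + cmul t v) ?V"
    unfolding cholomorphic_on_def
  proof
    fix t
    have "((\<lambda>t. q + cmul t v) has_derivative (\<lambda>t. cmul t v)) (at t)"
      using has_derivative_add[OF has_derivative_const bounded_linear_imp_has_derivative[OF bounded_linear_cmul]]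
      by fastforce
    then show "\<exists>D. ((\<lambda>t. q + cmul t v) has_derivative D) (at t) \<and> (\<forall>v. D (mul_i v) = mul_i (D v))"
      by (auto simp: mul_i_cmul)
  qed
  from cholomorphic_on_compose[OF this assms(1)]
  have h: "cholomorphic_on (\<lambda>t. F (q + cmul t v)) ?V" by blast
  have d: "((\<lambda>t. q + cmul t v) has_derivative (\<lambda>t. cmul t v)) (at t)"
    using has_derivative_add[OF has_derivative_const bounded_linear_imp_has_derivative[OF bounded_linear_cmul]]
    by fastforce
  have "wirt 1 (\<lambda>t. F (q + cmul t v)) t = wirt (cmul 1 v) F (q + cmul t v)"
    by (rule wirt_comp(1)[OF d]) (use assms in \<open>auto simp: mul_i_cmul intro: cholomorphic_onD\<close>)
  also have "\<dots> = frechet_derivative F (at (q + cmul t v)) v"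
    by (subst cholomorphic_on_wirt[OF assms]) (simp add: cmul_def)
  finally show ?thesis
    using cholomorphic_on_imp_has_field_derivative[OF h, of t] assms by simp
qed

lemma cholomorphic_on_local:
  assumes "\<And>p. p \<in> U \<Longrightarrow> \<exists>V. p \<in> V \<and> cholomorphic_on F V"
  shows "cholomorphic_on F U"
  unfolding cholomorphic_on_def
proof
  fix p assume "p \<in> U"
  then obtain V where "p \<in> V" "cholomorphic_on F V" using assms by blast
  then show "\<exists>D. (F has_derivative D) (at p) \<and> (\<forall>v. D (mul_i v) = mul_i (D v))"
    using cholomorphic_onD(2,3) by blast
qed

lemma cholomorphic_on_mult:
  fixes F G :: "'a::complex_euclidean \<Rightarrow> complex"
  assumes "cholomorphic_on F U" "cholomorphic_on G U"
  shows "cholomorphic_on (\<lambda>p. F p * G p) U"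
  unfolding cholomorphic_on_def
proof
  fix p assume p: "p \<in> U"
  show "\<exists>D. ((\<lambda>p. F p * G p) has_derivative D) (at p) \<and> (\<forall>v. D (mul_i v) = mul_i (D v))"
    using has_derivative_mult[OF cholomorphic_onD(2)[OF assms(1) p] cholomorphic_onD(2)[OF assms(2) p]]
      cholomorphic_onD(3)[OF assms(1) p] cholomorphic_onD(3)[OF assms(2) p]
    by (intro exI conjI allI) (auto simp: algebra_simps)
qed

section \<open>Derivatives of holomorphic functions of several variables\<close>

text \<open>Cauchy's formula for the first derivative on the line through \<open>q\<close> in
  direction \<open>v\<close>. The velocity of the circle cancels the factor 1 / (2 pi i) and one
  power of the denominator. The circle is centred at the parameter 0 and not at \<open>q\<close>, so
  the domain of integration stays fixed when \<open>q\<close> moves.\<close>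

lemma cholomorphic_on_cauchy_circle:
  fixes F :: "'a::complex_euclidean \<Rightarrow> complex"
  assumes F: "cholomorphic_on F U" and \<rho>: "\<rho> > 0"
    and U: "\<And>t. cmod t \<le> \<rho> \<Longrightarrow> q + cmul t v \<in> U"
  shows "frechet_derivative F (at q) v =
    integral {0..1} (\<lambda>x. F (q + cmul (circlepath 0 \<rho> x) v) / circlepath 0 \<rho> x)"
proof -
  let ?\<phi> = "\<lambda>t. F (q + cmul t v)"
  have d: "(?\<phi> has_field_derivative frechet_derivative F (at (q + cmul t v)) v) (at t)" if "cmod t \<le> \<rho>" for t
    by (rule cholomorphic_on_line_has_field_derivative[OF F U[OF that]])
  have cont: "continuous_on (cball 0 \<rho>) ?\<phi>"
    using d by (auto intro!: continuous_at_imp_continuous_on DERIV_isCont)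
  have hol: "?\<phi> holomorphic_on ball 0 \<rho>"
    using d unfolding holomorphic_on_open[OF open_ball] by (intro ballI exI) (rule d, simp)
  have vd: "vector_derivative (circlepath 0 \<rho>) (at x) = 2 * of_real pi * \<i> * circlepath 0 \<rho> x" for x
    using vector_derivative_at[OF has_vector_derivative_circlepath, of 0 \<rho> x] by (simp add: circlepath)
  have "frechet_derivative F (at q) v =
      1 / (2 * of_real pi * \<i>) * contour_integral (circlepath 0 \<rho>) (\<lambda>u. ?\<phi> u / (u - 0)\<^sup>2)"
    using Cauchy_derivative_integral_circlepath(2)[OF cont hol, of 0] d[of 0] \<rho>
    by (intro DERIV_unique[of ?\<phi> _ 0]) simp_all
  also have "\<dots> = 1 / (2 * of_real pi * \<i>) * integral {0..1}
      (\<lambda>x. ?\<phi> (circlepath 0 \<rho> x) / (circlepath 0 \<rho> x)\<^sup>2 * (2 * of_real pi * \<i> * circlepath 0 \<rho> x))"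
    unfolding contour_integral_integral vd by simp
  also have "\<dots> = integral {0..1}
      (\<lambda>x. 1 / (2 * of_real pi * \<i>) *
        (?\<phi> (circlepath 0 \<rho> x) / (circlepath 0 \<rho> x)\<^sup>2 * (2 * of_real pi * \<i> * circlepath 0 \<rho> x)))"
    by (rule integral_mult_right[symmetric])
  also have "\<dots> = integral {0..1} (\<lambda>x. ?\<phi> (circlepath 0 \<rho> x) / circlepath 0 \<rho> x)"
    by (rule integral_cong) (simp add: power2_eq_square)
  finally show ?thesis .
qed

lemma cholomorphic_on_cauchy_circle_local:
  fixes F :: "'a::complex_euclidean \<Rightarrow> complex"
  assumes F: "cholomorphic_on F U" and U: "open U" "p \<in> U"
  obtains r \<rho> where "r > 0" "\<rho> > 0" "ball p r \<subseteq> U"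
    "\<And>q t. q \<in> ball p r \<Longrightarrow> cmod t \<le> \<rho> \<Longrightarrow> q + cmul t v \<in> U"
    "\<And>q. q \<in> ball p r \<Longrightarrow> frechet_derivative F (at q) v =
      integral {0..1} (\<lambda>x. F (q + cmul (circlepath 0 \<rho> x) v) / circlepath 0 \<rho> x)"
proof -
  obtain R where R: "R > 0" "ball p R \<subseteq> U" using U openE by blast
  \<comment> \<open>The radius R of a ball in \<open>U\<close> is shared equally between the
    position of \<open>q\<close> and the displacement \<open>cmul t v\<close>. The summand 1 keeps
    \<open>N\<close> positive when \<open>v = 0\<close>.\<close>
  define N where "N = norm v + norm (mul_i v) + 1"
  have N: "N > 0" by (simp add: N_def add_nonneg_pos)
  define \<rho> where "\<rho> = R / 2 / N"
  have \<rho>: "\<rho> > 0" using R N by (simp add: \<rho>_def)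
  have inU: "q + cmul t v \<in> U" if "q \<in> ball p (R/2)" "cmod t \<le> \<rho>" for q t
  proof -
    have "norm (cmul t v) \<le> \<rho> * (norm v + norm (mul_i v))"
      using norm_cmul_le[of t v] mult_right_mono[OF that(2), of "norm v + norm (mul_i v)"] by simp
    also have "\<dots> \<le> \<rho> * N" using \<rho> by (intro mult_left_mono) (auto simp: N_def)
    also have "\<dots> = R / 2" using N by (simp add: \<rho>_def)
    finally have "norm (cmul t v) \<le> R / 2" .
    moreover have "dist p (q + cmul t v) \<le> dist p q + norm (cmul t v)"
      using dist_triangle[of p "q + cmul t v" q] by (simp add: dist_norm)
    ultimately have "q + cmul t v \<in> ball p R" using that(1) by simp
    then show ?thesis using R by blast
  qed
  show ?thesis
    using that[of "R/2" \<rho>] R \<rho> inU cholomorphic_on_cauchy_circle[OF F \<rho>] by fastforce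
qed

lemma continuous_on_circlepath: "continuous_on A (circlepath z r)"
  unfolding circlepath by (intro continuous_intros)

lemma norm_circlepath: "r > 0 \<Longrightarrow> cmod (circlepath 0 r x) = r"
  by (simp add: circlepath norm_mult)

lemma cholomorphic_on_imp_continuous_on: "cholomorphic_on F U \<Longrightarrow> continuous_on U F"
  by (meson cholomorphic_onD(1) continuous_at_imp_continuous_on differentiable_imp_continuous_within)

text \<open>Joint continuity in the point and the angle is what the theorems on parameter integrals
  ask for. It is used with \<open>G\<close> equal to \<open>F\<close> and to a directional
  derivative of \<open>F\<close>.\<close>

lemma continuous_on_cauchy_kernel:
  fixes G :: "'a::complex_euclidean \<Rightarrow> complex"
  assumes G: "continuous_on U G" and \<rho>: "\<rho> > 0"
    and U: "\<And>q t. q \<in> V \<Longrightarrow> cmod t \<le> \<rho> \<Longrightarrow> q + cmul t v \<in> U"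
  shows "continuous_on (V \<times> A) (\<lambda>(q, x). G (q + cmul (circlepath 0 \<rho> x) v) / circlepath 0 \<rho> x)"
proof -
  have c: "continuous_on (V \<times> A) (\<lambda>y. circlepath 0 \<rho> (snd y))"
    by (rule continuous_on_compose2[OF continuous_on_circlepath[of UNIV]]) (auto intro: continuous_intros)
  have m: "continuous_on (V \<times> A) (\<lambda>y. fst y + cmul (circlepath 0 \<rho> (snd y)) v)"
    by (intro continuous_intros bounded_linear.continuous_on[OF bounded_linear_cmul] c)
  have "circlepath 0 \<rho> x \<noteq> 0" for x using norm_circlepath[OF \<rho>, of x] \<rho> by force
  then show ?thesis
    unfolding split_beta
    by (intro continuous_on_divide continuous_on_compose2[OF G m] c)
      (use \<rho> in \<open>auto intro!: U simp: norm_circlepath\<close>)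
qed

text \<open>Cauchy's formula presents the derivative as an integral with continuous integrand. This
  must precede differentiation under the integral, whose hypothesis is continuity of the
  differentiated integrand.\<close>

lemma continuous_on_frechet_derivative_cholomorphic:
  fixes F :: "'a::complex_euclidean \<Rightarrow> complex"
  assumes F: "cholomorphic_on F U" and U: "open U"
  shows "continuous_on U (\<lambda>q. frechet_derivative F (at q) v)"
proof (rule continuous_at_imp_continuous_on, rule ballI)
  fix p assume "p \<in> U"
  obtain r \<rho> where r: "r > 0" "\<rho> > 0" and "ball p r \<subseteq> U"
    and inU: "\<And>q t. q \<in> ball p r \<Longrightarrow> cmod t \<le> \<rho> \<Longrightarrow> q + cmul t v \<in> U"
    and eq: "\<And>q. q \<in> ball p r \<Longrightarrow> frechet_derivative F (at q) v =
      integral {0..1} (\<lambda>x. F (q + cmul (circlepath 0 \<rho> x) v) / circlepath 0 \<rho> x)"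
    by (rule cholomorphic_on_cauchy_circle_local[OF F U \<open>p \<in> U\<close>, where v = v]) (rule that)
  have "continuous_on (ball p r) (\<lambda>q. integral (cbox 0 1) (\<lambda>x. F (q + cmul (circlepath 0 \<rho> x) v) / circlepath 0 \<rho> x))"
    by (intro integral_continuous_on_param continuous_on_cauchy_kernel[OF cholomorphic_on_imp_continuous_on[OF F] r(2) inU])
  then have "continuous_on (ball p r) (\<lambda>q. frechet_derivative F (at q) v)"
    by (rule continuous_on_eq) (simp add: eq)
  then show "isCont (\<lambda>q. frechet_derivative F (at q) v) p"
    using r by (simp add: continuous_on_eq_continuous_at)
qed

text \<open>Cauchy's formula is differentiated under the integral sign. The integrand has a complex
  linear derivative in \<open>q\<close> for each fixed angle, and an integral of complex linear maps
  is complex linear.\<close>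

theorem cholomorphic_on_frechet_derivative:
  fixes F :: "'a::complex_euclidean \<Rightarrow> complex"
  assumes F: "cholomorphic_on F U" and U: "open U"
  shows "cholomorphic_on (\<lambda>q. frechet_derivative F (at q) v) U"
  unfolding cholomorphic_on_def
proof
  fix p assume "p \<in> U"
  obtain r \<rho> where r: "r > 0" "\<rho> > 0" and "ball p r \<subseteq> U"
    and inU: "\<And>q t. q \<in> ball p r \<Longrightarrow> cmod t \<le> \<rho> \<Longrightarrow> q + cmul t v \<in> U"
    and eq: "\<And>q. q \<in> ball p r \<Longrightarrow> frechet_derivative F (at q) v =
      integral {0..1} (\<lambda>x. F (q + cmul (circlepath 0 \<rho> x) v) / circlepath 0 \<rho> x)"
    by (rule cholomorphic_on_cauchy_circle_local[OF F U \<open>p \<in> U\<close>, where v = v]) (rule that)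
  let ?c = "circlepath 0 \<rho>"
  have c0: "?c x \<noteq> 0" for x using norm_circlepath[OF r(2), of x] r by force
  have cU: "q + cmul (?c x) v \<in> U" if "q \<in> ball p r" for q x
    using inU[OF that, of "?c x"] norm_circlepath[OF r(2), of x] by simp
  define D where "D q x = Blinfun (\<lambda>w. frechet_derivative F (at (q + cmul (?c x) v)) w / ?c x)" for q x
  have D: "blinfun_apply (D q x) = (\<lambda>w. frechet_derivative F (at (q + cmul (?c x) v)) w / ?c x)"
    and hd: "((\<lambda>q. F (q + cmul (?c x) v) / ?c x) has_derivative blinfun_apply (D q x)) (at q within ball p r)"
    if "q \<in> ball p r" for q x
  proof -
    have s: "((\<lambda>q. q + cmul (?c x) v) has_derivative (\<lambda>w. w)) (at q)"
      by (auto intro!: derivative_eq_intros)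
    have h: "((\<lambda>q. F (q + cmul (?c x) v) / ?c x) has_derivative
        (\<lambda>w. frechet_derivative F (at (q + cmul (?c x) v)) w / ?c x)) (at q)"
      using has_derivative_compose[OF s cholomorphic_onD(2)[OF F cU[OF that]]]
      by (auto intro!: derivative_eq_intros simp: c0)
    show "blinfun_apply (D q x) = (\<lambda>w. frechet_derivative F (at (q + cmul (?c x) v)) w / ?c x)"
      unfolding D_def using has_derivative_bounded_linear[OF h] by (rule bounded_linear_Blinfun_apply)
    with h show "((\<lambda>q. F (q + cmul (?c x) v) / ?c x) has_derivative blinfun_apply (D q x)) (at q within ball p r)"
      by (simp add: has_derivative_at_withinI)
  qed
  \<comment> \<open>The source space is finite-dimensional, so continuity of an operator-valued map
    may be tested by evaluating at fixed vectors; the values are again Cauchy kernels.\<close>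
  have contD: "continuous_on (ball p r \<times> cbox 0 1) (\<lambda>(q, x). D q x)"
  proof (rule continuous_on_blinfun_componentwise)
    fix i :: 'a
    have "continuous_on (ball p r \<times> cbox 0 1) (\<lambda>(q, x). frechet_derivative F (at (q + cmul (?c x) v)) i / ?c x)"
      by (rule continuous_on_cauchy_kernel[OF continuous_on_frechet_derivative_cholomorphic[OF F U] r(2) inU])
    then show "continuous_on (ball p r \<times> cbox 0 1) (\<lambda>y. blinfun_apply (case y of (q, x) \<Rightarrow> D q x) i)"
      by (rule continuous_on_eq) (auto simp: D)
  qed
  have int: "(\<lambda>x. F (q + cmul (?c x) v) / ?c x) integrable_on cbox 0 1" if "q \<in> ball p r" for q
  proof (rule integrable_continuous)
    have 1: "continuous_on (cbox (0::real) 1) (\<lambda>x. (q, x))" by (intro continuous_intros)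
    have 2: "continuous_on (ball p r \<times> cbox 0 1) (\<lambda>(q, x). F (q + cmul (?c x) v) / ?c x)"
      by (rule continuous_on_cauchy_kernel[OF cholomorphic_on_imp_continuous_on[OF F] r(2) inU])
    show "continuous_on (cbox 0 1) (\<lambda>x. F (q + cmul (?c x) v) / ?c x)"
      using continuous_on_compose2[OF 2 1] that by force
  qed
  have p: "p \<in> ball p r" using r by simp
  have intD: "D p integrable_on cbox 0 1"
  proof (rule integrable_continuous)
    have 1: "continuous_on (cbox (0::real) 1) (\<lambda>x. (p, x))" by (intro continuous_intros)
    show "continuous_on (cbox 0 1) (D p)"
      using continuous_on_compose2[OF contD 1] p by force
  qed
  have "((\<lambda>q. integral (cbox 0 1) (\<lambda>x. F (q + cmul (?c x) v) / ?c x)) has_derivative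
      blinfun_apply (integral (cbox 0 1) (D p))) (at p within ball p r)"
    by (rule leibniz_rule[OF hd int contD p convex_ball])
  then have "((\<lambda>q. integral (cbox 0 1) (\<lambda>x. F (q + cmul (?c x) v) / ?c x)) has_derivative
      blinfun_apply (integral (cbox 0 1) (D p))) (at p)"
    using at_within_open[OF p open_ball] by simp
  then have "((\<lambda>q. frechet_derivative F (at q) v) has_derivative blinfun_apply (integral (cbox 0 1) (D p))) (at p)"
    by (rule has_derivative_transform_within_open[OF _ open_ball p]) (simp add: eq)
  moreover have "blinfun_apply (integral (cbox 0 1) (D p)) w = integral (cbox 0 1) (\<lambda>x. blinfun_apply (D p x) w)" for w
    using integral_linear[OF intD, of "\<lambda>B. blinfun_apply B w"]
    by (simp add: o_def blinfun.bounded_linear_left)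
  \<comment> \<open>Evaluation at a vector passes through the integral, and on complex values
    \<open>mul_i\<close> is multiplication by a constant, which can be pulled out.\<close>
  then have "blinfun_apply (integral (cbox 0 1) (D p)) (mul_i w) = mul_i (blinfun_apply (integral (cbox 0 1) (D p)) w)" for w
    using cholomorphic_onD(3)[OF F cU[OF p]] by (simp add: D[OF p] flip: integral_mult_right)
  ultimately show "\<exists>D. ((\<lambda>q. frechet_derivative F (at q) v) has_derivative D) (at p) \<and> (\<forall>w. D (mul_i w) = mul_i (D w))"
    by blast
qed

corollary cholomorphic_on_wirt_cholomorphic:
  fixes F :: "'a::complex_euclidean \<Rightarrow> complex"
  assumes "cholomorphic_on F U" "open U"
  shows "cholomorphic_on (wirt v F) U"
  by (rule cholomorphic_on_cong[OF assms(2) _ cholomorphic_on_frechet_derivative[OF assms]])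
    (simp add: cholomorphic_on_wirt[OF assms(1)])

text \<open>Directional derivatives are holomorphic again, so the induction on the order may be run
  with \<open>F\<close> arbitrary.\<close>

corollary cholomorphic_on_imp_smooth_on:
  fixes F :: "'a::complex_euclidean \<Rightarrow> complex"
  assumes "cholomorphic_on F U" "open U"
  shows "smooth_on F U"
  unfolding smooth_on_def
proof
  show "Ck_on k F U" for k
    using assms(1)
  proof (induction k arbitrary: F)
    case 0
    then show ?case by (simp add: cholomorphic_on_imp_continuous_on)
  next
    case (Suc k)
    then show ?case
      by (simp add: cholomorphic_onD(1) cholomorphic_on_frechet_derivative[OF _ assms(2)])
  qed
qed

section \<open>Integration by parts\<close>

text \<open>Translation invariance makes the integral of every difference quotient vanish.\<close>

lemma integral_frechet_derivative_eq_0: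
  fixes u :: "'a::euclidean_space \<Rightarrow> 'b::euclidean_space"
  assumes u: "Ck_on 1 u UNIV" and supp: "\<And>p. p \<notin> cball 0 R \<Longrightarrow> u p = 0"
  shows "integrable lborel (\<lambda>p. frechet_derivative u (at p) v)"
    and "(LINT p|lborel. frechet_derivative u (at p) v) = 0"
proof -
  define D where "D p = frechet_derivative u (at p) v" for p
  have du: "(u has_derivative frechet_derivative u (at p)) (at p)" for p
    using u by (simp add: frechet_derivative_works)
  have contD: "continuous_on UNIV D" using u by (simp add: D_def[abs_def])
  have contu: "continuous_on UNIV u"
    using du has_derivative_continuous by (blast intro: continuous_at_imp_continuous_on)
  have D0: "D p = 0" if "p \<notin> cball 0 R" for p
  proof -
    have "frechet_derivative u (at p) = frechet_derivative (\<lambda>_. 0) (at p)"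
      by (rule frechet_derivative_cong_open[of "- cball 0 R"]) (use that supp in auto)
    then show ?thesis by (simp add: D_def frechet_derivative_const)
  qed
  have integ: "integrable lborel f" if "continuous_on UNIV f" "\<And>p. p \<notin> cball 0 r \<Longrightarrow> f p = 0" for f :: "'a \<Rightarrow> 'b" and r
  proof -
    have "integrable lborel (\<lambda>p. indicator (cball 0 r) p *\<^sub>R f p)"
      by (rule borel_integrable_compact) (auto intro: continuous_on_subset[OF that(1)])
    moreover have "(\<lambda>p. indicator (cball 0 r) p *\<^sub>R f p) = f"
      using that(2) by (auto simp: fun_eq_iff indicator_def)
    ultimately show ?thesis by simp
  qed
  show "integrable lborel (\<lambda>p. frechet_derivative u (at p) v)"
    using integ[OF contD D0] by (simp add: D_def)
  obtain B where B: "\<And>p. p \<in> cball 0 R \<Longrightarrow> norm (D p) \<le> B" "B \<ge> 0"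
  proof -
    have "bounded (D ` cball 0 R)"
      by (intro compact_imp_bounded compact_continuous_image continuous_on_subset[OF contD]) auto
    then obtain b where b: "\<forall>x\<in>cball 0 R. norm (D x) \<le> b"
      unfolding bounded_iff by blast
    have "norm (D p) \<le> max b 0" if "p \<in> cball 0 R" for p
      using b that by (simp add: le_max_iff_disj)
    then show ?thesis using that[of "max b 0"] by simp
  qed
  have B': "norm (D p) \<le> B" for p using B D0 by (cases "p \<in> cball 0 R") auto
  have line: "((\<lambda>s. u (p + s *\<^sub>R v)) has_derivative (\<lambda>h. h *\<^sub>R D (p + s *\<^sub>R v))) (at s)" for p s
  proof -
    have "((\<lambda>s. p + s *\<^sub>R v) has_derivative (\<lambda>h. h *\<^sub>R v)) (at s)"
      by (auto intro!: derivative_eq_intros)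
    from has_derivative_compose[OF this du]
    show ?thesis
      by (simp add: D_def linear_cmul[OF has_derivative_linear[OF du]])
  qed
  \<comment> \<open>Difference quotients along the steps 1 / (n + 1). All these steps have length at
    most 1, which confines the supports to one fixed ball.\<close>
  define Q where "Q n p = of_nat (Suc n) *\<^sub>R (u (p + inverse (of_nat (Suc n)) *\<^sub>R v) - u p)" for n :: nat and p
  have lim: "(\<lambda>n. Q n p) \<longlonglongrightarrow> D p" for p
  proof -
    have "((\<lambda>h. norm (u (p + h *\<^sub>R v) - u p - h *\<^sub>R D p) / norm h) \<longlongrightarrow> 0) (at 0)"
      using line[of p 0] unfolding has_derivative_at by simp
    then have "((\<lambda>h. norm ((u (p + h *\<^sub>R v) - u p) /\<^sub>R h - D p)) \<longlongrightarrow> 0) (at 0)"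
    proof (rule Lim_transform_eventually)
      show "\<forall>\<^sub>F h in at 0. norm (u (p + h *\<^sub>R v) - u p - h *\<^sub>R D p) / norm h =
          norm ((u (p + h *\<^sub>R v) - u p) /\<^sub>R h - D p)"
        unfolding eventually_at_filter
      proof (rule always_eventually, intro allI impI)
        fix h :: real assume h: "h \<noteq> 0"
        have "(u (p + h *\<^sub>R v) - u p) /\<^sub>R h - D p = (u (p + h *\<^sub>R v) - u p - h *\<^sub>R D p) /\<^sub>R h"
          using h by (simp add: scaleR_diff_right)
        then show "norm (u (p + h *\<^sub>R v) - u p - h *\<^sub>R D p) / norm h =
            norm ((u (p + h *\<^sub>R v) - u p) /\<^sub>R h - D p)"
          by (simp add: divide_inverse mult.commute)
      qed
    qed
    then have "((\<lambda>h. (u (p + h *\<^sub>R v) - u p) /\<^sub>R h) \<longlongrightarrow> D p) (at 0)"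
      by (rule LIM_zero_cancel[OF tendsto_norm_zero_cancel])
    moreover have "filterlim (\<lambda>n. inverse (of_nat (Suc n)) :: real) (at 0) sequentially"
      by (intro filterlim_atI LIMSEQ_inverse_real_of_nat) (simp del: of_nat_Suc)
    ultimately have "(\<lambda>n. (u (p + inverse (of_nat (Suc n)) *\<^sub>R v) - u p) /\<^sub>R inverse (of_nat (Suc n))) \<longlonglongrightarrow> D p"
      by (rule filterlim_compose)
    then show ?thesis by (simp add: Q_def[abs_def])
  qed
  \<comment> \<open>The dominating function: the mean value inequality bounds the quotient by
    \<open>B\<close>, and outside the ball of radius \<open>R + norm v\<close> both the point and
    its translate have left the support of \<open>u\<close>.\<close>
  have bound: "norm (Q n p) \<le> indicator (cball 0 (R + norm v)) p * B" for n p
  proof (cases "p \<in> cball 0 (R + norm v)")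
    case True
    have "norm (u (p + inverse (of_nat (Suc n)) *\<^sub>R v) - u (p + 0 *\<^sub>R v)) \<le> B * norm (inverse (of_nat (Suc n)) - 0 :: real)"
    proof (rule differentiable_bound[OF convex_UNIV])
      show "((\<lambda>s. u (p + s *\<^sub>R v)) has_derivative (\<lambda>h. h *\<^sub>R D (p + s *\<^sub>R v))) (at s within UNIV)" for s
        by (rule line)
      show "onorm (\<lambda>h::real. h *\<^sub>R D (p + s *\<^sub>R v)) \<le> B" for s
        by (rule onorm_le) (simp add: mult.commute[of B] mult_left_mono[OF B'])
    qed auto
    then have "real (Suc n) * norm (u (p + inverse (of_nat (Suc n)) *\<^sub>R v) - u p) \<le> real (Suc n) * (B * inverse (of_nat (Suc n)))"
      by (intro mult_left_mono) auto
    also have "\<dots> = B" by (simp del: of_nat_Suc)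
    finally show ?thesis using True by (simp add: Q_def del: of_nat_Suc)
  next
    case False
    have "norm p \<le> norm (p + inverse (of_nat (Suc n)) *\<^sub>R v) + norm (inverse (of_nat (Suc n)) *\<^sub>R v)"
      using norm_triangle_ineq4[of "p + inverse (of_nat (Suc n)) *\<^sub>R v" "inverse (of_nat (Suc n)) *\<^sub>R v"] by simp
    also have "norm (inverse (of_nat (Suc n)) *\<^sub>R v) \<le> 1 * norm v"
      unfolding norm_scaleR by (intro mult_right_mono) (auto simp: inverse_le_1_iff)
    finally have "p + inverse (of_nat (Suc n)) *\<^sub>R v \<notin> cball 0 R" using False by auto
    moreover have "p \<notin> cball 0 R" using False add_increasing2[OF norm_ge_zero[of v], of "norm p" R] by auto
    ultimately show ?thesis using supp False by (simp add: Q_def del: of_nat_Suc)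
  qed
  have intu: "integrable lborel u" by (rule integ[OF contu supp])
  have shift: "integrable lborel (\<lambda>p. u (p + c))" "(LINT p|lborel. u (p + c)) = (LINT p|lborel. u p)" for c
  proof -
    have m: "u \<in> borel_measurable borel" using contu by (rule borel_measurable_continuous_onI)
    show "integrable lborel (\<lambda>p. u (p + c))"
      using intu m integrable_distr_eq[of "(+) c" lborel borel u] by (simp add: lborel_distr_plus add.commute)
    show "(LINT p|lborel. u (p + c)) = (LINT p|lborel. u p)"
      using m integral_distr[of "(+) c" lborel borel u] by (simp add: lborel_distr_plus add.commute)
  qed
  have Q0: "(LINT p|lborel. Q n p) = 0" for n
    unfolding Q_def using shift intu by simp
  have "(\<lambda>n. LINT p|lborel. Q n p) \<longlonglongrightarrow> (LINT p|lborel. D p)"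
  proof (rule integral_dominated_convergence[where w = "\<lambda>p. indicator (cball 0 (R + norm v)) p * B"])
    show "D \<in> borel_measurable lborel" using borel_measurable_continuous_onI[OF contD] by simp
    show "Q n \<in> borel_measurable lborel" for n
      unfolding Q_def[abs_def]
      by (simp, rule borel_measurable_continuous_onI)
        (intro continuous_intros continuous_on_compose2[OF contu], auto)
    show "integrable lborel (\<lambda>p::'a. indicator (cball 0 (R + norm v)) p * B)"
      using borel_integrable_compact[of "cball 0 (R + norm v) :: 'a set" "\<lambda>_. B"] by simp
  qed (use lim bound in auto)
  then show "(LINT p|lborel. frechet_derivative u (at p) v) = 0"
    using LIMSEQ_unique[OF _ tendsto_const] unfolding Q0 D_def by metis
qed

section \<open>Integration by parts against test functions\<close>

lemma integral_wirt_eq_0: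
  fixes u :: "complex \<Rightarrow> complex"
  assumes "Ck_on 1 u UNIV" "\<And>p. p \<notin> cball 0 R \<Longrightarrow> u p = 0"
  shows "(LINT p|lborel. wirt v u p) = 0"
  unfolding wirt_def using integral_frechet_derivative_eq_0[OF assms] by simp

lemma Ck_on_Un:
  assumes "open U" "open V" "Ck_on k F U" "Ck_on k F V"
  shows "Ck_on k F (U \<union> V)"
  using assms(3,4)
  by (induction k arbitrary: F) (use assms(1,2) in \<open>auto intro: continuous_on_open_Un\<close>)

text \<open>The product of \<open>G\<close> with the conjugate of \<open>k\<close>, extended by 0,
  is C^1 on the whole plane because \<open>W\<close> and the complement of the support of
  \<open>k\<close> are open and cover it. By \<open>G0\<close> its derivative with respect to z is
  the integrand, and such a derivative has integral 0.\<close>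

lemma integral_by_parts_wirt_bar:
  fixes G k :: "complex \<Rightarrow> complex"
  assumes W: "open W" and G: "smooth_on G W" and G0: "\<And>p. p \<in> W \<Longrightarrow> wirt 1 G p = 0"
    and k: "smooth_on k UNIV" and K: "compact (closure {p. k p \<noteq> 0})" "closure {p. k p \<noteq> 0} \<subseteq> W"
  shows "(LINT p:W|lborel. G p * cnj (wirt_bar 1 k p)) = 0"
proof -
  let ?K = "closure {p. k p \<noteq> 0}"
  define u where "u p = (if p \<in> W then G p * cnj (k p) else 0)" for p
  have kz: "k p = 0" if "p \<notin> ?K" for p
    using that closure_subset[of "{p. k p \<noteq> 0}"] by auto
  have sW: "smooth_on (\<lambda>p. G p * cnj (k p)) W"
    by (intro smooth_on_mult smooth_on_cnj W G smooth_on_subset[OF k]) auto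
  have uW: "Ck_on 1 u W"
    by (rule Ck_on_cong[OF W _ smooth_on_imp_Ck_on[OF sW]]) (simp add: u_def)
  have uK: "Ck_on 1 u (- ?K)"
  proof (rule Ck_on_cong[OF _ _ Ck_on_const])
    show "0 = u p" if "p \<in> - ?K" for p using kz[of p] that by (simp add: u_def)
  qed (simp add: open_Compl)
  have "W \<union> - ?K = UNIV" using K by blast
  then have u1: "Ck_on 1 u UNIV"
    using Ck_on_Un[OF W _ uW uK] by (simp add: open_Compl)
  obtain R where R: "\<forall>x\<in>?K. cmod x \<le> R"
    using compact_imp_bounded[OF K(1)] unfolding bounded_iff by blast
  have "(LINT p|lborel. wirt 1 u p) = 0"
  proof (rule integral_wirt_eq_0[OF u1])
    fix p :: complex assume "p \<notin> cball 0 R"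
    then have "p \<notin> ?K" using R by auto
    then show "u p = 0" using kz[of p] by (simp add: u_def)
  qed
  moreover have "wirt 1 u p = indicator W p *\<^sub>R (G p * cnj (wirt_bar 1 k p))" for p
  proof (cases "p \<in> W")
    case True
    have "wirt 1 u p = wirt 1 (\<lambda>p. G p * cnj (k p)) p"
      by (rule wirt_cong_open[OF W True]) (simp add: u_def)
    also have "\<dots> = G p * cnj (wirt_bar 1 k p)"
      using smooth_onD[OF k UNIV_I, of p] smooth_onD[OF smooth_on_cnj[OF open_UNIV k] UNIV_I, of p]
        smooth_onD[OF G True] G0[OF True]
      by (simp add: wirt_mult wirt_cnj)
    finally show ?thesis using True by simp
  next
    case False
    then have "p \<in> - ?K" using K by blast
    then have "wirt 1 u p = wirt 1 (\<lambda>_. 0) p"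
    proof (rule wirt_cong_open(1)[rotated])
      show "u x = 0" if "x \<in> - ?K" for x using kz[of x] that by (simp add: u_def)
    qed (simp add: open_Compl)
    then show ?thesis using False by simp
  qed
  ultimately show ?thesis by (simp add: set_lebesgue_integral_def)
qed

section \<open>Liouville's equation\<close>

lemma has_derivative_slice: "((\<lambda>p. (p, \<tau>)) has_derivative (\<lambda>v. (v, 0))) (at p)"
  by (intro has_derivative_Pair has_derivative_ident has_derivative_const)

lemma smooth_on_slice_map: "smooth_on (\<lambda>p::'a::real_normed_vector. (p, \<tau>::'b::real_normed_vector)) V"
proof (rule smooth_onI)
  have d: "frechet_derivative (\<lambda>p::'a. (p, \<tau>)) (at p) = (\<lambda>v. (v, 0))" for p
    using frechet_derivative_at[OF has_derivative_slice] by metis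
  show "smooth_on (\<lambda>p. frechet_derivative (\<lambda>p::'a. (p, \<tau>)) (at p) v) V" for v
    unfolding d by (rule smooth_on_const)
qed (use has_derivative_slice in \<open>auto simp: differentiable_def\<close>)

lemma cholomorphic_on_slice_map:
  "cholomorphic_on (\<lambda>p::'a::complex_euclidean. (p, \<tau>::'b::complex_euclidean)) V"
  unfolding cholomorphic_on_def
proof
  show "\<exists>D. ((\<lambda>p::'a. (p, \<tau>)) has_derivative D) (at p) \<and> (\<forall>v. D (mul_i v) = mul_i (D v))" for p
    by (rule exI[of _ "\<lambda>v. (v, 0)"]) (simp add: has_derivative_slice)
qed

lemma open_slice: "open U \<Longrightarrow> open {p. (p, \<tau>) \<in> U}"
  using open_vimage[of U "\<lambda>p. (p, \<tau>)"] by (simp add: vimage_def continuous_on_Pair continuous_on_const)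

lemma smooth_on_slice:
  fixes F :: "complex \<times> 'e::euclidean_space \<Rightarrow> 'c::real_normed_vector"
  assumes "open U" "smooth_on F U"
  shows "smooth_on (\<lambda>p. F (p, \<tau>)) {p. (p, \<tau>) \<in> U}"
  by (rule smooth_on_compose[where F = "\<lambda>p. (p, \<tau>)" and G = F, OF open_slice[OF assms(1)] assms(1) _ smooth_on_slice_map assms(2)])
    auto

lemma cholomorphic_on_slice:
  fixes F :: "complex \<times> 'e::complex_euclidean \<Rightarrow> complex"
  assumes "cholomorphic_on F U"
  shows "cholomorphic_on (\<lambda>p. F (p, \<tau>)) {p. (p, \<tau>) \<in> U}"
  by (rule cholomorphic_on_compose[where F = "\<lambda>p. (p, \<tau>)" and G = F, OF cholomorphic_on_slice_map assms]) auto

lemma wirt_slice: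
  fixes F :: "complex \<times> 'e::complex_euclidean \<Rightarrow> complex"
  assumes "F differentiable (at (p, \<tau>))"
  shows "wirt v (\<lambda>p. F (p, \<tau>)) p = wirt (v, 0) F (p, \<tau>)"
    and "wirt_bar v (\<lambda>p. F (p, \<tau>)) p = wirt_bar (v, 0) F (p, \<tau>)"
  using wirt_comp[OF has_derivative_slice _ assms, of v] by simp_all

text \<open>The logarithmic derivative with the denominator cleared; in this form it feeds directly
  into product rules.\<close>

lemma wirt_ln:
  assumes "g differentiable (at q)" "g q > (0::real)"
  shows "wirt_bar v (\<lambda>p. of_real (ln (g p))) q * of_real (g q) = wirt_bar v (\<lambda>p. of_real (g p)) q"
proof -
  note d = frechet_derivative_worksI[OF assms(1)]
  have 1: "((\<lambda>p. complex_of_real (g p)) has_derivative (\<lambda>w. of_real (frechet_derivative g (at q) w))) (at q)"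
    by (rule bounded_linear.has_derivative[OF bounded_linear_of_real d])
  have "((\<lambda>p. ln (g p)) has_derivative (\<lambda>w. frechet_derivative g (at q) w * inverse (g q))) (at q)"
    using d assms(2) by (auto intro!: derivative_eq_intros simp: divide_inverse)
  then have 2: "((\<lambda>p. complex_of_real (ln (g p))) has_derivative
      (\<lambda>w. of_real (frechet_derivative g (at q) w * inverse (g q)))) (at q)"
    by (rule bounded_linear.has_derivative[OF bounded_linear_of_real])
  show ?thesis
    unfolding wirt_eqI(2)[OF 1] wirt_eqI(2)[OF 2] using assms(2) by (simp add: field_simps)
qed

text \<open>Liouville's equation \<open>\<partial>\<^sub>z L = g\<close> makes \<open>g dbar a\<close> antiholomorphic along the fibers: by the
  definition of \<open>a\<close> one has \<open>g dbar a = - dbar \<partial>\<^sub>v L + L \<partial>\<^sub>v L\<close>, and both terms have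
  the same derivative with respect to \<open>z\<close> up to sign.\<close>

lemma liouville_wirt_zero:
  fixes g :: "complex \<times> 'e::complex_euclidean \<Rightarrow> real" and v :: 'e
  defines "L \<equiv> wirt_bar (1, 0) (\<lambda>p. of_real (ln (g p)))"
  defines "a \<equiv> \<lambda>q. - wirt (0, v) L q / of_real (g q)"
  assumes U: "open U" and g: "smooth_on g U" "\<And>q. q \<in> U \<Longrightarrow> g q > 0"
    and curv: "\<And>q. q \<in> U \<Longrightarrow> wirt (1, 0) L q = of_real (g q)" and q: "q \<in> U"
  shows "wirt (1, 0) (\<lambda>q. of_real (g q) * wirt_bar (1, 0) a q) q = 0"
proof -
  define G where "G p = complex_of_real (g p)" for p
  let ?D = "wirt (1, 0)" and ?Db = "wirt_bar (1, 0)" and ?Dv = "wirt (0, v)"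
  have sG: "smooth_on G U" unfolding G_def by (rule smooth_on_of_real[OF U g(1)])
  have sL: "smooth_on L U"
    unfolding L_def by (intro smooth_on_wirt smooth_on_of_real smooth_on_ln U g)
  have sLv: "smooth_on (?Dv L) U" by (rule smooth_on_wirt[OF U sL])
  have a: "a = (\<lambda>q. (- ?Dv L q) * of_real (inverse (g q)))"
    by (simp add: a_def divide_inverse)
  have sa: "smooth_on a U"
    unfolding a by (intro smooth_on_mult smooth_on_minus smooth_on_of_real smooth_on_inverse sLv U g)
  note dG = smooth_onD[OF sG] and dL = smooth_onD[OF sL] and dLv = smooth_onD[OF sLv] and da = smooth_onD[OF sa]
  have DbG: "?Db G p = L p * G p" if "p \<in> U" for p
    using wirt_ln[OF smooth_onD[OF g(1) that] g(2)[OF that]] by (simp add: L_def G_def[abs_def])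
  have Ga: "G p * a p = - ?Dv L p" if "p \<in> U" for p
    using g(2)[OF that] by (simp add: a_def G_def)
  have H: "of_real (g p) * ?Db a p = - ?Db (?Dv L) p + L p * ?Dv L p" if p: "p \<in> U" for p
  proof -
    have "?Db G p * a p + G p * ?Db a p = ?Db (\<lambda>p. G p * a p) p"
      by (rule wirt_mult(2)[OF dG[OF p] da[OF p], symmetric])
    also have "\<dots> = ?Db (\<lambda>p. - ?Dv L p) p" by (rule wirt_cong_open(2)[OF U p Ga])
    also have "\<dots> = - ?Db (?Dv L) p" by (rule wirt_minus(2)[OF dLv[OF p]])
    finally have "G p * ?Db a p = - ?Db (?Dv L) p - L p * (G p * a p)"
      using DbG[OF p] by (simp add: algebra_simps eq_diff_eq)
    then show ?thesis using Ga[OF p] by (simp add: G_def)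
  qed
  have sb: "smooth_on (?Db (?Dv L)) U" by (rule smooth_on_wirt[OF U sLv])
  have DL: "?D (?Dv L) p = ?Dv G p" if p: "p \<in> U" for p
  proof -
    have "?D (?Dv L) p = ?Dv (?D L) p" by (rule wirt_commute(2)[OF U p sL])
    also have "\<dots> = ?Dv G p" by (rule wirt_cong_open(1)[OF U p]) (simp add: curv G_def)
    finally show ?thesis .
  qed
  \<comment> \<open>Commuting derivatives brings \<partial>_z next to \<open>L\<close>, where the
    curvature equation replaces it by \<open>G\<close>. The remaining dbar of \<open>G\<close> is
    \<open>L * G\<close>, so the third order expression reduces to first derivatives of
    \<open>L\<close> and \<open>G\<close>.\<close>
  have "?D (?Db (?Dv L)) q = ?Db (?D (?Dv L)) q" by (rule wirt_commute(1)[OF U q sLv])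
  also have "\<dots> = ?Db (?Dv G) q" by (rule wirt_cong_open(2)[OF U q DL])
  also have "\<dots> = ?Dv (?Db G) q" by (rule wirt_commute(1)[OF U q sG, symmetric])
  also have "\<dots> = ?Dv (\<lambda>p. L p * G p) q" by (rule wirt_cong_open(1)[OF U q DbG])
  also have "\<dots> = ?Dv L q * G q + L q * ?Dv G q" by (rule wirt_mult(1)[OF dL[OF q] dG[OF q]])
  finally have DDb: "?D (?Db (?Dv L)) q = ?Dv L q * G q + L q * ?Dv G q" .
  have "?D (\<lambda>p. of_real (g p) * ?Db a p) q = ?D (\<lambda>p. - ?Db (?Dv L) p + L p * ?Dv L p) q"
    by (rule wirt_cong_open(1)[OF U q H])
  also have "\<dots> = ?D (\<lambda>p. - ?Db (?Dv L) p) q + ?D (\<lambda>p. L p * ?Dv L p) q"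
    by (rule wirt_add(1)[OF smooth_onD[OF smooth_on_minus[OF U sb] q] smooth_onD[OF smooth_on_mult[OF U sL sLv] q]])
  \<comment> \<open>By the product rule and the curvature equation the second summand is
    \<open>G * ?Dv L + L * ?Dv G\<close>, which is the value in \<open>DDb\<close>; the first
    summand is its negative.\<close>
  also have "\<dots> = 0"
    using wirt_minus(1)[OF smooth_onD[OF sb q]] wirt_mult(1)[OF dL[OF q] dLv[OF q]] DDb DL[OF q] curv[OF q]
    by (simp add: G_def)
  finally show ?thesis .
qed

section \<open>Charts\<close>

lemma is_chart_subset: "is_chart T c \<Longrightarrow> fst c \<subseteq> topspace T"
  by (simp add: is_chart_def openin_subset)

lemma is_chart_inj:
  assumes "is_chart T c"
  shows "inj_on (snd c) (fst c)"
proof -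
  have "inj_on (snd c) (topspace (subtopology T (fst c)))"
    using assms by (intro homeomorphic_imp_injective_map) (auto simp: is_chart_def)
  then show ?thesis using is_chart_subset[OF assms] by (simp add: inf.absorb2)
qed

lemma chart_inv_left: "is_chart T c \<Longrightarrow> x \<in> fst c \<Longrightarrow> chart_inv c (snd c x) = x"
  by (simp add: chart_inv_def is_chart_inj)

lemma chart_inv_right:
  "p \<in> snd c ` fst c \<Longrightarrow> snd c (chart_inv c p) = p" "p \<in> snd c ` fst c \<Longrightarrow> chart_inv c p \<in> fst c"
  by (simp_all add: chart_inv_def f_inv_into_f inv_into_into)

lemma chart_open_image:
  assumes "is_chart T c" "openin T W"
  shows "open (snd c ` (W \<inter> fst c))"
proof -
  have c: "openin T (fst c)" "open (snd c ` fst c)"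
    "homeomorphic_map (subtopology T (fst c)) (top_of_set (snd c ` fst c)) (snd c)"
    using assms by (simp_all add: is_chart_def)
  have "openin (subtopology T (fst c)) (W \<inter> fst c)"
    using assms(2) by (auto simp: openin_subtopology)
  then have "openin (top_of_set (snd c ` fst c)) (snd c ` (W \<inter> fst c))"
    using homeomorphic_imp_open_map[OF c(3)] by (auto simp: open_map_def)
  then show ?thesis using c(2) by (meson openin_open_trans)
qed

lemma atlas_is_chart: "complex_manifold M \<Longrightarrow> c \<in> atlas M \<Longrightarrow> is_chart (mtop M) c"
  by (simp add: complex_manifold_def)

lemma atlas_subset_charts: "complex_manifold M \<Longrightarrow> atlas M \<subseteq> charts M"
  by (auto simp: complex_manifold_def charts_def)

lemma atlas_cover:
  assumes "complex_manifold M" "x \<in> points M"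
  obtains c where "c \<in> atlas M" "x \<in> fst c"
  using assms unfolding complex_manifold_def by blast

lemma charts_is_chart: "c \<in> charts M \<Longrightarrow> is_chart (mtop M) c"
  by (simp add: charts_def)

text \<open>Members of \<open>charts M\<close> are only known to be compatible with the atlas. Near
  each point the coordinate change is therefore factored through an atlas chart around that
  point.\<close>

lemma charts_compatible:
  assumes M: "complex_manifold M" and c: "c \<in> charts M" "c' \<in> charts M"
  shows "cholomorphic_on (snd c' \<circ> chart_inv c) (snd c ` (fst c \<inter> fst c'))"
proof (rule cholomorphic_on_local)
  note ch = c[THEN charts_is_chart]
  fix p assume "p \<in> snd c ` (fst c \<inter> fst c')"
  then obtain x where x: "x \<in> fst c" "x \<in> fst c'" "p = snd c x" by blast
  then have "x \<in> points M" using is_chart_subset[OF ch(1)] by blast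
  with M obtain c0 where c0: "c0 \<in> atlas M" "x \<in> fst c0" by (rule atlas_cover)
  note ch0 = atlas_is_chart[OF M c0(1)]
  let ?V = "snd c ` (fst c \<inter> fst c' \<inter> fst c0)"
  have op: "open ?V"
    using chart_open_image[OF ch(1), of "fst c' \<inter> fst c0"] ch ch0
    by (simp add: is_chart_def openin_Int Int_ac)
  have 1: "cholomorphic_on (snd c0 \<circ> chart_inv c) ?V"
    by (rule cholomorphic_on_subset[of _ "snd c ` (fst c \<inter> fst c0)"])
      (use c(1) c0 in \<open>auto simp: charts_def compatible_def\<close>)
  have 2: "cholomorphic_on (snd c' \<circ> chart_inv c0) (snd c0 ` (fst c0 \<inter> fst c'))"
    using c(2) c0 by (auto simp: charts_def compatible_def Int_commute)
  have im: "(snd c0 \<circ> chart_inv c) ` ?V \<subseteq> snd c0 ` (fst c0 \<inter> fst c')"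
    using chart_inv_left[OF ch(1)] by auto
  have "cholomorphic_on (snd c' \<circ> chart_inv c) ?V"
    by (rule cholomorphic_on_cong[OF op _ cholomorphic_on_compose[OF 1 2 im]])
      (auto simp: chart_inv_left[OF ch(1)] chart_inv_left[OF ch0])
  moreover have "p \<in> ?V" using x c0 by blast
  ultimately show "\<exists>V. p \<in> V \<and> cholomorphic_on (snd c' \<circ> chart_inv c) V"
    by (intro exI[of _ ?V] conjI)
qed

lemma holomorphic_map_preimage_open:
  assumes "holomorphic_map M N F" "openin (mtop N) V"
  shows "openin (mtop M) (points M \<inter> F -` V)"
proof -
  have "points M \<inter> F -` V = {x \<in> points M. F x \<in> V}" by auto
  then show ?thesis using assms openin_continuous_map_preimage[of "mtop M" "mtop N" F V] by (simp add: holomorphic_map_def)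
qed

lemma open_chart_preimage:
  assumes M: "complex_manifold M" and N: "complex_manifold N" and F: "holomorphic_map M N F"
    and c: "c \<in> charts M" and d: "d \<in> atlas N" and W: "openin (mtop M) W"
  shows "open (snd c ` (W \<inter> fst c \<inter> F -` fst d))"
proof -
  have d': "openin (mtop N) (fst d)" using atlas_is_chart[OF N d] by (simp add: is_chart_def)
  have "W \<inter> fst c \<inter> F -` fst d = (W \<inter> (points M \<inter> F -` fst d)) \<inter> fst c"
    using is_chart_subset[OF charts_is_chart[OF c]] by blast
  then show ?thesis
    using chart_open_image[OF charts_is_chart[OF c] openin_Int[OF W holomorphic_map_preimage_open[OF F d']]]
    by simp
qed

text \<open>Holomorphic maps are defined by means of the atlas, whereas adapted charts lie in
  \<open>charts\<close>; again the local expression is factored through an atlas chart around each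
  point.\<close>

lemma holomorphic_map_charts:
  assumes M: "complex_manifold M" and N: "complex_manifold N" and F: "holomorphic_map M N F"
    and c: "c \<in> charts M" and d: "d \<in> atlas N"
  shows "cholomorphic_on (snd d \<circ> F \<circ> chart_inv c) (snd c ` (fst c \<inter> F -` fst d))"
proof (rule cholomorphic_on_local)
  note ch = c[THEN charts_is_chart]
  fix p assume "p \<in> snd c ` (fst c \<inter> F -` fst d)"
  then obtain x where x: "x \<in> fst c" "F x \<in> fst d" "p = snd c x" by blast
  then have "x \<in> points M" using is_chart_subset[OF ch] by blast
  with M obtain c0 where c0: "c0 \<in> atlas M" "x \<in> fst c0" by (rule atlas_cover)
  note ch0 = atlas_is_chart[OF M c0(1)]
  have c0': "openin (mtop M) (fst c0)" using ch0 by (simp add: is_chart_def)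
  let ?V = "snd c ` (fst c0 \<inter> fst c \<inter> F -` fst d)"
  have op: "open ?V" by (rule open_chart_preimage[OF M N F c d c0'])
  have 1: "cholomorphic_on (snd c0 \<circ> chart_inv c) ?V"
    by (rule cholomorphic_on_subset[of _ "snd c ` (fst c \<inter> fst c0)"])
      (use c(1) c0 in \<open>auto simp: charts_def compatible_def\<close>)
  have 2: "cholomorphic_on (snd d \<circ> F \<circ> chart_inv c0) (snd c0 ` (fst c0 \<inter> F -` fst d))"
    using F c0 d by (simp add: holomorphic_map_def)
  have im: "(snd c0 \<circ> chart_inv c) ` ?V \<subseteq> snd c0 ` (fst c0 \<inter> F -` fst d)"
    using chart_inv_left[OF ch(1)] by auto
  have "cholomorphic_on (snd d \<circ> F \<circ> chart_inv c) ?V"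
    by (rule cholomorphic_on_cong[OF op _ cholomorphic_on_compose[OF 1 2 im]])
      (auto simp: chart_inv_left[OF ch(1)] chart_inv_left[OF ch0])
  moreover have "p \<in> ?V" using x c0 by blast
  ultimately show "\<exists>V. p \<in> V \<and> cholomorphic_on (snd d \<circ> F \<circ> chart_inv c) V"
    by (intro exI[of _ ?V] conjI)
qed

section \<open>The cocycle of transition functions\<close>

lemma transition_wirt:
  assumes M: "complex_manifold M" and c: "c \<in> atlas M" "c' \<in> atlas M" "x \<in> fst c" "x \<in> fst c'"
  shows "transition c c' x = wirt 1 (snd c' \<circ> chart_inv c) (snd c x)"
    and "((snd c' \<circ> chart_inv c) has_field_derivative transition c c' x) (at (snd c x))"
proof -
  have h: "cholomorphic_on (snd c' \<circ> chart_inv c) (snd c ` (fst c \<inter> fst c'))"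
    using charts_compatible[OF M] atlas_subset_charts[OF M] c by blast
  show t: "transition c c' x = wirt 1 (snd c' \<circ> chart_inv c) (snd c x)"
    unfolding transition_def by (rule cholomorphic_on_imp_deriv[OF h]) (use c in blast)
  show "((snd c' \<circ> chart_inv c) has_field_derivative transition c c' x) (at (snd c x))"
    unfolding t by (rule cholomorphic_on_imp_has_field_derivative[OF h]) (use c in blast)
qed

lemma transition_refl:
  assumes M: "complex_manifold M" and c: "c \<in> atlas M" "x \<in> fst c"
  shows "transition c c x = 1"
proof -
  note ch = atlas_is_chart[OF M c(1)]
  have "((\<lambda>p. p) has_field_derivative transition c c x) (at (snd c x))"
  proof (rule has_field_derivative_transform_within_open[OF transition_wirt(2)[OF M c(1) c(1) c(2) c(2)]])
    show "open (snd c ` fst c)" using ch by (simp add: is_chart_def)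
  qed (use c chart_inv_left[OF ch] in auto)
  then show ?thesis using DERIV_ident DERIV_unique by blast
qed

lemma transition_cocycle:
  assumes M: "complex_manifold M"
    and c: "c \<in> atlas M" "c' \<in> atlas M" "c'' \<in> atlas M" "x \<in> fst c" "x \<in> fst c'" "x \<in> fst c''"
  shows "transition c' c'' x * transition c c' x = transition c c'' x"
proof -
  note ch = c(1-3)[THEN atlas_is_chart[OF M]]
  let ?V = "snd c ` (fst c' \<inter> fst c)"
  have op: "open ?V" by (rule chart_open_image[OF ch(1)]) (use ch(2) in \<open>simp add: is_chart_def\<close>)
  have x: "(snd c' \<circ> chart_inv c) (snd c x) = snd c' x" using chart_inv_left[OF ch(1)] c by simp
  have "((\<lambda>p. (snd c'' \<circ> chart_inv c') ((snd c' \<circ> chart_inv c) p)) has_field_derivative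
      transition c' c'' x * transition c c' x) (at (snd c x))"
    using transition_wirt(2)[OF M c(2,3,5,6)] transition_wirt(2)[OF M c(1,2,4,5)] unfolding x[symmetric]
    by (rule DERIV_chain2)
  then have "((snd c'' \<circ> chart_inv c) has_field_derivative transition c' c'' x * transition c c' x) (at (snd c x))"
    by (rule has_field_derivative_transform_within_open[OF _ op])
      (use c in \<open>auto simp: chart_inv_left[OF ch(1)] chart_inv_left[OF ch(2)]\<close>)
  then show ?thesis using transition_wirt(2)[OF M c(1,3,4,6)] DERIV_unique by blast
qed

lemma transition_inverse:
  assumes "complex_manifold M" "c \<in> atlas M" "c' \<in> atlas M" "x \<in> fst c" "x \<in> fst c'"
  shows "transition c' c x * transition c c' x = 1"
  using transition_cocycle[OF assms(1-3,2,4,5,4)] transition_refl[OF assms(1,2,4)] by simp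

section \<open>Holomorphic maps of Riemann surfaces\<close>

text \<open>The value at \<open>i\<close> satisfies the description since all members agree, and it
  is the only one because \<open>I\<close> is inhabited.\<close>

lemma common_value_eq:
  assumes "i \<in> I" "\<And>j. j \<in> I \<Longrightarrow> F j = F i"
  shows "common_value I F = F i"
  unfolding common_value_def
proof (rule the_equality)
  show "\<forall>j\<in>I. F i = F j" using assms(2)[symmetric] by blast
  show "t = F i" if "\<forall>j\<in>I. t = F j" for t using that assms(1) by blast
qed

locale riemann_surface_map =
  fixes R :: "('p, complex) manifold" and Y :: "('y, complex) manifold" and b :: "'p \<Rightarrow> 'y"
  assumes R: "complex_manifold R" and Y: "complex_manifold Y" and b: "holomorphic_map R Y b"
begin

lemma chR: "c \<in> atlas R \<Longrightarrow> is_chart (mtop R) c" and chY: "d \<in> atlas Y \<Longrightarrow> is_chart (mtop Y) d"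
  using R Y by (auto intro: atlas_is_chart)

lemma atlas_charts: "c \<in> atlas R \<Longrightarrow> c \<in> charts R" "d \<in> atlas Y \<Longrightarrow> d \<in> charts Y"
  using atlas_subset_charts R Y by auto

lemma open_chart: "c \<in> atlas R \<Longrightarrow> openin (mtop R) (fst c)"
  using chR by (simp add: is_chart_def)

lemma open_section_domain:
  "c \<in> atlas R \<Longrightarrow> d \<in> atlas Y \<Longrightarrow> openin (mtop R) W \<Longrightarrow> open (snd c ` (W \<inter> fst c \<inter> b -` fst d))"
  by (rule open_chart_preimage[OF R Y b]) (auto simp: atlas_charts)

lemma map_cholomorphic:
  "c \<in> atlas R \<Longrightarrow> d \<in> atlas Y \<Longrightarrow> cholomorphic_on (snd d \<circ> b \<circ> chart_inv c) (snd c ` (fst c \<inter> b -` fst d))"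
  by (rule holomorphic_map_charts[OF R Y b]) (auto simp: atlas_charts)

section \<open>Push-forward of tangent vectors and its independence of charts\<close>

lemma push_wirt:
  assumes "c \<in> atlas R" "d \<in> atlas Y" "x \<in> fst c" "b x \<in> fst d"
  shows "push b c d x t = wirt 1 (snd d \<circ> b \<circ> chart_inv c) (snd c x) * t"
  unfolding push_def using cholomorphic_on_imp_deriv[OF map_cholomorphic[OF assms(1,2)]] assms by simp

lemma push_deriv:
  assumes "c \<in> atlas R" "d \<in> atlas Y" "x \<in> fst c" "b x \<in> fst d"
  shows "((snd d \<circ> b \<circ> chart_inv c) has_field_derivative push b c d x 1) (at (snd c x))"
  using cholomorphic_on_imp_has_field_derivative[OF map_cholomorphic[OF assms(1,2)]] push_wirt[OF assms] assms
  by simp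

lemma push_linear: "push b c d x t = push b c d x 1 * t"
  by (simp add: push_def)

text \<open>Two expressions for the derivative of the same local map, one of them factored through
  \<open>c'\<close>, must agree. This is the independence of the source chart that
  \<open>common_value\<close> in \<open>push_vector_field\<close> calls for.\<close>

lemma push_transition:
  assumes c: "c \<in> atlas R" "c' \<in> atlas R" "d \<in> atlas Y" "x \<in> fst c" "x \<in> fst c'" "b x \<in> fst d"
  shows "push b c' d x (transition c c' x * t) = push b c d x t"
proof -
  note ch = chR[OF c(1)] chR[OF c(2)]
  let ?V = "snd c ` (fst c' \<inter> fst c)"
  have op: "open ?V" by (rule chart_open_image[OF ch(1) open_chart[OF c(2)]])
  have x: "(snd c' \<circ> chart_inv c) (snd c x) = snd c' x" using chart_inv_left[OF ch(1)] c by simp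
  have "((\<lambda>p. (snd d \<circ> b \<circ> chart_inv c') ((snd c' \<circ> chart_inv c) p)) has_field_derivative
      push b c' d x 1 * transition c c' x) (at (snd c x))"
    using push_deriv[OF c(2,3,5,6)] transition_wirt(2)[OF R c(1,2,4,5)] unfolding x[symmetric]
    by (rule DERIV_chain2)
  then have "((snd d \<circ> b \<circ> chart_inv c) has_field_derivative push b c' d x 1 * transition c c' x) (at (snd c x))"
    by (rule has_field_derivative_transform_within_open[OF _ op])
      (use c in \<open>auto simp: chart_inv_left[OF ch(1)] chart_inv_left[OF ch(2)]\<close>)
  then have "push b c d x 1 = push b c' d x 1 * transition c c' x"
    using push_deriv[OF c(1,3,4,6)] DERIV_unique by blast
  then show ?thesis using push_linear by (metis mult.assoc)
qed

lemma push_target_transition: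
  assumes c: "c \<in> atlas R" "d \<in> atlas Y" "d' \<in> atlas Y" "x \<in> fst c" "b x \<in> fst d" "b x \<in> fst d'"
  shows "push b c d' x t = transition d d' (b x) * push b c d x t"
proof -
  note ch = chR[OF c(1)] chY[OF c(2)]
  let ?V = "snd c ` (points R \<inter> fst c \<inter> b -` fst d)"
  have op: "open ?V" by (rule open_section_domain[OF c(1,2)]) simp
  have xR: "x \<in> points R" using is_chart_subset[OF ch(1)] c by blast
  have x: "(snd d \<circ> b \<circ> chart_inv c) (snd c x) = snd d (b x)" using chart_inv_left[OF ch(1)] c by simp
  have "((\<lambda>p. (snd d' \<circ> chart_inv d) ((snd d \<circ> b \<circ> chart_inv c) p)) has_field_derivative
      transition d d' (b x) * push b c d x 1) (at (snd c x))"
    using transition_wirt(2)[OF Y c(2,3,5,6)] push_deriv[OF c(1,2,4,5)] unfolding x[symmetric]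
    by (rule DERIV_chain2)
  then have "((snd d' \<circ> b \<circ> chart_inv c) has_field_derivative transition d d' (b x) * push b c d x 1) (at (snd c x))"
    by (rule has_field_derivative_transform_within_open[OF _ op])
      (use c xR in \<open>auto simp: chart_inv_left[OF ch(1)] chart_inv_left[OF ch(2)]\<close>)
  then have "push b c d' x 1 = transition d d' (b x) * push b c d x 1"
    using push_deriv[OF c(1,3,4,6)] DERIV_unique by blast
  then show ?thesis using push_linear by (metis mult.assoc)
qed

text \<open>The clause shared by smooth and holomorphic vector fields. It alone makes the
  push-forward well defined, so the algebra of push-forwards can be done once for both
  kinds.\<close>

definition vf_law :: "'p set \<Rightarrow> (('p, complex) chart \<Rightarrow> 'p \<Rightarrow> complex) \<Rightarrow> bool" where
  "vf_law W \<eta> \<longleftrightarrow>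
     (\<forall>c\<in>atlas R. \<forall>c'\<in>atlas R. \<forall>x\<in>W \<inter> fst c \<inter> fst c'. \<eta> c' x = transition c c' x * \<eta> c x)"

lemma vf_lawI:
  "(\<And>c c' x. c \<in> atlas R \<Longrightarrow> c' \<in> atlas R \<Longrightarrow> x \<in> W \<Longrightarrow> x \<in> fst c \<Longrightarrow> x \<in> fst c' \<Longrightarrow>
     \<eta> c' x = transition c c' x * \<eta> c x) \<Longrightarrow> vf_law W \<eta>"
  unfolding vf_law_def by blast

lemma vf_lawD:
  "vf_law W \<eta> \<Longrightarrow> c \<in> atlas R \<Longrightarrow> c' \<in> atlas R \<Longrightarrow> x \<in> W \<Longrightarrow> x \<in> fst c \<Longrightarrow> x \<in> fst c' \<Longrightarrow>
     \<eta> c' x = transition c c' x * \<eta> c x"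
  unfolding vf_law_def by blast

lemma vf_law_diff:
  assumes "vf_law W \<eta>" "vf_law W' \<eta>'"
  shows "vf_law (W \<inter> W') (\<lambda>c x. \<eta> c x - \<eta>' c x)"
proof (rule vf_lawI)
  fix c c' x
  assume "c \<in> atlas R" "c' \<in> atlas R" "x \<in> W \<inter> W'" "x \<in> fst c" "x \<in> fst c'"
  then show "\<eta> c' x - \<eta>' c' x = transition c c' x * (\<eta> c x - \<eta>' c x)"
    using vf_lawD[OF assms(1), of c c' x] vf_lawD[OF assms(2), of c c' x] by (simp add: right_diff_distrib)
qed

lemma vf_law_zero: "vf_law W (\<lambda>c x. 0)"
  by (rule vf_lawI) simp

definition pb_law :: "'p set \<Rightarrow> (('y, complex) chart \<Rightarrow> 'p \<Rightarrow> complex) \<Rightarrow> bool" where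
  "pb_law W \<sigma> \<longleftrightarrow>
     (\<forall>d\<in>atlas Y. \<forall>d'\<in>atlas Y. \<forall>x\<in>W \<inter> b -` (fst d \<inter> fst d'). \<sigma> d' x = transition d d' (b x) * \<sigma> d x)"

lemma pb_lawI:
  "(\<And>d d' x. d \<in> atlas Y \<Longrightarrow> d' \<in> atlas Y \<Longrightarrow> x \<in> W \<Longrightarrow> b x \<in> fst d \<Longrightarrow> b x \<in> fst d' \<Longrightarrow>
     \<sigma> d' x = transition d d' (b x) * \<sigma> d x) \<Longrightarrow> pb_law W \<sigma>"
  unfolding pb_law_def by blast

lemma pb_lawD:
  "pb_law W \<sigma> \<Longrightarrow> d \<in> atlas Y \<Longrightarrow> d' \<in> atlas Y \<Longrightarrow> x \<in> W \<Longrightarrow> b x \<in> fst d \<Longrightarrow> b x \<in> fst d' \<Longrightarrow>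
     \<sigma> d' x = transition d d' (b x) * \<sigma> d x"
  unfolding pb_law_def by blast

lemma holo_pb_section_iff:
  "holo_pb_section R Y b W \<sigma> \<longleftrightarrow> pb_law W \<sigma> \<and>
     (\<forall>c\<in>atlas R. \<forall>d\<in>atlas Y. (\<sigma> d \<circ> chart_inv c) holomorphic_on (snd c ` (W \<inter> fst c \<inter> b -` fst d)))"
  by (simp add: holo_pb_section_def pb_law_def)

lemma smooth_pb_section_iff:
  "smooth_pb_section R Y b W \<sigma> \<longleftrightarrow> pb_law W \<sigma> \<and>
     (\<forall>c\<in>atlas R. \<forall>d\<in>atlas Y. smooth_on (\<sigma> d \<circ> chart_inv c) (snd c ` (W \<inter> fst c \<inter> b -` fst d)))"
  by (simp add: smooth_pb_section_def pb_law_def)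

lemma push_vector_field_eq:
  assumes "vf_law W \<eta>" "x \<in> W" "c \<in> atlas R" "x \<in> fst c" "d \<in> atlas Y" "b x \<in> fst d"
  shows "push_vector_field R b \<eta> d x = push b c d x (\<eta> c x)"
  unfolding push_vector_field_def
proof (rule common_value_eq)
  show "push b c' d x (\<eta> c' x) = push b c d x (\<eta> c x)" if "c' \<in> {c \<in> atlas R. x \<in> fst c}" for c'
  proof -
    have "\<eta> c' x = transition c c' x * \<eta> c x" using vf_lawD[OF assms(1)] assms that by blast
    then show ?thesis using push_transition[of c c' d x "\<eta> c x"] assms that by simp
  qed
qed (use assms in simp)

lemma push_vector_field_diff:
  assumes "vf_law W \<eta>" "vf_law W' \<eta>'" "x \<in> W" "x \<in> W'" "x \<in> points R" "d \<in> atlas Y" "b x \<in> fst d"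
  shows "push_vector_field R b (\<lambda>c x. \<eta> c x - \<eta>' c x) d x
    = push_vector_field R b \<eta> d x - push_vector_field R b \<eta>' d x"
proof -
  obtain c where c: "c \<in> atlas R" "x \<in> fst c" using R assms(5) by (rule atlas_cover)
  show ?thesis
    using push_vector_field_eq[OF vf_law_diff[OF assms(1,2)] _ c assms(6,7)]
      push_vector_field_eq[OF assms(1) _ c assms(6,7)] push_vector_field_eq[OF assms(2) _ c assms(6,7)] assms(3,4)
    by (simp add: push_def right_diff_distrib)
qed

lemma push_vector_field_zero:
  assumes "x \<in> points R" "d \<in> atlas Y" "b x \<in> fst d"
  shows "push_vector_field R b (\<lambda>c x. 0) d x = 0"
proof -
  obtain c where c: "c \<in> atlas R" "x \<in> fst c" using R assms(1) by (rule atlas_cover)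
  show ?thesis
    using push_vector_field_eq[OF vf_law_zero UNIV_I c assms(2,3)] by (simp add: push_def)
qed

lemma holo_vector_field_iff:
  "holo_vector_field R W \<eta> \<longleftrightarrow>
     vf_law W \<eta> \<and> (\<forall>c\<in>atlas R. (\<eta> c \<circ> chart_inv c) holomorphic_on (snd c ` (W \<inter> fst c)))"
  by (simp add: holo_vector_field_def vf_law_def)

lemma smooth_vector_field_iff:
  "smooth_vector_field R W \<eta> \<longleftrightarrow>
     vf_law W \<eta> \<and> (\<forall>c\<in>atlas R. smooth_on (\<eta> c \<circ> chart_inv c) (snd c ` (W \<inter> fst c)))"
  by (simp add: smooth_vector_field_def vf_law_def)

lemma open_vf_domain: "c \<in> atlas R \<Longrightarrow> openin (mtop R) W \<Longrightarrow> open (snd c ` (W \<inter> fst c))"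
  by (rule chart_open_image[OF chR])

text \<open>In one complex dimension every direction is a complex multiple of 1, and
  \<open>wirt_bar\<close> is antilinear in the direction; hence the single equation for the
  direction 1 is the full Cauchy-Riemann condition.\<close>

lemma smooth_dbar_zero_imp_holo:
  assumes W: "openin (mtop R) W" and \<eta>: "smooth_vector_field R W \<eta>"
    and 0: "dbar_vector_field R W \<eta> (\<lambda>c x. 0)"
  shows "holo_vector_field R W \<eta>"
  unfolding holo_vector_field_iff
proof (intro conjI ballI)
  show "vf_law W \<eta>" using \<eta> by (simp add: smooth_vector_field_iff)
  fix c assume c: "c \<in> atlas R"
  let ?V = "snd c ` (W \<inter> fst c)"
  have "cholomorphic_on (\<eta> c \<circ> chart_inv c) ?V"
  proof (rule cholomorphic_onI_wirt_bar)
    fix p v assume p: "p \<in> ?V"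
    show d: "(\<eta> c \<circ> chart_inv c) differentiable (at p)"
      using \<eta> c p smooth_onD by (fastforce simp: smooth_vector_field_iff)
    have "wirt_bar 1 (\<eta> c \<circ> chart_inv c) p = 0"
      using 0 c p by (auto simp: dbar_vector_field_def)
    then show "wirt_bar v (\<eta> c \<circ> chart_inv c) p = 0"
      using wirt_cmul(2)[OF d, of v 1] by simp
  qed
  then show "(\<eta> c \<circ> chart_inv c) holomorphic_on ?V"
    using cholomorphic_on_iff_holomorphic_on[OF open_vf_domain[OF c W]] by blast
qed

section \<open>Holomorphic sections and stalks of the normal sheaf\<close>

lemma holo_pb_section_push:
  assumes W: "openin (mtop R) W" and \<eta>: "holo_vector_field R W \<eta>"
  shows "holo_pb_section R Y b W (push_vector_field R b \<eta>)"
  unfolding holo_pb_section_iff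
proof (intro conjI ballI pb_lawI)
  have law: "vf_law W \<eta>" using \<eta> by (simp add: holo_vector_field_iff)
  have sub: "W \<subseteq> points R" by (rule openin_subset[OF W])
  show "push_vector_field R b \<eta> d' x = transition d d' (b x) * push_vector_field R b \<eta> d x"
    if d: "d \<in> atlas Y" "d' \<in> atlas Y" and x: "x \<in> W" "b x \<in> fst d" "b x \<in> fst d'" for d d' x
  proof -
    have "x \<in> points R" using sub x by blast
    with R obtain c where c: "c \<in> atlas R" "x \<in> fst c" by (rule atlas_cover)
    show ?thesis
      using push_vector_field_eq[OF law x(1) c d(1) x(2)] push_vector_field_eq[OF law x(1) c d(2) x(3)]
        push_target_transition[OF c(1) d c(2) x(2,3)] by simp
  qed
  fix c d assume c: "c \<in> atlas R" and d: "d \<in> atlas Y"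
  let ?V = "snd c ` (W \<inter> fst c \<inter> b -` fst d)"
  have op: "open ?V" by (rule open_section_domain[OF c d W])
  have 1: "cholomorphic_on (wirt 1 (snd d \<circ> b \<circ> chart_inv c)) ?V"
    by (rule cholomorphic_on_wirt_cholomorphic[OF cholomorphic_on_subset[OF map_cholomorphic[OF c d]] op]) blast
  have "(\<eta> c \<circ> chart_inv c) holomorphic_on (snd c ` (W \<inter> fst c))"
    using \<eta> c by (simp add: holo_vector_field_iff)
  then have "(\<eta> c \<circ> chart_inv c) holomorphic_on ?V" by (rule holomorphic_on_subset) blast
  then have 2: "cholomorphic_on (\<eta> c \<circ> chart_inv c) ?V"
    using cholomorphic_on_iff_holomorphic_on[OF op] by blast
  have "cholomorphic_on (push_vector_field R b \<eta> d \<circ> chart_inv c) ?V"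
  proof (rule cholomorphic_on_cong[OF op _ cholomorphic_on_mult[OF 1 2]])
    fix p assume "p \<in> ?V"
    then obtain x where x: "x \<in> W" "x \<in> fst c" "b x \<in> fst d" "p = snd c x" by blast
    then show "wirt 1 (snd d \<circ> b \<circ> chart_inv c) p * (\<eta> c \<circ> chart_inv c) p = (push_vector_field R b \<eta> d \<circ> chart_inv c) p"
      using push_vector_field_eq[OF law x(1) c x(2) d x(3)] push_wirt[OF c d x(2,3)] chart_inv_left[OF chR[OF c] x(2)]
      by simp
  qed
  then show "(push_vector_field R b \<eta> d \<circ> chart_inv c) holomorphic_on ?V"
    using cholomorphic_on_iff_holomorphic_on[OF op] by blast
qed

lemma holo_pb_section_add:
  assumes "holo_pb_section R Y b W \<sigma>" "holo_pb_section R Y b W \<sigma>'"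
  shows "holo_pb_section R Y b W (\<lambda>d x. \<sigma> d x + \<sigma>' d x)"
proof -
  have "((\<lambda>x. \<sigma> d x + \<sigma>' d x) \<circ> chart_inv c) holomorphic_on snd c ` (W \<inter> fst c \<inter> b -` fst d)"
    if "c \<in> atlas R" "d \<in> atlas Y" for c d
    using holomorphic_on_add[of "\<sigma> d \<circ> chart_inv c" _ "\<sigma>' d \<circ> chart_inv c"] assms that
    by (simp add: holo_pb_section_iff o_def)
  moreover have "pb_law W (\<lambda>d x. \<sigma> d x + \<sigma>' d x)"
  proof (rule pb_lawI)
    fix d d' x
    assume "d \<in> atlas Y" "d' \<in> atlas Y" "x \<in> W" "b x \<in> fst d" "b x \<in> fst d'"
    then show "\<sigma> d' x + \<sigma>' d' x = transition d d' (b x) * (\<sigma> d x + \<sigma>' d x)"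
      using pb_lawD[of W \<sigma> d d' x] pb_lawD[of W \<sigma>' d d' x] assms
      by (simp add: holo_pb_section_iff distrib_left)
  qed
  ultimately show ?thesis by (simp add: holo_pb_section_iff)
qed

lemma holo_pb_section_cong:
  assumes W: "openin (mtop R) W" and \<sigma>: "holo_pb_section R Y b W \<sigma>"
    and eq: "\<And>d x. d \<in> atlas Y \<Longrightarrow> x \<in> W \<Longrightarrow> b x \<in> fst d \<Longrightarrow> \<sigma>' d x = \<sigma> d x"
  shows "holo_pb_section R Y b W \<sigma>'"
  unfolding holo_pb_section_iff
proof (intro conjI ballI pb_lawI)
  show "\<sigma>' d' x = transition d d' (b x) * \<sigma>' d x"
    if "d \<in> atlas Y" "d' \<in> atlas Y" "x \<in> W" "b x \<in> fst d" "b x \<in> fst d'" for d d' x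
    using pb_lawD[of W \<sigma> d d' x] that \<sigma> eq[of d x] eq[of d' x] by (simp add: holo_pb_section_iff)
  fix c d assume c: "c \<in> atlas R" and d: "d \<in> atlas Y"
  show "(\<sigma>' d \<circ> chart_inv c) holomorphic_on snd c ` (W \<inter> fst c \<inter> b -` fst d)"
  proof (rule holomorphic_transform)
    show "(\<sigma> d \<circ> chart_inv c) holomorphic_on snd c ` (W \<inter> fst c \<inter> b -` fst d)"
      using \<sigma> c d by (simp add: holo_pb_section_iff)
    show "(\<sigma> d \<circ> chart_inv c) p = (\<sigma>' d \<circ> chart_inv c) p" if "p \<in> snd c ` (W \<inter> fst c \<inter> b -` fst d)" for p
      using that eq[OF d] chart_inv_left[OF chR[OF c]] by auto
  qed
qed

lemma holo_pb_section_subset: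
  "holo_pb_section R Y b W \<sigma> \<Longrightarrow> W' \<subseteq> W \<Longrightarrow> holo_pb_section R Y b W' \<sigma>"
  unfolding holo_pb_section_iff pb_law_def
  by (blast intro: holomorphic_on_subset[OF _ image_mono])

lemma holo_vector_field_subset:
  "holo_vector_field R W \<eta> \<Longrightarrow> W' \<subseteq> W \<Longrightarrow> holo_vector_field R W' \<eta>"
  unfolding holo_vector_field_iff vf_law_def
  by (blast intro: holomorphic_on_subset[OF _ image_mono])

lemma holo_vector_field_diff:
  assumes "holo_vector_field R W \<eta>" "holo_vector_field R W \<eta>'"
  shows "holo_vector_field R W (\<lambda>c x. \<eta> c x - \<eta>' c x)"
proof -
  have "((\<lambda>x. \<eta> c x - \<eta>' c x) \<circ> chart_inv c) holomorphic_on snd c ` (W \<inter> fst c)" if "c \<in> atlas R" for c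
    using holomorphic_on_diff[of "\<eta> c \<circ> chart_inv c" _ "\<eta>' c \<circ> chart_inv c"] assms that
    by (simp add: holo_vector_field_iff o_def)
  then show ?thesis
    using vf_law_diff[of W \<eta> W \<eta>'] assms by (simp add: holo_vector_field_iff)
qed

lemma holo_vector_field_zero: "holo_vector_field R W (\<lambda>c x. 0)"
  by (simp add: holo_vector_field_iff o_def vf_law_zero)

text \<open>A representative that differs from \<open>\<sigma>1\<close> by the push-forward of
  \<open>\<eta>'\<close> differs from \<open>\<sigma>2\<close> by that of
  \<open>\<eta>' - \<eta>\<close>, on the intersection of the two neighbourhoods.\<close>

lemma normal_class_subset:
  assumes W: "openin (mtop R) W" "x \<in> W"
    and \<sigma>: "holo_pb_section R Y b W \<sigma>1" "holo_pb_section R Y b W \<sigma>2"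
    and \<eta>: "holo_vector_field R W \<eta>"
    and eq: "\<And>d y. d \<in> atlas Y \<Longrightarrow> y \<in> W \<Longrightarrow> b y \<in> fst d \<Longrightarrow> \<sigma>2 d y = \<sigma>1 d y + push_vector_field R b \<eta> d y"
  shows "normal_class R Y b \<sigma>1 x \<subseteq> normal_class R Y b \<sigma>2 x"
proof
  fix \<sigma>' assume "\<sigma>' \<in> normal_class R Y b \<sigma>1 x"
  then obtain W' \<eta>' where W': "openin (mtop R) W'" "x \<in> W'"
    and \<sigma>': "holo_pb_section R Y b W' \<sigma>'" and \<eta>': "holo_vector_field R W' \<eta>'"
    and eq': "\<And>d y. d \<in> atlas Y \<Longrightarrow> y \<in> W' \<Longrightarrow> b y \<in> fst d \<Longrightarrow> \<sigma>' d y = \<sigma>1 d y + push_vector_field R b \<eta>' d y"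
    unfolding normal_class_def by auto
  let ?V = "W \<inter> W'" and ?\<eta> = "\<lambda>c x. \<eta>' c x - \<eta> c x"
  have "openin (mtop R) ?V" "x \<in> ?V" using W W' by auto
  moreover have "holo_pb_section R Y b ?V \<sigma>2" "holo_pb_section R Y b ?V \<sigma>'"
    using \<sigma>(2) \<sigma>' by (auto intro: holo_pb_section_subset)
  moreover have "holo_vector_field R ?V ?\<eta>"
    by (intro holo_vector_field_diff holo_vector_field_subset[OF \<eta>] holo_vector_field_subset[OF \<eta>']) auto
  moreover have "\<sigma>' d y = \<sigma>2 d y + push_vector_field R b ?\<eta> d y"
    if "d \<in> atlas Y" "y \<in> ?V \<inter> b -` fst d" for d y
  proof -
    have "y \<in> points R" using openin_subset[OF W(1)] that by blast
    then have "push_vector_field R b ?\<eta> d y = push_vector_field R b \<eta>' d y - push_vector_field R b \<eta> d y"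
      using \<eta> \<eta>' that by (intro push_vector_field_diff[of W' _ W]) (auto simp: holo_vector_field_iff)
    then show ?thesis using eq eq' that by simp
  qed
  ultimately show "\<sigma>' \<in> normal_class R Y b \<sigma>2 x"
    unfolding normal_class_def by blast
qed

lemma normal_class_eq:
  assumes W: "openin (mtop R) W" "x \<in> W"
    and \<sigma>: "holo_pb_section R Y b W \<sigma>1" "holo_pb_section R Y b W \<sigma>2"
    and \<eta>: "holo_vector_field R W \<eta>"
    and eq: "\<And>d y. d \<in> atlas Y \<Longrightarrow> y \<in> W \<Longrightarrow> b y \<in> fst d \<Longrightarrow> \<sigma>2 d y = \<sigma>1 d y + push_vector_field R b \<eta> d y"
  shows "normal_class R Y b \<sigma>1 x = normal_class R Y b \<sigma>2 x"
proof
  show "normal_class R Y b \<sigma>1 x \<subseteq> normal_class R Y b \<sigma>2 x"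
    by (rule normal_class_subset[OF assms])
  \<comment> \<open>The negative field is written as a difference from the zero field, so that
    closure under differences covers it.\<close>
  let ?\<eta> = "\<lambda>c x. 0 - \<eta> c x"
  show "normal_class R Y b \<sigma>2 x \<subseteq> normal_class R Y b \<sigma>1 x"
  proof (rule normal_class_subset[OF W \<sigma>(2,1)])
    show "holo_vector_field R W ?\<eta>" by (intro holo_vector_field_diff holo_vector_field_zero \<eta>)
    show "\<sigma>1 d y = \<sigma>2 d y + push_vector_field R b ?\<eta> d y"
      if "d \<in> atlas Y" "y \<in> W" "b y \<in> fst d" for d y
    proof -
      have "y \<in> points R" using openin_subset[OF W(1)] that by blast
      then have "push_vector_field R b ?\<eta> d y = - push_vector_field R b \<eta> d y"
        using push_vector_field_diff[OF vf_law_zero[of UNIV], of W \<eta> y d] \<eta> that push_vector_field_zero[of y d]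
        by (simp add: holo_vector_field_iff)
      then show ?thesis using eq that by simp
    qed
  qed
qed

text \<open>The class of \<open>u - b\<^sub>* \<eta>\<close> does not depend on the primitive \<open>\<eta>\<close> of \<open>\<theta>\<close>: two
  primitives differ by a holomorphic vector field.\<close>

lemma normal_class_primitive_independent:
  assumes W: "openin (mtop R) W1" "openin (mtop R) W2" "x \<in> W1" "x \<in> W2"
    and \<eta>1: "smooth_vector_field R W1 \<eta>1" "dbar_vector_field R W1 \<eta>1 \<theta>"
    and \<eta>2: "smooth_vector_field R W2 \<eta>2" "dbar_vector_field R W2 \<eta>2 \<theta>"
    and \<sigma>1: "holo_pb_section R Y b W1 \<sigma>1"
    and u1: "\<And>d y. d \<in> atlas Y \<Longrightarrow> y \<in> W1 \<Longrightarrow> b y \<in> fst d \<Longrightarrow> u d y = \<sigma>1 d y + push_vector_field R b \<eta>1 d y"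
    and u2: "\<And>d y. d \<in> atlas Y \<Longrightarrow> y \<in> W2 \<Longrightarrow> b y \<in> fst d \<Longrightarrow> u d y = \<sigma>2 d y + push_vector_field R b \<eta>2 d y"
  shows "normal_class R Y b \<sigma>1 x = normal_class R Y b \<sigma>2 x"
proof -
  let ?W = "W1 \<inter> W2" and ?\<eta> = "\<lambda>c x. \<eta>1 c x - \<eta>2 c x"
  have oW: "openin (mtop R) ?W" using W by blast
  have law: "vf_law W1 \<eta>1" "vf_law W2 \<eta>2" using \<eta>1 \<eta>2 by (auto simp: smooth_vector_field_iff)
  have sm: "smooth_on (\<eta>1 c \<circ> chart_inv c) (snd c ` (?W \<inter> fst c))"
    "smooth_on (\<eta>2 c \<circ> chart_inv c) (snd c ` (?W \<inter> fst c))" if "c \<in> atlas R" for c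
    using \<eta>1(1) \<eta>2(1) that unfolding smooth_vector_field_iff
    by (auto intro: smooth_on_subset[OF _ image_mono])
  have "holo_vector_field R ?W ?\<eta>"
  proof (rule smooth_dbar_zero_imp_holo[OF oW])
    have "smooth_on (?\<eta> c \<circ> chart_inv c) (snd c ` (?W \<inter> fst c))" if c: "c \<in> atlas R" for c
      using smooth_on_diff[OF open_vf_domain[OF c oW] sm[OF c]] by (simp add: o_def)
    then show "smooth_vector_field R ?W ?\<eta>"
      using vf_law_diff[OF law] by (simp add: smooth_vector_field_iff)
    show "dbar_vector_field R ?W ?\<eta> (\<lambda>c x. 0)"
      unfolding dbar_vector_field_def
    proof (intro ballI)
      fix c x assume c: "c \<in> atlas R" and x: "x \<in> ?W \<inter> fst c"
      have px: "snd c x \<in> snd c ` (?W \<inter> fst c)" using x by blast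
      have d: "(\<eta>1 c \<circ> chart_inv c) differentiable (at (snd c x))"
        "(\<lambda>p. - (\<eta>2 c \<circ> chart_inv c) p) differentiable (at (snd c x))"
        "(\<eta>2 c \<circ> chart_inv c) differentiable (at (snd c x))"
        using smooth_onD[OF sm(1)[OF c] px] smooth_onD[OF sm(2)[OF c] px]
          smooth_onD[OF smooth_on_minus[OF open_vf_domain[OF c oW] sm(2)[OF c]] px] by auto
      have "wirt_bar 1 (?\<eta> c \<circ> chart_inv c) (snd c x) =
          wirt_bar 1 (\<eta>1 c \<circ> chart_inv c) (snd c x) - wirt_bar 1 (\<eta>2 c \<circ> chart_inv c) (snd c x)"
        using wirt_add(2)[OF d(1,2), of 1] wirt_minus(2)[OF d(3), of 1] by (simp add: o_def)
      also have "\<dots> = 0" using \<eta>1(2) \<eta>2(2) c x by (simp add: dbar_vector_field_def)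
      finally show "wirt_bar 1 (?\<eta> c \<circ> chart_inv c) (snd c x) = 0" .
    qed
  qed
  moreover have eq: "\<sigma>2 d y = \<sigma>1 d y + push_vector_field R b ?\<eta> d y"
    if "d \<in> atlas Y" "y \<in> ?W" "b y \<in> fst d" for d y
  proof -
    have "y \<in> points R" using openin_subset[OF W(1)] that by blast
    then have "push_vector_field R b ?\<eta> d y = push_vector_field R b \<eta>1 d y - push_vector_field R b \<eta>2 d y"
      using law that by (intro push_vector_field_diff[of W1 _ W2]) auto
    moreover have "\<sigma>2 d y + push_vector_field R b \<eta>2 d y = \<sigma>1 d y + push_vector_field R b \<eta>1 d y"
      using u1[of d y] u2[of d y] that by simp
    ultimately show ?thesis by (metis add_diff_cancel_right' add_diff_eq)
  qed
  moreover have s1: "holo_pb_section R Y b ?W \<sigma>1" using \<sigma>1 by (auto intro: holo_pb_section_subset)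
  \<comment> \<open>Holomorphy of \<open>\<sigma>2\<close> is a conclusion here: on the intersection
    it is \<open>\<sigma>1\<close> plus the push-forward of the holomorphic field
    \<open>?\<eta>\<close>.\<close>
  moreover have "holo_pb_section R Y b ?W \<sigma>2"
    by (rule holo_pb_section_cong[OF oW holo_pb_section_add[OF s1 holo_pb_section_push[OF oW calculation(1)]] eq])
  ultimately show ?thesis
    using oW W by (intro normal_class_eq[of ?W]) auto
qed

text \<open>Vector fields are given by components in all charts of the atlas, while a horizontal
  lift yields a coefficient in one adapted chart. This is the field on the domain of
  \<open>c\<close> whose component there is \<open>a\<close>.\<close>

definition extend_vf :: "('p, complex) chart \<Rightarrow> (complex \<Rightarrow> complex) \<Rightarrow> ('p, complex) chart \<Rightarrow> 'p \<Rightarrow> complex" where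
  "extend_vf c a k x = transition c k x * a (snd c x)"

lemma extend_vf_self: "c \<in> atlas R \<Longrightarrow> x \<in> fst c \<Longrightarrow> extend_vf c a c x = a (snd c x)"
  by (simp add: extend_vf_def transition_refl[OF R])

text \<open>The transformation law is the cocycle identity. In another chart \<open>k\<close> the
  component is a holomorphic factor times \<open>a\<close> composed with a holomorphic coordinate
  change, so dbar falls on \<open>a\<close> alone and picks up the conjugate of
  \<open>transition k c\<close>. This is the factor in the law of a \<open>(0,1)\<close>-form with
  values in the tangent bundle, so the equation for \<theta> in \<open>c\<close> spreads to every
  chart.\<close>

lemma
  assumes c: "c \<in> atlas R" and a: "smooth_on a (snd c ` fst c)"
  shows smooth_extend_vf: "smooth_vector_field R (fst c) (extend_vf c a)"
    and dbar_extend_vf: "smooth_T01_form R \<theta> \<Longrightarrow> (\<And>x. x \<in> fst c \<Longrightarrow> wirt_bar 1 a (snd c x) = \<theta> c x) \<Longrightarrow>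
      dbar_vector_field R (fst c) (extend_vf c a) \<theta>"
proof -
  have opc: "open (snd c ` fst c)" using chR[OF c] by (simp add: is_chart_def)
  have law: "vf_law (fst c) (extend_vf c a)"
    by (rule vf_lawI) (simp add: extend_vf_def transition_cocycle[OF R c] flip: mult.assoc)
  define T where "T k = wirt 1 (snd k \<circ> chart_inv c)" for k :: "('p, complex) chart"
  have ext: "open (snd k ` (fst c \<inter> fst k))"
    "cholomorphic_on (\<lambda>p. T k ((snd c \<circ> chart_inv k) p)) (snd k ` (fst c \<inter> fst k))"
    "smooth_on (\<lambda>p. a ((snd c \<circ> chart_inv k) p)) (snd k ` (fst c \<inter> fst k))"
    "cholomorphic_on (snd c \<circ> chart_inv k) (snd k ` (fst c \<inter> fst k))"
    "\<And>p. p \<in> snd k ` (fst c \<inter> fst k) \<Longrightarrow>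
       T k ((snd c \<circ> chart_inv k) p) * a ((snd c \<circ> chart_inv k) p) = (extend_vf c a k \<circ> chart_inv k) p"
    if k: "k \<in> atlas R" for k
  proof -
    show op: "open (snd k ` (fst c \<inter> fst k))" by (rule open_vf_domain[OF k open_chart[OF c]])
    have op': "open (snd c ` (fst k \<inter> fst c))" by (rule open_vf_domain[OF c open_chart[OF k]])
    have Th: "cholomorphic_on (T k) (snd c ` (fst k \<inter> fst c))"
      unfolding T_def
      by (rule cholomorphic_on_wirt_cholomorphic[OF _ op'])
        (use charts_compatible[OF R atlas_charts(1)[OF c] atlas_charts(1)[OF k]] in \<open>simp add: Int_commute\<close>)
    show ph: "cholomorphic_on (snd c \<circ> chart_inv k) (snd k ` (fst c \<inter> fst k))"
      using charts_compatible[OF R atlas_charts(1)[OF k] atlas_charts(1)[OF c]] by (simp add: Int_commute)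
    have im: "(snd c \<circ> chart_inv k) ` (snd k ` (fst c \<inter> fst k)) \<subseteq> snd c ` (fst k \<inter> fst c)"
      using chart_inv_left[OF chR[OF k]] by auto
    show "cholomorphic_on (\<lambda>p. T k ((snd c \<circ> chart_inv k) p)) (snd k ` (fst c \<inter> fst k))"
      by (rule cholomorphic_on_compose[OF ph Th im])
    show "smooth_on (\<lambda>p. a ((snd c \<circ> chart_inv k) p)) (snd k ` (fst c \<inter> fst k))"
      by (rule smooth_on_compose[OF op opc _ cholomorphic_on_imp_smooth_on[OF ph op] a]) (use im in blast)
    show "T k ((snd c \<circ> chart_inv k) p) * a ((snd c \<circ> chart_inv k) p) = (extend_vf c a k \<circ> chart_inv k) p"
      if "p \<in> snd k ` (fst c \<inter> fst k)" for p
      using that chart_inv_left[OF chR[OF k]] transition_wirt(1)[OF R c k] by (auto simp: T_def extend_vf_def)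
  qed
  have "smooth_on (extend_vf c a k \<circ> chart_inv k) (snd k ` (fst c \<inter> fst k))" if k: "k \<in> atlas R" for k
    by (rule smooth_on_cong[OF smooth_on_mult[OF ext(1)[OF k] cholomorphic_on_imp_smooth_on[OF ext(2)[OF k] ext(1)[OF k]]
          ext(3)[OF k]] ext(1)[OF k] ext(5)[OF k]])
  with law show "smooth_vector_field R (fst c) (extend_vf c a)"
    by (simp add: smooth_vector_field_iff)
  show "dbar_vector_field R (fst c) (extend_vf c a) \<theta>"
    if \<theta>: "smooth_T01_form R \<theta>" and a\<theta>: "\<And>x. x \<in> fst c \<Longrightarrow> wirt_bar 1 a (snd c x) = \<theta> c x"
    unfolding dbar_vector_field_def
  proof (intro ballI)
    fix k x assume k: "k \<in> atlas R" and x: "x \<in> fst c \<inter> fst k"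
    let ?V = "snd k ` (fst c \<inter> fst k)" and ?\<phi> = "snd c \<circ> chart_inv k"
    have px: "snd k x \<in> ?V" using x by blast
    have \<phi>x: "?\<phi> (snd k x) = snd c x" using chart_inv_left[OF chR[OF k]] x by simp
    have da: "a differentiable (at (?\<phi> (snd k x)))" using smooth_onD[OF a] x \<phi>x by auto
    have t: "frechet_derivative ?\<phi> (at (snd k x)) 1 = transition k c x"
      using transition_wirt(1)[OF R k c, of x] cholomorphic_on_wirt(1)[OF ext(4)[OF k] px, of 1] x by simp
    have "wirt_bar 1 (extend_vf c a k \<circ> chart_inv k) (snd k x) = wirt_bar 1 (\<lambda>p. T k (?\<phi> p) * a (?\<phi> p)) (snd k x)"
      by (rule wirt_cong_open(2)[OF ext(1)[OF k] px]) (simp only: ext(5)[OF k])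
    also have "\<dots> = T k (?\<phi> (snd k x)) * wirt_bar 1 (\<lambda>p. a (?\<phi> p)) (snd k x)"
      using wirt_mult(2)[OF cholomorphic_onD(1)[OF ext(2)[OF k] px] smooth_onD[OF ext(3)[OF k] px], of 1]
        cholomorphic_on_wirt(2)[OF ext(2)[OF k] px, of 1] by simp
    also have "wirt_bar 1 (\<lambda>p. a (?\<phi> p)) (snd k x) = wirt_bar (frechet_derivative ?\<phi> (at (snd k x)) 1) a (?\<phi> (snd k x))"
      by (rule wirt_comp(2)[OF cholomorphic_onD(2)[OF ext(4)[OF k] px] cholomorphic_onD(3)[OF ext(4)[OF k] px] da])
    also have "\<dots> = cnj (transition k c x) * \<theta> c x"
      using wirt_cmul(2)[OF da, of "transition k c x" 1] a\<theta>[of x] x t \<phi>x by simp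
    also have "T k (?\<phi> (snd k x)) = transition c k x"
      using transition_wirt(1)[OF R c k, of x] x \<phi>x by (simp add: T_def)
    also have "transition c k x * (cnj (transition k c x) * \<theta> c x) = transition c k x / cnj (transition c k x) * \<theta> c x"
    proof -
      have "transition k c x * transition c k x = 1" using transition_inverse[OF R c k] x by simp
      then have "transition k c x = 1 / transition c k x" by (metis eq_divide_imp mult_zero_right zero_neq_one)
      then show ?thesis by simp
    qed
    also have "\<dots> = \<theta> k x" 
      by (rule sym) (use \<theta> c k x in \<open>unfold smooth_T01_form_def, blast\<close>)
    finally show "wirt_bar 1 (extend_vf c a k \<circ> chart_inv k) (snd k x) = \<theta> k x" .
  qed
qed

end

section \<open>Adapted coordinates on a family\<close>

locale covering_family =
  fixes X :: "('x, complex \<times> 'e::complex_euclidean) manifold" and S :: "('s, 'e) manifold"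
    and Y :: "('y, complex) manifold" and f :: "'x \<Rightarrow> 's" and \<beta> :: "'x \<Rightarrow> 'y"
    and h :: "'s \<Rightarrow> ('x, complex) chart \<Rightarrow> 'x \<Rightarrow> real"
  assumes X: "complex_manifold X" and S: "complex_manifold S" and Y: "complex_manifold Y"
    and f: "holomorphic_map X S f" and \<beta>: "holomorphic_map X Y \<beta>"
    and fib: "\<And>t. t \<in> points S \<Longrightarrow> complex_manifold (fiber X S f t)"
    and hyp: "hyperbolic_metric_family X S f h"
begin

abbreviation "ad \<equiv> adapted_charts X S f"
abbreviation "fc \<equiv> fiber_chart X f"
abbreviation "img c \<equiv> snd c ` fst c"

lemma adD:
  assumes "(c, e) \<in> ad"
  shows "c \<in> charts X" "e \<in> atlas S" "is_chart (mtop X) c" "is_chart (mtop S) e"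
    "\<And>x. x \<in> fst c \<Longrightarrow> f x \<in> fst e" "\<And>x. x \<in> fst c \<Longrightarrow> snd (snd c x) = snd e (f x)"
    "\<And>x. x \<in> fst c \<Longrightarrow> x \<in> points X" "\<And>x. x \<in> fst c \<Longrightarrow> f x \<in> points S" "open (img c)"
    "\<And>x. x \<in> fst c \<Longrightarrow> chart_inv c (snd c x) = x"
proof -
  show 1: "c \<in> charts X" "e \<in> atlas S" and 2: "\<And>x. x \<in> fst c \<Longrightarrow> f x \<in> fst e"
    and "\<And>x. x \<in> fst c \<Longrightarrow> snd (snd c x) = snd e (f x)"
    using assms by (auto simp: adapted_charts_def)
  show ch: "is_chart (mtop X) c" "is_chart (mtop S) e"
    using 1 charts_is_chart atlas_is_chart[OF S] by blast+
  show "x \<in> points X" if "x \<in> fst c" for x using is_chart_subset[OF ch(1)] that by blast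
  show "f x \<in> points S" if "x \<in> fst c" for x using is_chart_subset[OF ch(2)] 2[OF that] by blast
  show "open (img c)" using ch(1) by (simp add: is_chart_def)
  show "chart_inv c (snd c x) = x" if "x \<in> fst c" for x by (rule chart_inv_left[OF ch(1) that])
qed

lemma fc_simps: "snd (fc t c) x = fst (snd c x)" "x \<in> fst (fc t c) \<longleftrightarrow> x \<in> fst c \<and> x \<in> points X \<and> f x = t"
  by (auto simp: fiber_chart_def fiber_set_def)

lemma fc_mem: "(c, e) \<in> ad \<Longrightarrow> x \<in> fst (fc t c) \<longleftrightarrow> x \<in> fst c \<and> f x = t"
  using adD(7)[of c e x] by (auto simp: fc_simps)

lemma fc_atlas: "(c, e) \<in> ad \<Longrightarrow> fc t c \<in> atlas (fiber X S f t)"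
  unfolding fiber_def manifold.select_convs by blast

lemma atlas_fiberE:
  assumes "k \<in> atlas (fiber X S f t)"
  obtains c e where "(c, e) \<in> ad" "k = fc t c"
  using assms unfolding fiber_def by auto

lemma points_fiber: "points (fiber X S f t) = fiber_set X f t"
  unfolding fiber_def fiber_set_def by auto

lemma snd_c_eq: "(c, e) \<in> ad \<Longrightarrow> x \<in> fst (fc t c) \<Longrightarrow> snd c x = (snd (fc t c) x, snd e t)"
  using adD(6) by (auto simp: fc_mem fc_simps prod_eq_iff)

text \<open>A point of the image of \<open>c\<close> whose base coordinate is that of
  \<open>t\<close> lies over \<open>t\<close>, because \<open>e\<close> is injective. The fiber
  chart and its inverse are therefore the restrictions of \<open>c\<close> and its inverse to the
  slice.\<close>

lemma slice_chart:
  assumes ce: "(c, e) \<in> ad" and t: "t \<in> fst e"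
  shows "snd (fc t c) ` fst (fc t c) = {p. (p, snd e t) \<in> img c}"
    and "p \<in> snd (fc t c) ` fst (fc t c) \<Longrightarrow> chart_inv (fc t c) p = chart_inv c (p, snd e t)"
    and "p \<in> snd (fc t c) ` fst (fc t c) \<Longrightarrow> chart_inv c (p, snd e t) \<in> fst (fc t c)"
proof -
  have tS: "t \<in> points S" using t is_chart_subset[OF adD(4)[OF ce]] by blast
  note chk = atlas_is_chart[OF fib[OF tS] fc_atlas[OF ce]]
  have *: "\<exists>x. x \<in> fst (fc t c) \<and> snd (fc t c) x = p \<and> snd c x = (p, snd e t)" if "(p, snd e t) \<in> img c" for p
  proof -
    obtain x where x: "x \<in> fst c" "snd c x = (p, snd e t)" using \<open>(p, snd e t) \<in> img c\<close> by (metis imageE)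
    have "snd e (f x) = snd e t" using adD(6)[OF ce x(1)] x(2) by simp
    then have "f x = t" using is_chart_inj[OF adD(4)[OF ce]] adD(5)[OF ce x(1)] t by (meson inj_onD)
    then show ?thesis using x fc_mem[OF ce] by (auto simp: fc_simps)
  qed
  show eq: "snd (fc t c) ` fst (fc t c) = {p. (p, snd e t) \<in> img c}"
  proof (rule subset_antisym; rule subsetI)
    fix p assume "p \<in> snd (fc t c) ` fst (fc t c)"
    then obtain x where "x \<in> fst (fc t c)" "p = snd (fc t c) x" by blast
    then show "p \<in> {p. (p, snd e t) \<in> img c}"
      using snd_c_eq[OF ce] fc_mem[OF ce] by (metis imageI mem_Collect_eq)
  next
    fix p assume "p \<in> {p. (p, snd e t) \<in> img c}"
    then show "p \<in> snd (fc t c) ` fst (fc t c)" using * by blast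
  qed
  fix p assume "p \<in> snd (fc t c) ` fst (fc t c)"
  then obtain x where x: "x \<in> fst (fc t c)" "snd (fc t c) x = p" "snd c x = (p, snd e t)"
    using * eq by blast
  then have "chart_inv c (p, snd e t) = x" "chart_inv (fc t c) p = x"
    using adD(10)[OF ce, of x] chart_inv_left[OF chk x(1)] fc_mem[OF ce] by auto
  with x show "chart_inv (fc t c) p = chart_inv c (p, snd e t)" "chart_inv c (p, snd e t) \<in> fst (fc t c)" by auto
qed

section \<open>The metric coefficient and the lift in adapted coordinates\<close>

abbreviation "g \<equiv> family_coefficient X f h"

lemma g_chart: "(c, e) \<in> ad \<Longrightarrow> x \<in> fst c \<Longrightarrow> g c (snd c x) = h (f x) (fc (f x) c) x"
  by (simp add: family_coefficient_def adD(10))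

lemma fiber_hyperbolic: "t \<in> points S \<Longrightarrow> hyperbolic_metric (fiber X S f t) (h t)"
  using hyp by (simp add: hyperbolic_metric_family_def)

lemma fiber_hyperbolicD:
  assumes t: "t \<in> points S" and k: "k \<in> atlas (fiber X S f t)" "x \<in> fst k"
  shows "h t k x > 0"
    and "wirt 1 (wirt_bar 1 (\<lambda>p. of_real (ln (h t k (chart_inv k p))))) (snd k x) = of_real (h t k x)"
    and "k' \<in> atlas (fiber X S f t) \<Longrightarrow> x \<in> fst k' \<Longrightarrow> h t k x = (cmod (transition k k' x))\<^sup>2 * h t k' x"
proof -
  note H = fiber_hyperbolic[OF t, unfolded hyperbolic_metric_def]
  show "h t k x > 0"
    using H[THEN conjunct2, THEN conjunct2, THEN conjunct1] k by blast
  show "wirt 1 (wirt_bar 1 (\<lambda>p. of_real (ln (h t k (chart_inv k p))))) (snd k x) = of_real (h t k x)"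
    using H[THEN conjunct2, THEN conjunct2, THEN conjunct2] k by blast
  show "h t k x = (cmod (transition k k' x))\<^sup>2 * h t k' x" if "k' \<in> atlas (fiber X S f t)" "x \<in> fst k'"
    using H[THEN conjunct1] k that by blast
qed

lemma g_smooth: "(c, e) \<in> ad \<Longrightarrow> smooth_on (g c) (img c)"
  using hyp unfolding hyperbolic_metric_family_def by blast

lemma g_pos:
  assumes ce: "(c, e) \<in> ad" and q: "q \<in> img c"
  shows "g c q > 0"
proof -
  obtain x where x: "x \<in> fst c" "q = snd c x" using q by blast
  have "h (f x) (fc (f x) c) x > 0"
    by (rule fiber_hyperbolicD(1)[OF adD(8)[OF ce x(1)] fc_atlas[OF ce]]) (simp add: fc_mem[OF ce] x)
  then show ?thesis using g_chart[OF ce x(1)] x by simp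
qed

definition lg :: "('x, complex \<times> 'e) chart \<Rightarrow> complex \<times> 'e \<Rightarrow> complex" where
  "lg c p = of_real (ln (g c p))"

text \<open>This is the function L of the overview in the coordinates of \<open>c\<close>.\<close>

definition dlg :: "('x, complex \<times> 'e) chart \<Rightarrow> complex \<times> 'e \<Rightarrow> complex" where
  "dlg c = wirt_bar (1, 0) (lg c)"

lemma lg_smooth: "(c, e) \<in> ad \<Longrightarrow> smooth_on (lg c) (img c)"
  unfolding lg_def[abs_def] by (intro smooth_on_of_real smooth_on_ln g_smooth g_pos adD)

lemma dlg_smooth: "(c, e) \<in> ad \<Longrightarrow> smooth_on (dlg c) (img c)"
  unfolding dlg_def by (intro smooth_on_wirt lg_smooth adD)

text \<open>The curvature condition is imposed on each fiber separately, in fiber charts. On the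
  slice through \<open>q\<close> these one-variable derivatives are the Wirtinger derivatives of the
  family coefficient in the direction \<open>(1, 0)\<close>.\<close>

lemma liouville:
  assumes ce: "(c, e) \<in> ad" and q: "q \<in> img c"
  shows "wirt (1, 0) (dlg c) q = of_real (g c q)"
proof -
  obtain x where x: "x \<in> fst c" "q = snd c x" using q by blast
  define t where "t = f x"
  define k where "k = fc t c"
  let ?V = "snd k ` fst k"
  have tS: "t \<in> points S" "t \<in> fst e" using adD(5,8)[OF ce x(1)] by (auto simp: t_def)
  have xk: "x \<in> fst k" using fc_mem[OF ce] x by (simp add: k_def t_def)
  have qe: "q = (snd k x, snd e t)" using snd_c_eq[OF ce, of x t] xk x by (simp add: k_def)
  note sl = slice_chart[OF ce tS(2), folded k_def]
  have op: "open ?V" using sl(1) open_slice[OF adD(9)[OF ce]] by metis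
  have px: "snd k x \<in> ?V" using xk by blast
  have inU: "(p, snd e t) \<in> img c" if "p \<in> ?V" for p using sl(1) that by blast
  have eq: "of_real (ln (h t k (chart_inv k p))) = lg c (p, snd e t)" if p: "p \<in> ?V" for p
  proof -
    have y: "chart_inv k p \<in> fst k" "snd c (chart_inv k p) = (p, snd e t)"
      using sl(2,3)[OF p] chart_inv_right(1)[OF inU[OF p]] by auto
    then have "g c (p, snd e t) = h t k (chart_inv k p)"
      using g_chart[OF ce, of "chart_inv k p"] fc_mem[OF ce] by (simp add: k_def)
    then show ?thesis by (simp add: lg_def)
  qed
  have eq2: "wirt_bar 1 (\<lambda>p. of_real (ln (h t k (chart_inv k p)))) p = dlg c (p, snd e t)" if p: "p \<in> ?V" for p
  proof -
    have "wirt_bar 1 (\<lambda>p. of_real (ln (h t k (chart_inv k p)))) p = wirt_bar 1 (\<lambda>p. lg c (p, snd e t)) p"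
      by (rule wirt_cong_open(2)[OF op p eq])
    also have "\<dots> = dlg c (p, snd e t)"
      unfolding dlg_def by (rule wirt_slice(2)[OF smooth_onD[OF lg_smooth[OF ce] inU[OF p]]])
    finally show ?thesis .
  qed
  have "wirt (1, 0) (dlg c) q = wirt 1 (\<lambda>p. dlg c (p, snd e t)) (snd k x)"
    unfolding qe by (rule wirt_slice(1)[OF smooth_onD[OF dlg_smooth[OF ce] inU[OF px]], symmetric])
  also have "\<dots> = wirt 1 (wirt_bar 1 (\<lambda>p. of_real (ln (h t k (chart_inv k p))))) (snd k x)"
    by (rule wirt_cong_open(1)[OF op px eq2[symmetric]])
  also have "\<dots> = of_real (h t k x)"
    by (rule fiber_hyperbolicD(2)[OF tS(1) fc_atlas[OF ce, of t, folded k_def] xk])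
  also have "h t k x = g c q" using g_chart[OF ce x(1)] x by (simp add: t_def k_def)
  finally show ?thesis .
qed

text \<open>The vertical coefficient of the horizontal lift as a function on the whole chart image,
  for a constant base direction \<open>v\<close>. In this form it can be differentiated and
  restricted to slices, whereas \<open>horizontal_lift\<close> is evaluated at points of X.\<close>

definition lift :: "('x, complex \<times> 'e) chart \<Rightarrow> 'e \<Rightarrow> complex \<times> 'e \<Rightarrow> complex" where
  "lift c v q = - wirt (0, v) (dlg c) q / of_real (g c q)"

lemma horizontal_lift_eq: "horizontal_lift X f h \<xi> c e x = (lift c (\<xi> e) (snd c x), \<xi> e)"
  by (simp add: horizontal_lift_def Let_def lift_def dlg_def lg_def[abs_def])

lemma lift_smooth:
  assumes ce: "(c, e) \<in> ad"
  shows "smooth_on (lift c v) (img c)"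
proof -
  have "lift c v = (\<lambda>q. (- wirt (0, v) (dlg c) q) * of_real (inverse (g c q)))"
    by (auto simp: lift_def divide_inverse)
  then show ?thesis
    by (simp only:) (intro smooth_on_mult smooth_on_minus smooth_on_of_real smooth_on_inverse
      smooth_on_wirt dlg_smooth[OF ce] g_smooth[OF ce] g_pos[OF ce] adD[OF ce])
qed

lemma lift_harmonic:
  assumes ce: "(c, e) \<in> ad" and q: "q \<in> img c"
  shows "wirt (1, 0) (\<lambda>q. of_real (g c q) * wirt_bar (1, 0) (lift c v) q) q = 0"
  unfolding lift_def[abs_def] dlg_def lg_def[abs_def]
  by (rule liouville_wirt_zero[OF adD(9)[OF ce] g_smooth[OF ce] g_pos[OF ce] _ q])
    (use liouville[OF ce] in \<open>simp_all add: dlg_def lg_def[abs_def]\<close>)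

end

section \<open>Change of adapted coordinates\<close>

context covering_family
begin

definition coord :: "('x, complex \<times> 'e) chart \<Rightarrow> ('x, complex \<times> 'e) chart \<Rightarrow> complex \<times> 'e \<Rightarrow> complex \<times> 'e" where
  "coord c c' = snd c' \<circ> chart_inv c"

text \<open>This is \<phi> of the overview: the new fiber coordinate as a function of the old
  coordinates.\<close>

definition ztrans :: "('x, complex \<times> 'e) chart \<Rightarrow> ('x, complex \<times> 'e) chart \<Rightarrow> complex \<times> 'e \<Rightarrow> complex" where
  "ztrans c c' q = fst (coord c c' q)"

abbreviation "ovl c c' \<equiv> snd c ` (fst c' \<inter> fst c)"

text \<open>The differential of the change of base coordinates. It takes a point \<open>q\<close> of
  the total space for uniformity with \<open>ztrans\<close>, but depends on its base coordinate
  only.\<close>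

definition dbase :: "('s, 'e) chart \<Rightarrow> ('s, 'e) chart \<Rightarrow> complex \<times> 'e \<Rightarrow> 'e \<Rightarrow> 'e" where
  "dbase e e' q = frechet_derivative (snd e' \<circ> chart_inv e) (at (snd q))"

lemma coord_chart: "(c, e) \<in> ad \<Longrightarrow> x \<in> fst c \<Longrightarrow> coord c c' (snd c x) = snd c' x"
  by (simp add: coord_def adD)

lemma open_ovl: "(c, e) \<in> ad \<Longrightarrow> (c', e') \<in> ad \<Longrightarrow> open (ovl c c')"
  by (rule chart_open_image[OF adD(3)]) (use adD(3) in \<open>auto simp: is_chart_def\<close>)

lemma coord_image: "(c, e) \<in> ad \<Longrightarrow> coord c c' ` ovl c c' \<subseteq> img c'"
  using coord_chart[of c e _ c'] by auto

lemma coord_mem: "(c, e) \<in> ad \<Longrightarrow> q \<in> ovl c c' \<Longrightarrow> coord c c' q \<in> img c'"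
  using coord_image by blast

lemma coord_cholo: "(c, e) \<in> ad \<Longrightarrow> (c', e') \<in> ad \<Longrightarrow> cholomorphic_on (coord c c') (ovl c c')"
  unfolding coord_def using charts_compatible[OF X adD(1) adD(1)] by (simp add: Int_commute)

lemma ztrans_cholo:
  assumes "(c, e) \<in> ad" "(c', e') \<in> ad"
  shows "cholomorphic_on (ztrans c c') (ovl c c')"
proof -
  have "cholomorphic_on (fst :: complex \<times> 'e \<Rightarrow> complex) UNIV"
    by (rule cholomorphic_on_complex_linear[OF bounded_linear_fst]) (simp add: mul_i_prod_def)
  from cholomorphic_on_compose[OF coord_cholo[OF assms] this] show ?thesis
    unfolding ztrans_def[abs_def] by simp
qed

text \<open>Both charts turn \<open>f\<close> into the second projection, so the base component of
  the coordinate change is a function of the base coordinate alone. The Jacobian is block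
  triangular.\<close>

lemma coord_deriv:
  assumes ce: "(c, e) \<in> ad" "(c', e') \<in> ad" and q: "q \<in> ovl c c'"
  shows "frechet_derivative (coord c c') (at q) (v, w) = (wirt (v, w) (ztrans c c') q, dbase e e' q w)"
    and "dbase e e' q 0 = 0"
proof -
  let ?D = "frechet_derivative (coord c c') (at q)"
  let ?\<psi> = "snd e' \<circ> chart_inv e"
  have D: "(coord c c' has_derivative ?D) (at q)" by (rule cholomorphic_onD(2)[OF coord_cholo[OF ce] q])
  have "(ztrans c c' has_derivative (\<lambda>u. fst (?D u))) (at q)"
    unfolding ztrans_def[abs_def] by (rule has_derivative_fst[OF D])
  from fun_cong[OF frechet_derivative_at[OF this], of "(v, w)"]
  have 1: "fst (?D (v, w)) = wirt (v, w) (ztrans c c') q"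
    using cholomorphic_on_wirt(1)[OF ztrans_cholo[OF ce] q] by simp
  obtain x where x: "x \<in> fst c" "x \<in> fst c'" "q = snd c x" using q by blast
  have sq: "snd q \<in> snd e ` (fst e \<inter> fst e')"
    using adD(5)[OF ce(1)] adD(5)[OF ce(2)] adD(6)[OF ce(1)] x by auto
  have "cholomorphic_on ?\<psi> (snd e ` (fst e \<inter> fst e'))"
    using charts_compatible[OF S] adD(2)[OF ce(1)] adD(2)[OF ce(2)] atlas_subset_charts[OF S] by blast
  note \<psi> = cholomorphic_onD(2)[OF this sq]
  have sn: "(snd has_derivative snd) (at q)"
    by (rule bounded_linear_imp_has_derivative[OF bounded_linear_snd])
  have "((\<lambda>q. ?\<psi> (snd q)) has_derivative (\<lambda>u. dbase e e' q (snd u))) (at q)"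
    unfolding dbase_def by (rule has_derivative_compose[OF sn \<psi>])
  then have "((\<lambda>q. snd (coord c c' q)) has_derivative (\<lambda>u. dbase e e' q (snd u))) (at q)"
  proof (rule has_derivative_transform_within_open[OF _ open_ovl[OF ce] q])
    fix p assume "p \<in> ovl c c'"
    then obtain y where y: "y \<in> fst c" "y \<in> fst c'" "p = snd c y" by blast
    show "?\<psi> (snd p) = snd (coord c c' p)"
      using y coord_chart[OF ce(1) y(1)] adD(5,6)[OF ce(1) y(1)] adD(5,6)[OF ce(2) y(2)]
        chart_inv_left[OF adD(4)[OF ce(1)]] by simp
  qed
  moreover have "((\<lambda>q. snd (coord c c' q)) has_derivative (\<lambda>u. snd (?D u))) (at q)"
    by (rule has_derivative_snd[OF D])
  ultimately have "(\<lambda>u. snd (?D u)) = (\<lambda>u. dbase e e' q (snd u))"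
    by (rule has_derivative_unique[rotated])
  then have "snd (?D (v, w)) = dbase e e' q w" by (metis snd_conv)
  with 1 show "?D (v, w) = (wirt (v, w) (ztrans c c') q, dbase e e' q w)" by (simp add: prod_eq_iff)
  show "dbase e e' q 0 = 0" unfolding dbase_def using has_derivative_linear[OF \<psi>] by (rule linear_0)
qed

lemma wirt_coord:
  fixes F :: "complex \<times> 'e \<Rightarrow> complex"
  assumes ce: "(c, e) \<in> ad" "(c', e') \<in> ad" and q: "q \<in> ovl c c'"
    and F: "F differentiable (at (coord c c' q))"
  shows "wirt (v, w) (\<lambda>q. F (coord c c' q)) q =
      wirt (v, w) (ztrans c c') q * wirt (1, 0) F (coord c c' q) + wirt (0, dbase e e' q w) F (coord c c' q)"
    and "wirt_bar (1, 0) (\<lambda>q. F (coord c c' q)) q =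
      cnj (wirt (1, 0) (ztrans c c') q) * wirt_bar (1, 0) F (coord c c' q)"
proof -
  note c = wirt_comp[OF cholomorphic_onD(2,3)[OF coord_cholo[OF ce] q] F] 
  have s: "(z, w) = cmul z (1, 0) + (0, w)" for z and w :: 'e by simp
  show "wirt (v, w) (\<lambda>q. F (coord c c' q)) q =
      wirt (v, w) (ztrans c c') q * wirt (1, 0) F (coord c c' q) + wirt (0, dbase e e' q w) F (coord c c' q)"
    unfolding c coord_deriv(1)[OF ce q] by (subst s) (simp only: wirt_vec_add[OF F] wirt_cmul[OF F])
  show "wirt_bar (1, 0) (\<lambda>q. F (coord c c' q)) q =
      cnj (wirt (1, 0) (ztrans c c') q) * wirt_bar (1, 0) F (coord c c' q)"
    unfolding c coord_deriv[OF ce q] using wirt_cmul(2)[OF F, of "wirt (1, 0) (ztrans c c') q" "(1, 0)"] by simp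
qed

text \<open>The transition map between two fiber charts is \<open>ztrans\<close> with the base
  coordinate held fixed, hence its derivative is the partial derivative of \<open>ztrans\<close>
  along the fiber. This converts transformation laws on the fiber into identities on the total
  space.\<close>

lemma
  assumes ce: "(c, e) \<in> ad" "(c', e') \<in> ad" and x: "x \<in> fst (fc t c)" "x \<in> fst (fc t c')"
  shows open_fiber_ovl: "open (snd (fc t c) ` (fst (fc t c') \<inter> fst (fc t c)))"
    and fiber_trans: "\<And>p. p \<in> snd (fc t c) ` (fst (fc t c') \<inter> fst (fc t c)) \<Longrightarrow>
      (p, snd e t) \<in> ovl c c' \<and>
      coord c c' (p, snd e t) = ((snd (fc t c') \<circ> chart_inv (fc t c)) p, snd e' t) \<and>
      (snd (fc t c') \<circ> chart_inv (fc t c)) p = ztrans c c' (p, snd e t)"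
    and fiber_transition: "transition (fc t c) (fc t c') x = wirt (1, 0) (ztrans c c') (snd c x)"
    and snd_c_mem: "snd c x \<in> ovl c c'"
proof -
  let ?k = "fc t c" and ?k' = "fc t c'"
  let ?V = "snd ?k ` (fst ?k' \<inter> fst ?k)"
  have fx: "x \<in> fst c" "x \<in> fst c'" "f x = t" using x fc_mem ce by auto
  then have t: "t \<in> points S" "t \<in> fst e" "t \<in> fst e'" using adD(5,8)[OF ce(1)] adD(5)[OF ce(2)] by auto
  note R = fib[OF t(1)]
  note k = fc_atlas[OF ce(1), of t] fc_atlas[OF ce(2), of t]
  note ch = k[THEN atlas_is_chart[OF R]]
  show op: "open ?V" by (rule chart_open_image[OF ch(1)]) (use ch(2) in \<open>simp add: is_chart_def\<close>)
  show tr: "(p, snd e t) \<in> ovl c c' \<and> coord c c' (p, snd e t) = ((snd ?k' \<circ> chart_inv ?k) p, snd e' t) \<and>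
      (snd ?k' \<circ> chart_inv ?k) p = ztrans c c' (p, snd e t)" if p: "p \<in> ?V" for p
  proof -
    obtain y where y: "y \<in> fst ?k'" "y \<in> fst ?k" "p = snd ?k y" using p by blast
    have "snd c y = (p, snd e t)" "snd c' y = (snd ?k' y, snd e' t)"
      using snd_c_eq[OF ce(1) y(2)] snd_c_eq[OF ce(2) y(1)] y by auto
    moreover have "chart_inv ?k p = y" using chart_inv_left[OF ch(1) y(2)] y by simp
    moreover have "y \<in> fst c" "y \<in> fst c'" using y fc_mem ce by auto
    moreover have "coord c c' (p, snd e t) = snd c' y" using calculation coord_chart[OF ce(1), of y c'] by simp
    ultimately show ?thesis by (auto simp: ztrans_def intro: image_eqI[of _ _ y])
  qed
  have px: "snd ?k x \<in> ?V" using x by blast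
  have q: "snd c x = (snd ?k x, snd e t)" by (rule snd_c_eq[OF ce(1) x(1)])
  show "snd c x \<in> ovl c c'" using fx by blast
  have "transition ?k ?k' x = wirt 1 (snd ?k' \<circ> chart_inv ?k) (snd ?k x)"
    by (rule transition_wirt(1)[OF R k x])
  also have "\<dots> = wirt 1 (\<lambda>p. ztrans c c' (p, snd e t)) (snd ?k x)"
    by (rule wirt_cong_open(1)[OF op px]) (use tr in blast)
  also have "\<dots> = wirt (1, 0) (ztrans c c') (snd c x)"
    unfolding q by (rule wirt_slice(1)) (use cholomorphic_onD(1)[OF ztrans_cholo[OF ce]] tr[OF px] in blast)
  finally show "transition ?k ?k' x = wirt (1, 0) (ztrans c c') (snd c x)" .
qed

text \<open>The law of the metric on each fiber, read on the total space. Positivity of the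
  left-hand side also forces the fiber derivative of \<open>ztrans\<close> to be nonzero, which the
  later divisions rely on.\<close>

lemma g_trans:
  assumes ce: "(c, e) \<in> ad" "(c', e') \<in> ad" and q: "q \<in> ovl c c'"
  shows "complex_of_real (g c q) = wirt (1, 0) (ztrans c c') q * cnj (wirt (1, 0) (ztrans c c') q)
      * of_real (g c' (coord c c' q))"
    and "wirt (1, 0) (ztrans c c') q \<noteq> 0"
proof -
  obtain x where x: "x \<in> fst c" "x \<in> fst c'" "q = snd c x" using q by blast
  let ?k = "fc (f x) c" and ?k' = "fc (f x) c'"
  have k: "x \<in> fst ?k" "x \<in> fst ?k'" using x fc_mem ce by auto
  have "h (f x) ?k x = (cmod (transition ?k ?k' x))\<^sup>2 * h (f x) ?k' x"
    using k by (intro fiber_hyperbolicD(3) adD(8)[OF ce(1) x(1)] fc_atlas[OF ce(1)] fc_atlas[OF ce(2)])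
  then have e: "g c q = (cmod (wirt (1, 0) (ztrans c c') q))\<^sup>2 * g c' (coord c c' q)"
    using g_chart[OF ce(1) x(1)] g_chart[OF ce(2) x(2)] coord_chart[OF ce(1) x(1), of c']
      fiber_transition[OF ce k] x(3) by simp
  show "complex_of_real (g c q) = wirt (1, 0) (ztrans c c') q * cnj (wirt (1, 0) (ztrans c c') q)
      * of_real (g c' (coord c c' q))"
    unfolding e of_real_mult complex_norm_square by (rule refl)
  have "g c q > 0" by (rule g_pos[OF ce(1)]) (use x in blast)
  with e show "wirt (1, 0) (ztrans c c') q \<noteq> 0" by auto
qed

text \<open>This is L = cnj (m_z / m) + cnj m * L' with the denominator cleared, where m is the
  fiber derivative of \<open>ztrans\<close>. It results from applying dbar to the law of the metric
  and cancelling \<open>m * G'\<close>; no logarithm of a complex function appears.\<close>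

lemma dlg_trans:
  assumes ce: "(c, e) \<in> ad" "(c', e') \<in> ad" and q: "q \<in> ovl c c'"
  shows "cnj (wirt (1, 0) (ztrans c c') q) * dlg c q = cnj (wirt (1, 0) (wirt (1, 0) (ztrans c c')) q)
      + cnj (wirt (1, 0) (ztrans c c') q) * cnj (wirt (1, 0) (ztrans c c') q) * dlg c' (coord c c' q)"
proof -
  let ?m = "wirt (1, 0) (ztrans c c')"
  define G G' where "G p = complex_of_real (g c p)" and "G' p = complex_of_real (g c' p)" for p
  note op = open_ovl[OF ce]
  have hm: "cholomorphic_on ?m (ovl c c')" by (rule cholomorphic_on_wirt_cholomorphic[OF ztrans_cholo[OF ce] op])
  have sm: "smooth_on ?m (ovl c c')" by (rule cholomorphic_on_imp_smooth_on[OF hm op])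
  have q': "coord c c' q \<in> img c'" by (rule coord_mem[OF ce(1) q])
  have qc: "q \<in> img c" using q by blast
  have dG': "G' differentiable (at (coord c c' q))"
    unfolding G'_def by (rule smooth_onD[OF smooth_on_of_real[OF adD(9)[OF ce(2)] g_smooth[OF ce(2)]] q'])
  have dGt: "(\<lambda>p. G' (coord c c' p)) differentiable (at q)"
    using differentiable_chain_at[OF cholomorphic_onD(1)[OF coord_cholo[OF ce] q] dG'] by (simp add: o_def)
  have dm: "?m differentiable (at q)" "(\<lambda>p. cnj (?m p)) differentiable (at q)"
    "(\<lambda>p. ?m p * cnj (?m p)) differentiable (at q)"
    using smooth_onD[OF sm q] smooth_onD[OF smooth_on_cnj[OF op sm] q]
      smooth_onD[OF smooth_on_mult[OF op sm smooth_on_cnj[OF op sm]] q] by auto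
  have 1: "wirt_bar (1, 0) G q = dlg c q * G q"
    using wirt_ln[OF smooth_onD[OF g_smooth[OF ce(1)] qc] g_pos[OF ce(1) qc]]
    by (simp add: dlg_def lg_def[abs_def] G_def[abs_def])
  have 2: "wirt_bar (1, 0) G' (coord c c' q) = dlg c' (coord c c' q) * G' (coord c c' q)"
    using wirt_ln[OF smooth_onD[OF g_smooth[OF ce(2)] q'] g_pos[OF ce(2) q']]
    by (simp add: dlg_def lg_def[abs_def] G'_def[abs_def])
  have "wirt_bar (1, 0) G q = wirt_bar (1, 0) (\<lambda>p. ?m p * cnj (?m p) * G' (coord c c' p)) q"
    by (rule wirt_cong_open(2)[OF op q]) (simp only: G_def G'_def g_trans(1)[OF ce])
  also have "\<dots> = (?m q * cnj (wirt (1, 0) ?m q)) * G' (coord c c' q)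
      + ?m q * cnj (?m q) * (cnj (?m q) * (dlg c' (coord c c' q) * G' (coord c c' q)))"
    using wirt_mult(2)[OF dm(3) dGt, of "(1, 0)"] wirt_mult(2)[OF dm(1,2), of "(1, 0)"]
      wirt_cnj(2)[OF dm(1), of "(1, 0)"] cholomorphic_on_wirt(2)[OF hm q, of "(1, 0)"]
      wirt_coord(2)[OF ce q dG'] 2 by simp
  finally have "dlg c q * (?m q * cnj (?m q) * G' (coord c c' q)) = (?m q * cnj (wirt (1, 0) ?m q)) * G' (coord c c' q)
      + ?m q * cnj (?m q) * (cnj (?m q) * (dlg c' (coord c c' q) * G' (coord c c' q)))"
    using 1 g_trans(1)[OF ce q] by (simp add: G_def G'_def)
  then have "(?m q * G' (coord c c' q)) * (cnj (?m q) * dlg c q) = (?m q * G' (coord c c' q)) *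
      (cnj (wirt (1, 0) ?m q) + cnj (?m q) * cnj (?m q) * dlg c' (coord c c' q))"
    by (simp add: algebra_simps)
  moreover have "?m q * G' (coord c c' q) \<noteq> 0"
    using g_trans(2)[OF ce q] g_pos[OF ce(2) q'] by (simp add: G'_def)
  ultimately show ?thesis by (simp only: mult_cancel_left) simp
qed

text \<open>The horizontal lifts computed in two adapted charts are related by the
  differential of the coordinate change.\<close>

lemma lift_coord:
  assumes ce: "(c, e) \<in> ad" "(c', e') \<in> ad" and q: "q \<in> ovl c c'"
  shows "lift c' (dbase e e' q v) (coord c c' q) =
    wirt (1, 0) (ztrans c c') q * lift c v q + wirt (0, v) (ztrans c c') q"
proof -
  let ?m = "wirt (1, 0) (ztrans c c')"
  note op = open_ovl[OF ce]
  have hm: "cholomorphic_on ?m (ovl c c')" by (rule cholomorphic_on_wirt_cholomorphic[OF ztrans_cholo[OF ce] op])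
  have hmm: "cholomorphic_on (wirt (1, 0) ?m) (ovl c c')" by (rule cholomorphic_on_wirt_cholomorphic[OF hm op])
  have sm: "smooth_on ?m (ovl c c')" "smooth_on (wirt (1, 0) ?m) (ovl c c')"
    using cholomorphic_on_imp_smooth_on[OF hm op] cholomorphic_on_imp_smooth_on[OF hmm op] .
  note scm = smooth_on_cnj[OF op sm(1)] smooth_on_cnj[OF op sm(2)]
  have q': "coord c c' q \<in> img c'" by (rule coord_mem[OF ce(1) q])
  have qc: "q \<in> img c" using q by blast
  have dL: "dlg c differentiable (at q)" by (rule smooth_onD[OF dlg_smooth[OF ce(1)] qc])
  have dL': "dlg c' differentiable (at (coord c c' q))" by (rule smooth_onD[OF dlg_smooth[OF ce(2)] q'])
  have dLt: "(\<lambda>p. dlg c' (coord c c' p)) differentiable (at q)"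
    using differentiable_chain_at[OF cholomorphic_onD(1)[OF coord_cholo[OF ce] q] dL'] by (simp add: o_def)
  have d: "(\<lambda>p. cnj (?m p)) differentiable (at q)" "(\<lambda>p. cnj (wirt (1, 0) ?m p)) differentiable (at q)"
    "(\<lambda>p. cnj (?m p) * cnj (?m p)) differentiable (at q)"
    using smooth_onD[OF scm(1) q] smooth_onD[OF scm(2) q] smooth_onD[OF smooth_on_mult[OF op scm(1) scm(1)] q] by auto
  have d2: "(\<lambda>p. cnj (?m p) * cnj (?m p) * dlg c' (coord c c' p)) differentiable (at q)"
    by (rule differentiable_mult[OF d(3) dLt])
  \<comment> \<open>Conjugates of holomorphic functions are annihilated by \<open>wirt\<close>, so
    in \<open>dlg_trans\<close> the derivative along the base acts only on the two occurrences of L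
    and L'.\<close>
  have z: "wirt (0, v) (\<lambda>p. cnj (?m p)) q = 0" "wirt (0, v) (\<lambda>p. cnj (wirt (1, 0) ?m p)) q = 0"
    using wirt_cnj(1)[OF cholomorphic_onD(1)[OF hm q], of "(0, v)"] wirt_cnj(1)[OF cholomorphic_onD(1)[OF hmm q], of "(0, v)"]
      cholomorphic_on_wirt(2)[OF hm q] cholomorphic_on_wirt(2)[OF hmm q] by simp_all
  let ?n = "wirt (0, v) (ztrans c c') q" and ?W = "wirt (0, dbase e e' q v) (dlg c') (coord c c' q)"
  have "cnj (?m q) * wirt (0, v) (dlg c) q = wirt (0, v) (\<lambda>p. cnj (?m p) * dlg c p) q"
    using wirt_mult(1)[OF d(1) dL, of "(0, v)"] z by simp
  also have "\<dots> = wirt (0, v) (\<lambda>p. cnj (wirt (1, 0) ?m p) + cnj (?m p) * cnj (?m p) * dlg c' (coord c c' p)) q"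
    by (rule wirt_cong_open(1)[OF op q dlg_trans[OF ce]])
  also have "\<dots> = cnj (?m q) * cnj (?m q) * wirt (0, v) (\<lambda>p. dlg c' (coord c c' p)) q"
    using wirt_add(1)[OF d(2) d2, of "(0, v)"] wirt_mult(1)[OF d(3) dLt, of "(0, v)"]
      wirt_mult(1)[OF d(1) d(1), of "(0, v)"] z by simp
  \<comment> \<open>A base direction acquires the vertical part \<open>?n\<close> under the
    coordinate change, and Liouville's equation turns the vertical derivative of L' into the metric
    coefficient. After division by \<open>g\<close> this is the inhomogeneous term of the
    law.\<close>
  also have "wirt (0, v) (\<lambda>p. dlg c' (coord c c' p)) q = ?n * of_real (g c' (coord c c' q)) + ?W"
    using wirt_coord(1)[OF ce q dL', of 0 v] liouville[OF ce(2) q'] by simp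
  finally have "cnj (?m q) * wirt (0, v) (dlg c) q =
      cnj (?m q) * (cnj (?m q) * (?n * of_real (g c' (coord c c' q)) + ?W))" by (simp only: mult.assoc)
  then have "wirt (0, v) (dlg c) q = cnj (?m q) * (?n * of_real (g c' (coord c c' q)) + ?W)"
    using g_trans(2)[OF ce q] by simp
  then show ?thesis
    unfolding lift_def g_trans(1)[OF ce q] using g_trans(2)[OF ce q] g_pos[OF ce(2) q']
    by (simp add: field_simps)
qed

end

section \<open>The push-forward of the horizontal lift\<close>

context covering_family
begin

definition B :: "('x, complex \<times> 'e) chart \<Rightarrow> ('y, complex) chart \<Rightarrow> complex \<times> 'e \<Rightarrow> complex" where
  "B c d = snd d \<circ> \<beta> \<circ> chart_inv c"

abbreviation "bdom c d \<equiv> snd c ` (points X \<inter> fst c \<inter> \<beta> -` fst d)"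

lemma B_chart: "(c, e) \<in> ad \<Longrightarrow> x \<in> fst c \<Longrightarrow> B c d (snd c x) = snd d (\<beta> x)"
  by (simp add: B_def adD)

lemma dom_mem: "(c, e) \<in> ad \<Longrightarrow> x \<in> fst c \<Longrightarrow> \<beta> x \<in> fst d \<Longrightarrow> snd c x \<in> bdom c d"
  using adD(7)[of c e x] by blast

lemma open_dom: "(c, e) \<in> ad \<Longrightarrow> d \<in> atlas Y \<Longrightarrow> open (bdom c d)"
  by (rule open_chart_preimage[OF X Y \<beta>]) (simp_all add: adD)

lemma B_cholo: "(c, e) \<in> ad \<Longrightarrow> d \<in> atlas Y \<Longrightarrow> cholomorphic_on (B c d) (bdom c d)"
  unfolding B_def
  by (rule cholomorphic_on_subset[OF holomorphic_map_charts[OF X Y \<beta>]]) (use adD in blast)+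

lemma B_differentiable:
  "(c, e) \<in> ad \<Longrightarrow> d \<in> atlas Y \<Longrightarrow> x \<in> fst c \<Longrightarrow> \<beta> x \<in> fst d \<Longrightarrow> B c d differentiable (at (snd c x))"
  by (rule cholomorphic_onD(1)[OF B_cholo dom_mem])

lemma wirt_B_cholo: "(c, e) \<in> ad \<Longrightarrow> d \<in> atlas Y \<Longrightarrow> cholomorphic_on (wirt v (B c d)) (bdom c d)"
  by (rule cholomorphic_on_wirt_cholomorphic[OF B_cholo open_dom])

section \<open>Behaviour of the derivatives of \<beta> under changes of charts\<close>

lemma wirt_split:
  fixes F :: "complex \<times> 'e \<Rightarrow> complex"
  assumes "F differentiable (at q)"
  shows "wirt (z, w) F q = z * wirt (1, 0) F q + wirt (0, w) F q"
proof -
  have "(z, w) = cmul z (1, 0) + (0, w)" by simp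
  then show ?thesis by (simp only: wirt_vec_add[OF assms] wirt_cmul[OF assms])
qed

lemma wirt_B_coord:
  assumes ce: "(c, e) \<in> ad" "(c', e') \<in> ad" and d: "d \<in> atlas Y"
    and x: "x \<in> fst c" "x \<in> fst c'" "\<beta> x \<in> fst d"
  shows "wirt (v, w) (B c d) (snd c x) = wirt (v, w) (ztrans c c') (snd c x) * wirt (1, 0) (B c' d) (snd c' x)
    + wirt (0, dbase e e' (snd c x) w) (B c' d) (snd c' x)"
proof -
  have q: "snd c x \<in> ovl c c'" using x by blast
  have "wirt (v, w) (B c d) (snd c x) = wirt (v, w) (\<lambda>q. B c' d (coord c c' q)) (snd c x)"
  proof (rule wirt_cong_open(1)[OF open_ovl[OF ce] q])
    fix p assume "p \<in> ovl c c'"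
    then obtain y where y: "y \<in> fst c" "y \<in> fst c'" "p = snd c y" by blast
    then show "B c d p = B c' d (coord c c' p)"
      using B_chart[OF ce(1) y(1)] B_chart[OF ce(2) y(2)] coord_chart[OF ce(1) y(1)] by simp
  qed
  also have "\<dots> = wirt (v, w) (ztrans c c') (snd c x) * wirt (1, 0) (B c' d) (coord c c' (snd c x))
    + wirt (0, dbase e e' (snd c x) w) (B c' d) (coord c c' (snd c x))"
    by (rule wirt_coord(1)[OF ce q]) (simp add: coord_chart[OF ce(1) x(1)] B_differentiable[OF ce(2) d x(2,3)])
  finally show ?thesis by (simp only: coord_chart[OF ce(1) x(1)])
qed

lemma wirt_B_target:
  assumes ce: "(c, e) \<in> ad" and d: "d \<in> atlas Y" "d' \<in> atlas Y"
    and x: "x \<in> fst c" "\<beta> x \<in> fst d" "\<beta> x \<in> fst d'"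
  shows "wirt v (B c d') (snd c x) = transition d d' (\<beta> x) * wirt v (B c d) (snd c x)"
proof -
  note t = transition_wirt[OF Y d x(2,3)]
  note q = dom_mem[OF ce x(1,2)]
  have bq: "B c d (snd c x) = snd d (\<beta> x)" by (rule B_chart[OF ce x(1)])
  have dF: "(snd d' \<circ> chart_inv d) differentiable (at (B c d (snd c x)))"
    unfolding bq using t(2) field_differentiable_def field_differentiable_imp_differentiable by blast
  have "wirt v (B c d') (snd c x) = wirt v (\<lambda>q. (snd d' \<circ> chart_inv d) (B c d q)) (snd c x)"
  proof (rule wirt_cong_open(1)[OF open_dom[OF ce d(1)] q])
    fix p assume "p \<in> bdom c d"
    then obtain y where y: "y \<in> fst c" "\<beta> y \<in> fst d" "p = snd c y" by blast
    then show "B c d' p = (snd d' \<circ> chart_inv d) (B c d p)"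
      using B_chart[OF ce y(1)] chart_inv_left[OF atlas_is_chart[OF Y d(1)] y(2)] by simp
  qed
  also have "\<dots> = wirt (frechet_derivative (B c d) (at (snd c x)) v) (snd d' \<circ> chart_inv d) (B c d (snd c x))"
    by (rule wirt_comp(1)[OF cholomorphic_onD(2,3)[OF B_cholo[OF ce d(1)] q] dF])
  also have "\<dots> = wirt (cmul (wirt v (B c d) (snd c x)) 1) (snd d' \<circ> chart_inv d) (B c d (snd c x))"
    by (simp add: cholomorphic_on_wirt(1)[OF B_cholo[OF ce d(1)] q])
  also have "\<dots> = wirt v (B c d) (snd c x) * transition d d' (\<beta> x)"
    using wirt_cmul(1)[OF dF, of "wirt v (B c d) (snd c x)" 1] by (simp only: t(1) bq)
  finally show ?thesis by (simp only: mult.commute)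
qed

end

section \<open>The fiber over one point and one tangent vector of the base\<close>

locale covering_family_at = covering_family X S Y f \<beta> h
  for X :: "('x, complex \<times> 'e::complex_euclidean) manifold" and S :: "('s, 'e) manifold"
    and Y :: "('y, complex) manifold" and f :: "'x \<Rightarrow> 's" and \<beta> :: "'x \<Rightarrow> 'y"
    and h :: "'s \<Rightarrow> ('x, complex) chart \<Rightarrow> 'x \<Rightarrow> real" +
  fixes s :: 's and \<xi> :: "('s, 'e) chart \<Rightarrow> 'e"
  assumes s: "s \<in> points S" and \<xi>: "tangent_vector S s \<xi>"
begin

abbreviation "R \<equiv> fiber X S f s"
abbreviation "k \<equiv> fc s"

lemma R: "complex_manifold R" by (rule fib[OF s])

lemma k_mem:
  assumes "(c, e) \<in> ad" "x \<in> fst (k c)"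
  shows "x \<in> fst c" "f x = s" "s \<in> fst e" "snd c x = (snd (k c) x, snd e s)"
  using assms fc_mem[OF assms(1)] adD(5)[OF assms(1)] snd_c_eq[OF assms] by auto

lemma k_chart_inv: "(c, e) \<in> ad \<Longrightarrow> x \<in> fst (k c) \<Longrightarrow> chart_inv (k c) (snd (k c) x) = x"
  by (rule chart_inv_left[OF atlas_is_chart[OF R fc_atlas]])

lemma slice_mem: "(c, e) \<in> ad \<Longrightarrow> snd (k c) ` fst (k c) \<subseteq> {p. (p, snd e s) \<in> img c}"
  using k_mem by (smt (verit) image_subset_iff mem_Collect_eq image_eqI)

lemma slice_dom_mem:
  assumes "(c, e) \<in> ad"
  shows "snd (k c) ` (fst (k c) \<inter> \<beta> -` fst d) \<subseteq> {p. (p, snd e s) \<in> bdom c d}"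
proof
  fix p assume "p \<in> snd (k c) ` (fst (k c) \<inter> \<beta> -` fst d)"
  then obtain x where x: "x \<in> fst (k c)" "\<beta> x \<in> fst d" "p = snd (k c) x" by blast
  show "p \<in> {p. (p, snd e s) \<in> bdom c d}"
    using dom_mem[OF assms k_mem(1)[OF assms x(1)] x(2)] k_mem(4)[OF assms x(1)] x(3) by simp
qed

lemma open_k_section:
  assumes ce: "(c, e) \<in> ad" and d: "d \<in> atlas Y"
  shows "open (snd (k c) ` (fst (k c) \<inter> \<beta> -` fst d))"
proof -
  have d': "openin (mtop Y) (fst d)" using atlas_is_chart[OF Y d] by (simp add: is_chart_def)
  have "openin (mtop R) (fiber_set X f s \<inter> (points X \<inter> \<beta> -` fst d))"
    unfolding fiber_def manifold.select_convs
    using holomorphic_map_preimage_open[OF \<beta> d'] by (auto simp: openin_subtopology)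
  from chart_open_image[OF atlas_is_chart[OF R fc_atlas[OF ce]] this]
  have "open (snd (k c) ` ((fiber_set X f s \<inter> (points X \<inter> \<beta> -` fst d)) \<inter> fst (k c)))" .
  moreover have "(fiber_set X f s \<inter> (points X \<inter> \<beta> -` fst d)) \<inter> fst (k c) = fst (k c) \<inter> \<beta> -` fst d"
    by (auto simp: fiber_chart_def fiber_set_def)
  ultimately show ?thesis by simp
qed

lemma fiber_map_eq:
  assumes "(c, e) \<in> ad" "p \<in> snd (k c) ` (fst (k c) \<inter> \<beta> -` fst d)"
  shows "(snd d \<circ> \<beta> \<circ> chart_inv (k c)) p = B c d (p, snd e s)"
proof -
  obtain x where x: "x \<in> fst (k c)" "p = snd (k c) x" using assms(2) by blast
  show ?thesis
    using k_chart_inv[OF assms(1) x(1)] B_chart[OF assms(1) k_mem(1)[OF assms(1) x(1)], of d] k_mem(4)[OF assms(1) x(1)] x(2)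
    by simp
qed

lemma holomorphic_map_fiber: "holomorphic_map R Y \<beta>"
  unfolding holomorphic_map_def
proof (intro conjI ballI)
  show "continuous_map (mtop R) (mtop Y) \<beta>"
    using \<beta> unfolding fiber_def holomorphic_map_def manifold.select_convs
    by (blast intro: continuous_map_from_subtopology)
  fix k' d assume "k' \<in> atlas R" and d: "d \<in> atlas Y"
  then obtain c e where ce: "(c, e) \<in> ad" "k' = k c" by (elim atlas_fiberE)
  show "cholomorphic_on (snd d \<circ> \<beta> \<circ> chart_inv k') (snd k' ` (fst k' \<inter> \<beta> -` fst d))"
    unfolding ce(2)
  proof (rule cholomorphic_on_cong[OF open_k_section[OF ce(1) d]])
    show "cholomorphic_on (\<lambda>p. B c d (p, snd e s)) (snd (k c) ` (fst (k c) \<inter> \<beta> -` fst d))"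
      by (rule cholomorphic_on_subset[OF cholomorphic_on_slice[OF B_cholo[OF ce(1) d]] slice_dom_mem[OF ce(1)]])
  qed (rule fiber_map_eq[OF ce(1), symmetric])
qed

sublocale rsm: riemann_surface_map R Y \<beta>
  by unfold_locales (rule R Y holomorphic_map_fiber)+

lemma push_fiber:
  assumes ce: "(c, e) \<in> ad" and d: "d \<in> atlas Y" and x: "x \<in> fst (k c)" "\<beta> x \<in> fst d"
  shows "push \<beta> (k c) d x t = wirt (1, 0) (B c d) (snd c x) * t"
proof -
  have px: "snd (k c) x \<in> snd (k c) ` (fst (k c) \<inter> \<beta> -` fst d)" using x by blast
  note q = k_mem(4)[OF ce x(1)]
  have "wirt 1 (snd d \<circ> \<beta> \<circ> chart_inv (k c)) (snd (k c) x) = wirt 1 (\<lambda>p. B c d (p, snd e s)) (snd (k c) x)"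
    by (rule wirt_cong_open(1)[OF open_k_section[OF ce d] px fiber_map_eq[OF ce]])
  also have "\<dots> = wirt (1, 0) (B c d) (snd c x)"
    unfolding q by (rule wirt_slice(1)) (use B_differentiable[OF ce d k_mem(1)[OF ce x(1)] x(2)] q in simp)
  finally show ?thesis
    using rsm.push_wirt[OF fc_atlas[OF ce] d x] by simp
qed

lemma dbase_\<xi>:
  assumes ce: "(c, e) \<in> ad" "(c', e') \<in> ad" and "s \<in> fst e" "s \<in> fst e'" "snd q = snd e s"
  shows "dbase e e' q (\<xi> e) = \<xi> e'"
proof -
  have "\<xi> e' = frechet_derivative (snd e' \<circ> chart_inv e) (at (snd e s)) (\<xi> e)"
    using \<xi> adD(2)[OF ce(1)] adD(2)[OF ce(2)] assms(3,4) unfolding tangent_vector_def by blast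
  then show ?thesis unfolding dbase_def assms(5) by (rule sym)
qed

text \<open>The coefficient \<open>a\<close> of the overview on the fiber over \<open>s\<close>. The
  base chart \<open>e\<close> is an argument because both the component of \<xi> and the coordinate
  of \<open>s\<close> depend on it.\<close>

definition vlift :: "('x, complex \<times> 'e) chart \<Rightarrow> ('s, 'e) chart \<Rightarrow> complex \<Rightarrow> complex" where
  "vlift c e p = lift c (\<xi> e) (p, snd e s)"

definition u :: "('y, complex) chart \<Rightarrow> 'x \<Rightarrow> complex" where
  "u = push_horizontal_lift X S f \<beta> h \<xi>"

definition sec :: "('x, complex \<times> 'e) chart \<Rightarrow> ('s, 'e) chart \<Rightarrow> ('y, complex) chart \<Rightarrow> 'x \<Rightarrow> complex" where
  "sec c e d y = wirt (0, \<xi> e) (B c d) (snd c y)"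

text \<open>The lifts in two adapted charts correspond under the differential of the coordinate
  change by \<open>lift_coord\<close> and \<open>dbase_\<xi>\<close>. Hence the chain rule for
  \<beta> carries one candidate value into the other, and \<open>common_value\<close> may be
  computed in any adapted chart around \<open>x\<close>.\<close>

lemma u_eq:
  assumes ce: "(c, e) \<in> ad" and x: "x \<in> fst (k c)" and d: "d \<in> atlas Y" "\<beta> x \<in> fst d"
  shows "u d x = vlift c e (snd (k c) x) * wirt (1, 0) (B c d) (snd c x) + sec c e d x"
proof -
  let ?F = "\<lambda>(c, e). wirt (horizontal_lift X f h \<xi> c e x) (snd d \<circ> \<beta> \<circ> chart_inv c) (snd c x)"
  have F: "?F (c, e) = lift c (\<xi> e) (snd c x) * wirt (1, 0) (B c d) (snd c x) + wirt (0, \<xi> e) (B c d) (snd c x)"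
    if "(c, e) \<in> ad" "x \<in> fst c" for c e
    using wirt_split[OF B_differentiable[OF that(1) d(1) that(2) d(2)], of "lift c (\<xi> e) (snd c x)" "\<xi> e"]
    by (simp add: horizontal_lift_eq B_def)
  note xc = k_mem[OF ce x]
  have "u d x = ?F (c, e)"
    unfolding u_def push_horizontal_lift_def
  proof (rule common_value_eq)
    show "(c, e) \<in> {(c, e) \<in> ad. x \<in> fst c}" using ce xc by blast
    fix j assume "j \<in> {(c, e) \<in> ad. x \<in> fst c}"
    then obtain c' e' where j: "j = (c', e')" and ce': "(c', e') \<in> ad" and x': "x \<in> fst c'" by blast
    have se': "s \<in> fst e'" using adD(5)[OF ce' x'] xc by simp
    have dx: "dbase e e' (snd c x) (\<xi> e) = \<xi> e'"
      by (rule dbase_\<xi>[OF ce ce' xc(3) se']) (simp add: xc(4))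
    have q: "snd c x \<in> ovl c c'" using xc x' by blast
    have zt: "ztrans c c' differentiable (at (snd c x))"
      by (rule cholomorphic_onD(1)[OF ztrans_cholo[OF ce ce'] q])
    have "?F (c, e) = wirt (lift c (\<xi> e) (snd c x), \<xi> e) (B c d) (snd c x)"
      by (simp add: horizontal_lift_eq B_def)
    also have "\<dots> = lift c' (\<xi> e') (snd c' x) * wirt (1, 0) (B c' d) (snd c' x) + wirt (0, \<xi> e') (B c' d) (snd c' x)"
      using wirt_B_coord[OF ce ce' d(1) xc(1) x' d(2), of "lift c (\<xi> e) (snd c x)" "\<xi> e"]
        lift_coord[OF ce ce' q, of "\<xi> e"] wirt_split[OF zt, of "lift c (\<xi> e) (snd c x)" "\<xi> e"]
        dx coord_chart[OF ce xc(1), of c'] by (simp add: mult.commute)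
    also have "\<dots> = ?F (c', e')" by (rule F[OF ce' x', symmetric])
    finally show "?F j = ?F (c, e)" unfolding j by (rule sym)
  qed
  then show ?thesis unfolding F[OF ce xc(1)] by (simp add: sec_def vlift_def xc(4))
qed

lemma vlift_smooth: "(c, e) \<in> ad \<Longrightarrow> smooth_on (vlift c e) (snd (k c) ` fst (k c))"
  unfolding vlift_def[abs_def]
  by (rule smooth_on_subset[OF smooth_on_slice[OF adD(9) lift_smooth] slice_mem])

lemma open_k: "(c, e) \<in> ad \<Longrightarrow> open (snd (k c) ` fst (k c))"
  using atlas_is_chart[OF R fc_atlas] by (simp add: is_chart_def)

text \<open>In a' = \<phi>_z a + \<phi>_s both \<phi>_z and \<phi>_s are holomorphic on the slice,
  so dbar removes the inhomogeneous term and leaves \<phi>_z times dbar \<open>a\<close>. On the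
  left the chain rule produces the conjugate of the transition function; together this is the tensor
  law.\<close>

lemma wirt_bar_vlift_trans:
  assumes ce: "(c, e) \<in> ad" "(c', e') \<in> ad" and x: "x \<in> fst (k c)" "x \<in> fst (k c')"
  shows "wirt_bar 1 (vlift c' e') (snd (k c') x) =
    transition (k c) (k c') x / cnj (transition (k c) (k c') x) * wirt_bar 1 (vlift c e) (snd (k c) x)"
proof -
  let ?V = "snd (k c) ` (fst (k c') \<inter> fst (k c))"
  let ?\<tau> = "snd (k c') \<circ> chart_inv (k c)"
  let ?T = "transition (k c) (k c') x"
  let ?p = "snd (k c) x"
  let ?m = "\<lambda>p. wirt (1, 0) (ztrans c c') (p, snd e s)" and ?n = "\<lambda>p. wirt (0, \<xi> e) (ztrans c c') (p, snd e s)"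
  note op = open_fiber_ovl[OF ce x] and tr = fiber_trans[OF ce x]
  have px: "?p \<in> ?V" using x by blast
  have q: "snd c x = (?p, snd e s)" by (rule k_mem(4)[OF ce(1) x(1)])
  have dx: "dbase e e' (p, snd e s) (\<xi> e) = \<xi> e'" for p
    by (rule dbase_\<xi>[OF ce k_mem(3)[OF ce(1) x(1)] k_mem(3)[OF ce(2) x(2)]]) simp
  have eq: "vlift c' e' (?\<tau> p) = ?m p * vlift c e p + ?n p" if p: "p \<in> ?V" for p
    using lift_coord[OF ce conjunct1[OF tr[OF p]], of "\<xi> e"] tr[OF p] by (simp add: vlift_def dx)
  have hol: "cholomorphic_on ?m ?V" "cholomorphic_on ?n ?V"
    using tr by (auto intro!: cholomorphic_on_subset[OF cholomorphic_on_slice[OF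
      cholomorphic_on_wirt_cholomorphic[OF ztrans_cholo[OF ce] open_ovl[OF ce]]]])
  have da: "vlift c e differentiable (at ?p)"
    by (rule smooth_onD[OF vlift_smooth[OF ce(1)]]) (use x in blast)
  have \<tau>x: "?\<tau> ?p = snd (k c') x" using k_chart_inv[OF ce(1) x(1)] by simp
  have da': "vlift c' e' differentiable (at (?\<tau> ?p))"
    unfolding \<tau>x by (rule smooth_onD[OF vlift_smooth[OF ce(2)]]) (use x in blast)
  have d\<tau>: "(?\<tau> has_derivative (*) ?T) (at ?p)"
    using transition_wirt(2)[OF R fc_atlas[OF ce(1)] fc_atlas[OF ce(2)] x] by (simp add: has_field_derivative_def)
  have "wirt_bar 1 (\<lambda>p. vlift c' e' (?\<tau> p)) ?p = wirt_bar (?T * 1) (vlift c' e') (?\<tau> ?p)"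
    by (rule wirt_comp(2)[OF d\<tau> _ da']) simp
  also have "\<dots> = cnj ?T * wirt_bar 1 (vlift c' e') (snd (k c') x)"
    using wirt_cmul(2)[OF da', of ?T 1] by (simp only: cmul_complex \<tau>x)
  finally have 1: "wirt_bar 1 (\<lambda>p. vlift c' e' (?\<tau> p)) ?p = cnj ?T * wirt_bar 1 (vlift c' e') (snd (k c') x)" .
  have dma: "(\<lambda>p. ?m p * vlift c e p) differentiable (at ?p)"
    by (rule differentiable_mult[OF cholomorphic_onD(1)[OF hol(1) px] da])
  have "wirt_bar 1 (\<lambda>p. vlift c' e' (?\<tau> p)) ?p = wirt_bar 1 (\<lambda>p. ?m p * vlift c e p + ?n p) ?p"
    by (rule wirt_cong_open(2)[OF op px eq])
  also have "\<dots> = ?m ?p * wirt_bar 1 (vlift c e) ?p"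
    using wirt_add(2)[OF dma cholomorphic_onD(1)[OF hol(2) px], of 1]
      wirt_mult(2)[OF cholomorphic_onD(1)[OF hol(1) px] da, of 1]
      cholomorphic_on_wirt(2)[OF hol(1) px, of 1] cholomorphic_on_wirt(2)[OF hol(2) px, of 1] by simp
  also have "?m ?p = ?T" using fiber_transition[OF ce x] q by simp
  finally have "cnj ?T * wirt_bar 1 (vlift c' e') (snd (k c') x) = ?T * wirt_bar 1 (vlift c e) ?p"
    using 1 by simp
  moreover have "?T \<noteq> 0" using fiber_transition[OF ce x] g_trans(2)[OF ce snd_c_mem[OF ce x]] by simp
  ultimately show ?thesis by (simp add: field_simps)
qed

text \<open>A chart of the fiber does not determine the adapted chart that it comes from, hence the choice.\<close>

definition \<theta> :: "('x, complex) chart \<Rightarrow> 'x \<Rightarrow> complex" where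
  "\<theta> j x = (case SOME (c, e). (c, e) \<in> ad \<and> k c = j of (c, e) \<Rightarrow> wirt_bar 1 (vlift c e) (snd j x))"

text \<open>Whatever pair is chosen, its fiber chart is \<open>k c\<close>; the transition from a
  chart to itself is 1, so the transformation law says that both pairs give the same value.\<close>

lemma \<theta>_eq:
  assumes ce: "(c, e) \<in> ad" and x: "x \<in> fst (k c)"
  shows "\<theta> (k c) x = wirt_bar 1 (vlift c e) (snd (k c) x)"
proof -
  obtain c' e' where so: "(SOME (c', e'). (c', e') \<in> ad \<and> k c' = k c) = (c', e')"
    using prod.exhaust by blast
  have "case (SOME (c', e'). (c', e') \<in> ad \<and> k c' = k c) of (c', e') \<Rightarrow> (c', e') \<in> ad \<and> k c' = k c"
    by (rule someI[of _ "(c, e)"]) (use ce in simp)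
  then have ce': "(c', e') \<in> ad" "k c' = k c" unfolding so by auto
  have "wirt_bar 1 (vlift c' e') (snd (k c) x) = wirt_bar 1 (vlift c e) (snd (k c) x)"
    using wirt_bar_vlift_trans[OF ce ce'(1), of x] x ce'(2) transition_refl[OF R fc_atlas[OF ce] x] by simp
  then show ?thesis by (simp add: \<theta>_def so)
qed

lemma \<theta>_smooth_form: "smooth_T01_form R \<theta>"
  unfolding smooth_T01_form_def
proof (intro conjI ballI)
  fix j j' x assume j: "j \<in> atlas R" "j' \<in> atlas R" and x: "x \<in> fst j \<inter> fst j'"
  obtain c e where ce: "(c, e) \<in> ad" "j = k c" using j(1) by (elim atlas_fiberE)
  obtain c' e' where ce': "(c', e') \<in> ad" "j' = k c'" using j(2) by (elim atlas_fiberE)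
  show "\<theta> j' x = transition j j' x / cnj (transition j j' x) * \<theta> j x"
    using wirt_bar_vlift_trans[OF ce(1) ce'(1), of x] \<theta>_eq[OF ce(1), of x] \<theta>_eq[OF ce'(1), of x] x
    unfolding ce(2) ce'(2) by simp
next
  fix j assume j: "j \<in> atlas R"
  then obtain c e where ce: "(c, e) \<in> ad" "j = k c" by (elim atlas_fiberE)
  show "smooth_on (\<theta> j \<circ> chart_inv j) (snd j ` fst j)"
    unfolding ce(2)
  proof (rule smooth_on_cong[OF smooth_on_wirt(2)[OF open_k[OF ce(1)] vlift_smooth[OF ce(1)]] open_k[OF ce(1)]])
    fix p assume "p \<in> snd (k c) ` fst (k c)"
    then obtain x where "x \<in> fst (k c)" "p = snd (k c) x" by blast
    then show "wirt_bar 1 (vlift c e) p = (\<theta> (k c) \<circ> chart_inv (k c)) p"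
      using \<theta>_eq[OF ce(1)] k_chart_inv[OF ce(1)] by simp
  qed
qed

text \<open>The zero field serves as the adjoint. Against a test function in a chart the L2 product
  is the integral of g \<theta> times the conjugate of a dbar derivative, and it vanishes by parts
  because \<open>lift_harmonic\<close> makes g \<theta> antiholomorphic along the fiber.\<close>

lemma \<theta>_harmonic: "\<theta> \<in> harmonic_T01_forms R (h s)"
proof -
  have "formal_adjoint_dbar R (h s) \<theta> (\<lambda>c x. 0)"
    unfolding formal_adjoint_dbar_def
  proof (intro ballI allI impI)
    fix j and \<kappa> :: "complex \<Rightarrow> complex"
    assume j: "j \<in> atlas R" and
      \<kappa>: "smooth_on \<kappa> UNIV \<and> compact (closure {p. \<kappa> p \<noteq> 0}) \<and> closure {p. \<kappa> p \<noteq> 0} \<subseteq> snd j ` fst j"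
    obtain c e where ce: "(c, e) \<in> ad" "j = k c" using j by (elim atlas_fiberE)
    let ?W = "snd (k c) ` fst (k c)"
    let ?H = "\<lambda>q. of_real (g c q) * wirt_bar (1, 0) (lift c (\<xi> e)) q"
    let ?G = "\<lambda>p. of_real (h s (k c) (chart_inv (k c) p)) * \<theta> (k c) (chart_inv (k c) p)"
    note op = open_k[OF ce(1)]
    have sH: "smooth_on ?H (img c)"
      by (intro smooth_on_mult smooth_on_of_real smooth_on_wirt adD(9)[OF ce(1)] g_smooth[OF ce(1)] lift_smooth[OF ce(1)])
    have inU: "(p, snd e s) \<in> img c" if "p \<in> ?W" for p using slice_mem[OF ce(1)] that by blast
    \<comment> \<open>The weighted form on the fiber is the slice of a function on the total space,
      which is where Liouville's equation was differentiated.\<close>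
    have G: "?G p = ?H (p, snd e s)" if p: "p \<in> ?W" for p
    proof -
      obtain x where x: "x \<in> fst (k c)" "p = snd (k c) x" using p by blast
      have "wirt_bar 1 (vlift c e) p = wirt_bar (1, 0) (lift c (\<xi> e)) (p, snd e s)"
        unfolding vlift_def[abs_def]
        by (rule wirt_slice(2)[OF smooth_onD[OF lift_smooth[OF ce(1)] inU[OF p]]])
      then show ?thesis
        using \<theta>_eq[OF ce(1) x(1)] k_chart_inv[OF ce(1) x(1)] g_chart[OF ce(1) k_mem(1)[OF ce(1) x(1)]]
          k_mem(2,4)[OF ce(1) x(1)] x(2) by simp
    qed
    have sl: "smooth_on (\<lambda>p. ?H (p, snd e s)) ?W"
      by (rule smooth_on_subset[OF smooth_on_slice[OF adD(9)[OF ce(1)] sH] slice_mem[OF ce(1)]])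
    have sG: "smooth_on ?G ?W" by (rule smooth_on_cong[OF sl op G[symmetric]])
    have "wirt 1 ?G p = 0" if p: "p \<in> ?W" for p
    proof -
      have "wirt 1 ?G p = wirt 1 (\<lambda>p. ?H (p, snd e s)) p" by (rule wirt_cong_open(1)[OF op p G])
      also have "\<dots> = wirt (1, 0) ?H (p, snd e s)" by (rule wirt_slice(1)[OF smooth_onD[OF sH inU[OF p]]])
      also have "\<dots> = 0" by (rule lift_harmonic[OF ce(1) inU[OF p]])
      finally show ?thesis .
    qed
    then have "(LINT p:?W|lborel. ?G p * cnj (wirt_bar 1 \<kappa> p)) = 0"
      using integral_by_parts_wirt_bar[OF op sG, of \<kappa>] \<kappa> unfolding ce(2) by blast
    then show "(LINT p:snd j ` fst j|lborel. of_real (h s j (chart_inv j p)) * \<theta> j (chart_inv j p) * cnj (wirt_bar 1 \<kappa> p)) =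
        (LINT p:snd j ` fst j|lborel. of_real ((h s j (chart_inv j p))\<^sup>2) * 0 * cnj (\<kappa> p))"
      unfolding ce(2) by simp
  qed
  moreover have "smooth_vector_field R (points R) (\<lambda>c x. 0)"
    by (simp add: smooth_vector_field_def o_def smooth_on_const)
  moreover have "dbar_vector_field R (points R) (\<lambda>c x. 0) (\<lambda>c x. 0)"
    by (simp add: dbar_vector_field_def o_def)
  ultimately show ?thesis
    unfolding harmonic_T01_forms_def using \<theta>_smooth_form by blast
qed

lemma u_slice:
  assumes ce: "(c, e) \<in> ad" and d: "d \<in> atlas Y" and p: "p \<in> snd (k c) ` (fst (k c) \<inter> \<beta> -` fst d)"
  shows "(u d \<circ> chart_inv (k c)) p =
    vlift c e p * wirt (1, 0) (B c d) (p, snd e s) + wirt (0, \<xi> e) (B c d) (p, snd e s)"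
proof -
  obtain x where x: "x \<in> fst (k c)" "\<beta> x \<in> fst d" "p = snd (k c) x" using p by blast
  show ?thesis
    using u_eq[OF ce x(1) d x(2)] k_chart_inv[OF ce x(1)] k_mem(4)[OF ce x(1)] x(3) by (simp add: sec_def)
qed

lemma wirt_B_slice_cholo:
  assumes ce: "(c, e) \<in> ad" and d: "d \<in> atlas Y"
  shows "cholomorphic_on (\<lambda>p. wirt v (B c d) (p, snd e s)) (snd (k c) ` (fst (k c) \<inter> \<beta> -` fst d))"
  by (rule cholomorphic_on_subset[OF cholomorphic_on_slice[OF wirt_B_cholo[OF ce d]] slice_dom_mem[OF ce]])

text \<open>On the slice both derivatives of \<beta> are holomorphic, so in the formula of
  \<open>u_slice\<close> dbar falls on the vertical coefficient alone.\<close>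

lemma u_dbar: "dbar_eq_push R Y \<beta> u \<theta>"
  unfolding dbar_eq_push_def
proof (intro ballI)
  fix j d x assume j: "j \<in> atlas R" and d: "d \<in> atlas Y" and x: "x \<in> fst j \<inter> \<beta> -` fst d"
  obtain c e where ce: "(c, e) \<in> ad" "j = k c" using j by (elim atlas_fiberE)
  let ?V = "snd (k c) ` (fst (k c) \<inter> \<beta> -` fst d)" and ?p = "snd (k c) x"
  have x': "x \<in> fst (k c)" "\<beta> x \<in> fst d" using x ce by auto
  have px: "?p \<in> ?V" using x' by blast
  have da: "vlift c e differentiable (at ?p)"
    by (rule smooth_onD[OF vlift_smooth[OF ce(1)]]) (use x' in blast)
  note hol = wirt_B_slice_cholo[OF ce(1) d, of "(1, 0)"] wirt_B_slice_cholo[OF ce(1) d, of "(0, \<xi> e)"]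
  note dh = cholomorphic_onD(1)[OF hol(1) px] cholomorphic_onD(1)[OF hol(2) px]
  have "wirt_bar 1 (u d \<circ> chart_inv (k c)) ?p =
      wirt_bar 1 (\<lambda>p. vlift c e p * wirt (1, 0) (B c d) (p, snd e s) + wirt (0, \<xi> e) (B c d) (p, snd e s)) ?p"
    by (rule wirt_cong_open(2)[OF open_k_section[OF ce(1) d] px u_slice[OF ce(1) d]])
  also have "\<dots> = wirt_bar 1 (vlift c e) ?p * wirt (1, 0) (B c d) (?p, snd e s)"
    using wirt_add(2)[OF differentiable_mult[OF da dh(1)] dh(2), of 1] wirt_mult(2)[OF da dh(1), of 1]
      cholomorphic_on_wirt(2)[OF hol(1) px, of 1] cholomorphic_on_wirt(2)[OF hol(2) px, of 1] by simp
  also have "\<dots> = push \<beta> (k c) d x (\<theta> (k c) x)"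
    using push_fiber[OF ce(1) d x'] \<theta>_eq[OF ce(1) x'(1)] k_mem(4)[OF ce(1) x'(1)] by (simp add: mult.commute)
  finally show "wirt_bar 1 (u d \<circ> chart_inv j) (snd j x) = push \<beta> j d x (\<theta> j x)"
    unfolding ce(2) .
qed

lemma points_R: "x \<in> points R \<Longrightarrow> \<exists>c e. (c, e) \<in> ad \<and> x \<in> fst (k c)"
  using R by (metis atlas_cover atlas_fiberE)

lemma R_Int_k: "(c, e) \<in> ad \<Longrightarrow> points R \<inter> fst (k c) = fst (k c)"
  using is_chart_subset[OF atlas_is_chart[OF R fc_atlas]] by blast

lemma u_smooth: "smooth_pb_section R Y \<beta> (points R) u"
  unfolding rsm.smooth_pb_section_iff
proof (intro conjI ballI rsm.pb_lawI)
  fix d d' x assume d: "d \<in> atlas Y" "d' \<in> atlas Y" and x: "x \<in> points R" "\<beta> x \<in> fst d" "\<beta> x \<in> fst d'"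
  obtain c e where ce: "(c, e) \<in> ad" "x \<in> fst (k c)" using points_R[OF x(1)] by blast
  show "u d' x = transition d d' (\<beta> x) * u d x"
    using u_eq[OF ce d(1) x(2)] u_eq[OF ce d(2) x(3)] wirt_B_target[OF ce(1) d k_mem(1)[OF ce] x(2,3)]
    by (simp add: sec_def algebra_simps)
next
  fix j d assume j: "j \<in> atlas R" and d: "d \<in> atlas Y"
  obtain c e where ce: "(c, e) \<in> ad" "j = k c" using j by (elim atlas_fiberE)
  let ?V = "snd (k c) ` (fst (k c) \<inter> \<beta> -` fst d)"
  note op = open_k_section[OF ce(1) d]
  have "smooth_on (\<lambda>p. vlift c e p * wirt (1, 0) (B c d) (p, snd e s) + wirt (0, \<xi> e) (B c d) (p, snd e s)) ?V"
    by (intro smooth_on_add smooth_on_mult op smooth_on_subset[OF vlift_smooth[OF ce(1)]]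
        cholomorphic_on_imp_smooth_on[OF wirt_B_slice_cholo[OF ce(1) d]]) blast
  then have "smooth_on (u d \<circ> chart_inv (k c)) ?V"
    by (rule smooth_on_cong[OF _ op u_slice[OF ce(1) d, symmetric]])
  then show "smooth_on (u d \<circ> chart_inv j) (snd j ` (points R \<inter> fst j \<inter> \<beta> -` fst d))"
    unfolding ce(2) R_Int_k[OF ce(1)] .
qed

lemma u_generalized_harmonic: "u \<in> generalized_harmonic R Y \<beta> (h s)"
  unfolding generalized_harmonic_def using u_smooth \<theta>_harmonic u_dbar by blast

section \<open>Comparison with the characteristic map\<close>

abbreviation "vf c e \<equiv> rsm.extend_vf (k c) (vlift c e)"

lemma vf_smooth: "(c, e) \<in> ad \<Longrightarrow> smooth_vector_field R (fst (k c)) (vf c e)"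
  by (rule rsm.smooth_extend_vf[OF fc_atlas vlift_smooth])

lemma vf_dbar: "(c, e) \<in> ad \<Longrightarrow> dbar_vector_field R (fst (k c)) (vf c e) \<theta>"
  by (rule rsm.dbar_extend_vf[OF fc_atlas vlift_smooth \<theta>_smooth_form \<theta>_eq[symmetric]])

lemma u_decomposition:
  assumes ce: "(c, e) \<in> ad" and d: "d \<in> atlas Y" and y: "y \<in> fst (k c)" "\<beta> y \<in> fst d"
  shows "u d y = sec c e d y + push_vector_field R \<beta> (vf c e) d y"
proof -
  have "rsm.vf_law (fst (k c)) (vf c e)" using vf_smooth[OF ce] by (simp add: rsm.smooth_vector_field_iff)
  from rsm.push_vector_field_eq[OF this y(1) fc_atlas[OF ce] y(1) d y(2)]
  have "push_vector_field R \<beta> (vf c e) d y = wirt (1, 0) (B c d) (snd c y) * vlift c e (snd (k c) y)"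
    unfolding push_fiber[OF ce d y] by (simp add: rsm.extend_vf_self[OF fc_atlas[OF ce] y(1)])
  then show ?thesis using u_eq[OF ce y(1) d y(2)] by simp
qed

text \<open>Holomorphy is demanded in every chart \<open>j\<close> of the fiber, while
  \<open>sec\<close> is manifestly holomorphic in the coordinate of \<open>k c\<close>; the
  holomorphic transition between the two charts is inserted.\<close>

lemma sec_holo:
  assumes ce: "(c, e) \<in> ad"
  shows "holo_pb_section R Y \<beta> (fst (k c)) (sec c e)"
  unfolding rsm.holo_pb_section_iff
proof (intro conjI ballI rsm.pb_lawI)
  fix d d' x assume d: "d \<in> atlas Y" "d' \<in> atlas Y" and x: "x \<in> fst (k c)" "\<beta> x \<in> fst d" "\<beta> x \<in> fst d'"
  show "sec c e d' x = transition d d' (\<beta> x) * sec c e d x"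
    unfolding sec_def by (rule wirt_B_target[OF ce d k_mem(1)[OF ce x(1)] x(2,3)])
next
  fix j d assume j: "j \<in> atlas R" and d: "d \<in> atlas Y"
  let ?V = "snd j ` (fst (k c) \<inter> fst j \<inter> \<beta> -` fst d)" and ?\<tau> = "snd (k c) \<circ> chart_inv j"
  note kc = fc_atlas[OF ce, of s]
  have op: "open ?V" by (rule rsm.open_section_domain[OF j d rsm.open_chart[OF kc]])
  have inv: "chart_inv j (snd j x) = x" if "x \<in> fst j" for x
    by (rule chart_inv_left[OF atlas_is_chart[OF R j] that])
  have "cholomorphic_on ?\<tau> (snd j ` (fst j \<inter> fst (k c)))"
    by (rule charts_compatible[OF R rsm.atlas_charts(1)[OF j] rsm.atlas_charts(1)[OF kc]])
  then have \<tau>: "cholomorphic_on ?\<tau> ?V" by (rule cholomorphic_on_subset) blast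
  have im: "?\<tau> ` ?V \<subseteq> snd (k c) ` (fst (k c) \<inter> \<beta> -` fst d)" using inv by auto
  have "cholomorphic_on (sec c e d \<circ> chart_inv j) ?V"
  proof (rule cholomorphic_on_cong[OF op _ cholomorphic_on_compose[OF \<tau> wirt_B_slice_cholo[OF ce d] im]])
    fix p assume "p \<in> ?V"
    then obtain x where "x \<in> fst (k c)" "x \<in> fst j" "p = snd j x" by blast
    then show "wirt (0, \<xi> e) (B c d) (?\<tau> p, snd e s) = (sec c e d \<circ> chart_inv j) p"
      using inv k_mem(4)[OF ce] by (simp add: sec_def)
  qed
  then show "(sec c e d \<circ> chart_inv j) holomorphic_on ?V"
    using cholomorphic_on_iff_holomorphic_on[OF op] by blast
qed

lemma open_fst_k: "(c, e) \<in> ad \<Longrightarrow> openin (mtop R) (fst (k c))"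
  by (rule rsm.open_chart[OF fc_atlas])

text \<open>By \<open>u_decomposition\<close>, \<open>sec\<close> in either adapted chart is
  \<open>u\<close> minus the push-forward of a primitive of \<theta>. Independence of the primitive
  is thus the independence of the chart that \<open>common_value\<close> requires.\<close>

lemma characteristic_map_eq:
  assumes ce: "(c, e) \<in> ad" and x: "x \<in> fst (k c)"
  shows "characteristic_map X S Y f \<beta> s \<xi> x = normal_class R Y \<beta> (sec c e) x"
proof -
  let ?F = "\<lambda>(c, e). normal_class R Y \<beta> (\<lambda>d y. wirt (0, \<xi> e) (snd d \<circ> \<beta> \<circ> chart_inv c) (snd c y)) x"
  have F: "?F (c, e) = normal_class R Y \<beta> (sec c e) x" for c e
    by (simp add: sec_def[abs_def] B_def)
  have "common_value {(c, e) \<in> ad. x \<in> fst c} ?F = ?F (c, e)"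
  proof (rule common_value_eq)
    show "(c, e) \<in> {(c, e) \<in> ad. x \<in> fst c}" using ce k_mem(1)[OF ce x] by blast
    fix j assume "j \<in> {(c, e) \<in> ad. x \<in> fst c}"
    then obtain c' e' where j: "j = (c', e')" and ce': "(c', e') \<in> ad" and x': "x \<in> fst c'" by blast
    have x': "x \<in> fst (k c')" using fc_mem[OF ce'] x' k_mem(2)[OF ce x] by blast
    show "?F j = ?F (c, e)"
      unfolding j F
      by (rule rsm.normal_class_primitive_independent[OF open_fst_k[OF ce'] open_fst_k[OF ce] x' x
            vf_smooth[OF ce'] vf_dbar[OF ce'] vf_smooth[OF ce] vf_dbar[OF ce] sec_holo[OF ce']
            u_decomposition[OF ce'] u_decomposition[OF ce]])
  qed
  moreover have "x \<in> fiber_set X f s" using x by (simp add: fiber_chart_def)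
  ultimately show ?thesis unfolding characteristic_map_def F by simp
qed

lemma correspondence: "corresponds R Y \<beta> (h s) u (characteristic_map X S Y f \<beta> s \<xi>)"
  unfolding corresponds_def
proof (intro conjI bexI[OF _ \<theta>_harmonic] u_generalized_harmonic u_dbar ballI allI impI)
  let ?n = "characteristic_map X S Y f \<beta> s \<xi>"
  have "?n \<in> extensional (points R)" by (simp add: characteristic_map_def points_fiber)
  moreover have "\<exists>W \<sigma>. openin (mtop R) W \<and> x \<in> W \<and> holo_pb_section R Y \<beta> W \<sigma> \<and>
      (\<forall>y\<in>W. ?n y = normal_class R Y \<beta> \<sigma> y)" if xR: "x \<in> points R" for x
  proof -
    obtain c e where ce: "(c, e) \<in> ad" "x \<in> fst (k c)" using points_R[OF xR] by blast
    show ?thesis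
      using open_fst_k[OF ce(1)] ce(2) sec_holo[OF ce(1)] characteristic_map_eq[OF ce(1)]
      by (intro exI[of _ "fst (k c)"] exI[of _ "sec c e"]) blast
  qed
  ultimately show "?n \<in> normal_sections R Y \<beta>" by (simp add: normal_sections_def)
next
  fix x assume "x \<in> points R"
  then obtain c e where ce: "(c, e) \<in> ad" "x \<in> fst (k c)" using points_R by blast
  then show "\<exists>U \<eta>. openin (mtop R) U \<and> x \<in> U \<and> smooth_vector_field R U \<eta> \<and> dbar_vector_field R U \<eta> \<theta>"
    using open_fst_k[OF ce(1)] vf_smooth[OF ce(1)] vf_dbar[OF ce(1)] by blast
next
  fix U \<eta> x
  assume A: "openin (mtop R) U \<and> smooth_vector_field R U \<eta> \<and> dbar_vector_field R U \<eta> \<theta>" and x: "x \<in> U"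
  then have "x \<in> points R" using openin_subset by blast
  then obtain c e where ce: "(c, e) \<in> ad" "x \<in> fst (k c)" using points_R by blast
  \<comment> \<open>The given primitive \<eta> on \<open>U\<close> is compared with the particular
    primitive \<open>vf c e\<close> near \<open>x\<close>, for which the remainder of
    \<open>u\<close> is \<open>sec c e\<close>.\<close>
  have "normal_class R Y \<beta> (sec c e) x = normal_class R Y \<beta> (\<lambda>d y. u d y - push_vector_field R \<beta> \<eta> d y) x"
    by (rule rsm.normal_class_primitive_independent[OF open_fst_k[OF ce(1)] _ ce(2) x
          vf_smooth[OF ce(1)] vf_dbar[OF ce(1)] _ _ sec_holo[OF ce(1)] u_decomposition[OF ce(1)]])
      (use A in auto)
  then show "characteristic_map X S Y f \<beta> s \<xi> x = normal_class R Y \<beta> (\<lambda>d y. u d y - push_vector_field R \<beta> \<eta> d y) x"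
    using characteristic_map_eq[OF ce] by simp
qed

end

theorem proposition4p2:
  fixes X :: "('x, complex \<times> (complex ^ 'n)) manifold"
    and S :: "('s, complex ^ 'n) manifold"
    and Y :: "('y, complex) manifold"
    and f :: "'x \<Rightarrow> 's" and \<beta> :: "'x \<Rightarrow> 'y"
    and h :: "'s \<Rightarrow> ('x, complex) chart \<Rightarrow> 'x \<Rightarrow> real"
    and s :: 's and \<xi> :: "('s, complex ^ 'n) chart \<Rightarrow> complex ^ 'n"
  assumes "compact_riemann_surface Y"
    and "family_of_coverings X S Y f \<beta>"
    and "\<forall>t\<in>points S. \<exists>g>1. has_genus (fiber X S f t) g"
    and "hyperbolic_metric_family X S f h"
    and "s \<in> points S"
    and "tangent_vector S s \<xi>"
  shows "push_horizontal_lift X S f \<beta> h \<xi> \<in> generalized_harmonic (fiber X S f s) Y \<beta> (h s) \<and>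
         corresponds (fiber X S f s) Y \<beta> (h s)
           (push_horizontal_lift X S f \<beta> h \<xi>) (characteristic_map X S Y f \<beta> s \<xi>)"
proof -
  interpret covering_family_at X S Y f \<beta> h s \<xi>
    using assms by unfold_locales (auto simp: family_of_coverings_def compact_riemann_surface_def)
  show ?thesis
    using u_generalized_harmonic correspondence unfolding u_def by blast
qed

end
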